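(* Let $Y(\mathbb{R})$ be a translation-invariant Banach function space and let $w$ be either $w_1(x)=e^{cx}$, or $w_2(x)=e^{c\varphi(x)}$, where $c>0$ and $\varphi:\mathbb{R}\to\mathbb{R}$ satisfies $\varphi(x)=x$ for $x\le0$ and $\frac{\varphi(z)-\varphi(x)}{z-x}\ge1$ for all $z>x\ge0$. (a) The normed space $\mathcal{M}_{Y(\mathbb{R},w)}$ is not complete with respect to $\|\cdot\|_{\mathcal{M}_{Y(\mathbb{R},w)}}$. (b) The normed algebra $\mathcal{M}^0_{Y(\mathbb{R},w)}$ is not complete with respect to $\|\cdot\|_{\mathcal{M}^0_{Y(\mathbb{R},w)}}$.
   Context: Banach function spaces on $\mathbb{R}$: let $\mathfrak{M}^+$ be the set of measurable functions with values in $[0,\infty]$. A Banach function norm $\rho:\mathfrak{M}^+\to[0,\infty]$ satisfies, for all $f,g,f_j\in\mathfrak{M}^+$, $a\ge0$, measurable $E$: (A1) $\rho(f)=0\iff f=0$ a.e., $\rho(af)=a\rho(f)$, $\rho(f+g)\le\rho(f)+\rho(g)$; (A2) $0\le g\le f$ a.e. implies $\rho(g)\le\rho(f)$; (A3) $0\le f_j\uparrow f$ a.e. implies $\rho(f_j)\uparrow\rho(f)$; (A4) $|E|<\infty$ implies $\rho(\chi_E)<\infty$; (A5) $|E|<\infty$ implies $\int_Ef\le C_E\rho(f)$ with $C_E$ independent of $f$. $Y(\mathbb{R})$ is the set of measurable complex $f$ with $\rho(|f|)<\infty$, $\|f\|_Y=\rho(|f|)$; translation-invariant means $\|u(\cdot-y)\|_Y=\|u\|_Y$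 for all $y$, $u\in Y$. $Y(\mathbb{R},w)=\{f: fw\in Y\}$ with norm $\|fw\|_Y$. Fourier transform: $(Fu)(\xi)=\int u(x)e^{-ix\xi}dx$. For a normed function space $Z$: $\mathcal{M}_{Z}$ is the set of $a\in S'(\mathbb{R})$ with $\|a\|_{\mathcal{M}_Z}:=\sup\{\|F^{-1}aFu\|_{Z}/\|u\|_{Z}: u\in (S(\mathbb{R})\cap Z)\setminus\{0\}\}<\infty$ (Fourier transforms on $S$, $S'$); $\mathcal{M}^0_{Z}$ is the set of $a\in L^\infty(\mathbb{R})$ with $\|a\|_{\mathcal{M}^0_Z}:=\sup\{\|F^{-1}aFu\|_{Z}/\|u\|_{Z}: u\in (L^2(\mathbb{R})\cap Z)\setminus\{0\}\}<\infty$, with $F^{\pm1}$ on $L^2(\mathbb{R})$. $\mathcal{M}^0_Z$ is a normed algebra under pointwise multiplication. *)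

theory Defs
  imports "HOL-Analysis.Analysis"
begin

definition banach_function_norm :: "((real \<Rightarrow> ennreal) \<Rightarrow> ennreal) \<Rightarrow> bool" where
  "banach_function_norm \<rho> \<longleftrightarrow>
    \<comment> \<open>(A1)\<close>
    (\<forall>f \<in> borel_measurable lebesgue. \<rho> f = 0 \<longleftrightarrow> (AE x in lebesgue. f x = 0)) \<and>
    (\<forall>f \<in> borel_measurable lebesgue. \<forall>a::real. a \<ge> 0 \<longrightarrow>
        \<rho> (\<lambda>x. ennreal a * f x) = ennreal a * \<rho> f) \<and>
    (\<forall>f \<in> borel_measurable lebesgue. \<forall>g \<in> borel_measurable lebesgue.
        \<rho> (\<lambda>x. f x + g x) \<le> \<rho> f + \<rho> g) \<and>
    \<comment> \<open>(A2)\<close>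
    (\<forall>f \<in> borel_measurable lebesgue. \<forall>g \<in> borel_measurable lebesgue.
        (AE x in lebesgue. g x \<le> f x) \<longrightarrow> \<rho> g \<le> \<rho> f) \<and>
    \<comment> \<open>(A3)\<close>
    (\<forall>F :: nat \<Rightarrow> real \<Rightarrow> ennreal. \<forall>f \<in> borel_measurable lebesgue.
        (\<forall>j. F j \<in> borel_measurable lebesgue) \<longrightarrow>
        (AE x in lebesgue. incseq (\<lambda>j. F j x) \<and> (SUP j. F j x) = f x) \<longrightarrow>
        incseq (\<lambda>j. \<rho> (F j)) \<and> (SUP j. \<rho> (F j)) = \<rho> f) \<and>
    \<comment> \<open>(A4)\<close>
    (\<forall>E \<in> sets lebesgue. emeasure lebesgue E < \<infinity> \<longrightarrow> \<rho> (indicator E) < \<infinity>) \<and>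
    \<comment> \<open>(A5)\<close>
    (\<forall>E \<in> sets lebesgue. emeasure lebesgue E < \<infinity> \<longrightarrow>
        (\<exists>C::real. \<forall>f \<in> borel_measurable lebesgue.
            (\<integral>\<^sup>+x. f x * indicator E x \<partial>lebesgue) \<le> ennreal C * \<rho> f))"

definition in_Y :: "((real \<Rightarrow> ennreal) \<Rightarrow> ennreal) \<Rightarrow> (real \<Rightarrow> complex) \<Rightarrow> bool" where
  "in_Y \<rho> f \<longleftrightarrow> f \<in> borel_measurable lebesgue \<and> \<rho> (\<lambda>x. ennreal (cmod (f x))) < \<infinity>"

definition translation_invariant :: "((real \<Rightarrow> ennreal) \<Rightarrow> ennreal) \<Rightarrow> bool" where
  "translation_invariant \<rho> \<longleftrightarrow>
    (\<forall>u. in_Y \<rho> u \<longrightarrow> (\<forall>y::real.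
        \<rho> (\<lambda>x. ennreal (cmod (u (x - y)))) = \<rho> (\<lambda>x. ennreal (cmod (u x)))))"

text \<open>Norm of the weighted space Y(R,w): the value of rho at |f| w, i.e. the norm of f w in Y;
  it equals infinity exactly when f is not in Y(R,w) (non-measurable f is given norm infinity).\<close>

definition wnorm :: "((real \<Rightarrow> ennreal) \<Rightarrow> ennreal) \<Rightarrow> (real \<Rightarrow> real) \<Rightarrow> (real \<Rightarrow> complex) \<Rightarrow> ennreal" where
  "wnorm \<rho> w f = (if (\<lambda>x. f x * complex_of_real (w x)) \<in> borel_measurable lebesgue
      then \<rho> (\<lambda>x. ennreal (cmod (f x) * w x)) else \<infinity>)"

definition vderiv_iter :: "nat \<Rightarrow> (real \<Rightarrow> complex) \<Rightarrow> real \<Rightarrow> complex" where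
  "vderiv_iter m = ((\<lambda>g x. vector_derivative g (at x)) ^^ m)"

definition schwartz :: "(real \<Rightarrow> complex) set" where
  "schwartz = {f. (\<forall>m x. vderiv_iter m f differentiable (at x)) \<and>
      (\<forall>k m. \<exists>C. \<forall>x. \<bar>x\<bar> ^ k * cmod (vderiv_iter m f x) \<le> C)}"

definition schwartz_seminorm :: "nat \<Rightarrow> nat \<Rightarrow> (real \<Rightarrow> complex) \<Rightarrow> real" where
  "schwartz_seminorm k m f = (SUP x. \<bar>x\<bar> ^ k * cmod (vderiv_iter m f x))"

text \<open>A tempered distribution is represented by its action on Schwartz functions
  (a continuous linear functional on S(R)); values on non-Schwartz functions are irrelevant.\<close>

definition tempered :: "((real \<Rightarrow> complex) \<Rightarrow> complex) \<Rightarrow> bool" where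
  "tempered a \<longleftrightarrow>
    (\<forall>f \<in> schwartz. \<forall>g \<in> schwartz. a (\<lambda>x. f x + g x) = a f + a g) \<and>
    (\<forall>f \<in> schwartz. \<forall>c::complex. a (\<lambda>x. c * f x) = c * a f) \<and>
    (\<exists>C N. \<forall>f \<in> schwartz.
        cmod (a f) \<le> C * (\<Sum>k\<le>N. \<Sum>m\<le>N. schwartz_seminorm k m f))"

definition fourier :: "(real \<Rightarrow> complex) \<Rightarrow> real \<Rightarrow> complex" where
  "fourier u \<xi> = integral\<^sup>L lebesgue (\<lambda>x. u x * cis (- (x * \<xi>)))"

text \<open>For a tempered distribution a and a Schwartz function u, F^{-1} a F u is the function
  x |-> (1/(2 pi)) a(xi |-> (F u)(xi) e^{i x xi}).\<close>

definition fm_op_S :: "((real \<Rightarrow> complex) \<Rightarrow> complex) \<Rightarrow> (real \<Rightarrow> complex) \<Rightarrow> real \<Rightarrow> complex" where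
  "fm_op_S a u x = complex_of_real (1 / (2 * pi)) * a (\<lambda>\<xi>. fourier u \<xi> * cis (x * \<xi>))"

definition mult_norm_S ::
  "((real \<Rightarrow> ennreal) \<Rightarrow> ennreal) \<Rightarrow> (real \<Rightarrow> real) \<Rightarrow> ((real \<Rightarrow> complex) \<Rightarrow> complex) \<Rightarrow> ennreal" where
  "mult_norm_S \<rho> w a =
     (SUP u \<in> {u \<in> schwartz. wnorm \<rho> w u < \<infinity> \<and> u \<noteq> (\<lambda>_. 0)}.
        wnorm \<rho> w (fm_op_S a u) / wnorm \<rho> w u)"

definition multipliers_S ::
  "((real \<Rightarrow> ennreal) \<Rightarrow> ennreal) \<Rightarrow> (real \<Rightarrow> real) \<Rightarrow> ((real \<Rightarrow> complex) \<Rightarrow> complex) set" where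
  "multipliers_S \<rho> w = {a. tempered a \<and> mult_norm_S \<rho> w a < \<infinity>}"

definition square_integrable :: "(real \<Rightarrow> complex) \<Rightarrow> bool" where
  "square_integrable f \<longleftrightarrow> f \<in> borel_measurable lebesgue \<and>
     (\<integral>\<^sup>+x. ennreal ((cmod (f x))\<^sup>2) \<partial>lebesgue) < \<infinity>"

definition L2_limit :: "(nat \<Rightarrow> real \<Rightarrow> complex) \<Rightarrow> (real \<Rightarrow> complex) \<Rightarrow> bool" where
  "L2_limit G h \<longleftrightarrow> h \<in> borel_measurable lebesgue \<and>
     (\<lambda>n. \<integral>\<^sup>+x. ennreal ((cmod (h x - G n x))\<^sup>2) \<partial>lebesgue) \<longlonglongrightarrow> 0"

definition fourier_L2 :: "(real \<Rightarrow> complex) \<Rightarrow> real \<Rightarrow> complex" where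
  "fourier_L2 u = (SOME h. L2_limit (\<lambda>n \<xi>. integral\<^sup>L lebesgue
       (\<lambda>x. indicator {- real n..real n} x * (u x * cis (- (x * \<xi>))))) h)"

definition inv_fourier_L2 :: "(real \<Rightarrow> complex) \<Rightarrow> real \<Rightarrow> complex" where
  "inv_fourier_L2 g = (SOME h. L2_limit (\<lambda>n x. complex_of_real (1 / (2 * pi)) * integral\<^sup>L lebesgue
       (\<lambda>\<xi>. indicator {- real n..real n} \<xi> * (g \<xi> * cis (x * \<xi>)))) h)"

definition essentially_bounded :: "(real \<Rightarrow> complex) \<Rightarrow> bool" where
  "essentially_bounded a \<longleftrightarrow> a \<in> borel_measurable lebesgue \<and>
     (\<exists>C. AE x in lebesgue. cmod (a x) \<le> C)"

definition fm_op_L2 :: "(real \<Rightarrow> complex) \<Rightarrow> (real \<Rightarrow> complex) \<Rightarrow> real \<Rightarrow> complex" where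
  "fm_op_L2 a u = inv_fourier_L2 (\<lambda>\<xi>. a \<xi> * fourier_L2 u \<xi>)"

definition mult_norm_L2 ::
  "((real \<Rightarrow> ennreal) \<Rightarrow> ennreal) \<Rightarrow> (real \<Rightarrow> real) \<Rightarrow> (real \<Rightarrow> complex) \<Rightarrow> ennreal" where
  "mult_norm_L2 \<rho> w a =
     (SUP u \<in> {u. square_integrable u \<and> wnorm \<rho> w u < \<infinity> \<and> \<not> (AE x in lebesgue. u x = 0)}.
        wnorm \<rho> w (fm_op_L2 a u) / wnorm \<rho> w u)"

definition multipliers_L2 ::
  "((real \<Rightarrow> ennreal) \<Rightarrow> ennreal) \<Rightarrow> (real \<Rightarrow> real) \<Rightarrow> (real \<Rightarrow> complex) set" where
  "multipliers_L2 \<rho> w = {a. essentially_bounded a \<and> mult_norm_L2 \<rho> w a < \<infinity>}"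

definition not_complete_wrt :: "'a set \<Rightarrow> ('a \<Rightarrow> 'a \<Rightarrow> ennreal) \<Rightarrow> bool" where
  "not_complete_wrt X d \<longleftrightarrow>
    (\<exists>s :: nat \<Rightarrow> 'a. (\<forall>n. s n \<in> X) \<and>
       (\<forall>\<epsilon>>0. \<exists>N. \<forall>m\<ge>N. \<forall>n\<ge>N. d (s m) (s n) < ennreal \<epsilon>) \<and>
       \<not> (\<exists>b \<in> X. (\<lambda>n. d (s n) b) \<longlonglongrightarrow> 0))"

definition admissible_phi :: "(real \<Rightarrow> real) \<Rightarrow> bool" where
  "admissible_phi \<phi> \<longleftrightarrow> (\<forall>x\<le>0. \<phi> x = x) \<and>
     (\<forall>x z. 0 \<le> x \<and> x < z \<longrightarrow> (\<phi> z - \<phi> x) / (z - x) \<ge> 1)"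

end

theory Submission
  imports Defs "HOL-Probability.Characteristic_Functions" "HOL-Probability.Sinc_Integral"
begin

text \<open>Both spaces fail to contain the limit of the same sequence of trigonometric polynomials
  \<open>a\<^sub>n(\<xi>) = (\<Sum>j<n. exp(c j / 2) exp(i j \<xi>))\<close>, whose operators are sums of left translations
  \<open>u \<mapsto> (\<Sum>j<n. exp(c j / 2) u(x + j))\<close>. Since \<open>\<phi>(x + t) \<ge> \<phi>(x) + t\<close>, a left translation by \<open>j\<close>
  has norm at most \<open>exp(- c j)\<close> on the weighted space, so the sequence is Cauchy. Applied to a function \<open>u\<close>
  supported in \<open>[0,1]\<close>, a limit would have to agree with \<open>exp(c j / 2) u(x + j)\<close> on \<open>(- j, 1 - j)\<close> for every \<open>j\<close>.
  This grows exponentially as \<open>x \<rightarrow> - \<infinity>\<close>: it is not square integrable, which excludes a bounded limit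
  symbol, and not polynomially bounded, which excludes a tempered limit distribution.\<close>

section \<open>The Fourier transform of integrable functions\<close>

text \<open>The mechanism is one-sided: a left translation carries a function to where the weight is
  smaller, so the weighted norm tolerates growth near minus infinity that neither symbol class can
  produce. A hypothetical limit symbol is never compared with the \<open>a\<^sub>n\<close>
  themselves; only its action on a single \<open>u\<close> enters. The translates of
  \<open>u\<close> live on unit intervals with disjoint interiors, so on each interval one summand
  survives, and monotonicity of the norm reduces convergence of the whole sum to equality on that
  interval. The labour lies in making "operator with symbol \<open>a\<^sub>n\<close>" mean "sum of
  translations" for both definitions. On Schwartz functions this is pointwise Fourier inversion. On
  \<open>L^2\<close> both transforms are chosen by \<open>SOME\<close> as limits of truncated
  integrals, so they are accessible only through pairings with test functions, and even linearity in
  the symbol holds only almost everywhere. Hence the development of inversion, a Bessel bound,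
  completeness of \<open>L^2\<close>, and smooth compactly supported test functions. The two weights
  enter only through one shift inequality, and the first weight is the case
  \<open>\<phi> x = x\<close> of the second.\<close>

lemma sigma_finite_lebesgue: "sigma_finite_measure (lebesgue :: 'a::euclidean_space measure)"
proof -
  obtain A :: "'a set set" where "countable A" "A \<subseteq> sets lborel" "\<Union>A = space lborel"
      "\<forall>a\<in>A. emeasure lborel a \<noteq> \<infinity>"
    using lborel.sigma_finite_countable by blast
  then show ?thesis
    by (intro sigma_finite_measure.intro exI[of _ A])
       (auto simp: emeasure_completion main_part_sets dest: subsetD)
qed

text \<open>All integrals in the definitions are over the completed measure, so Fubini is set up for
  that measure rather than for \<open>lborel\<close>.\<close>

interpretation lebesgue_pair: pair_sigma_finite "lebesgue :: real measure" "lebesgue :: real measure"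
  by (intro pair_sigma_finite.intro sigma_finite_lebesgue)

lemma borel_measurable_cis [measurable]: "cis \<in> borel_measurable borel"
  by (intro borel_measurable_continuous_onI continuous_intros)

lemma measurable_lebesgue_ident: "(\<lambda>x. x) \<in> lebesgue \<rightarrow>\<^sub>M (borel :: 'a::euclidean_space measure)"
  by (simp add: measurable_completion)

section \<open>Gaussians and their transforms\<close>

text \<open>The substitution \<open>t = s * \<xi>\<close> turns the integral into the characteristic
  function of the standard normal distribution. The result is written as \<open>2 * pi\<close> times
  a normal density of deviation \<open>s\<close>, because that density is an approximate identity as
  \<open>s\<close> tends to 0.\<close>

lemma fourier_gaussian:
  assumes s: "s > 0"
  shows "fourier (\<lambda>\<xi>. complex_of_real (exp (- (s * \<xi>)\<^sup>2 / 2))) y = of_real (2 * pi * normal_density 0 s y)"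
proof -
  have "fourier (\<lambda>\<xi>. complex_of_real (exp (- (s * \<xi>)\<^sup>2 / 2))) y
      = (\<integral>\<xi>. complex_of_real (exp (- (s * \<xi>)\<^sup>2 / 2)) * cis (- (\<xi> * y)) \<partial>lborel)"
    unfolding fourier_def by (intro integral_completion) measurable
  also have "\<dots> = (1 / s) *\<^sub>R (\<integral>t. complex_of_real (exp (- t\<^sup>2 / 2)) * cis (- (t * (y / s))) \<partial>lborel)"
    using s by (subst lborel_integral_real_affine[of "1/s" _ 0]) auto
  also have "(\<integral>t. complex_of_real (exp (- t\<^sup>2 / 2)) * cis (- (t * (y / s))) \<partial>lborel)
     = complex_of_real (sqrt (2 * pi)) * (\<integral>t. std_normal_density t *\<^sub>R iexp (- y / s * t) \<partial>lborel)"
    by (subst integral_mult_right_zero[symmetric])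
       (auto simp: std_normal_density_def cis_conv_exp scaleR_conv_of_real mult_ac intro!: Bochner_Integration.integral_cong)
  also have "(\<integral>t. std_normal_density t *\<^sub>R iexp (- y / s * t) \<partial>lborel) = char std_normal_distribution (- y / s)"
    unfolding char_def by (subst integral_density) auto
  also have "\<dots> = complex_of_real (exp (- (y / s)\<^sup>2 / 2))"
    by (simp add: char_std_normal_distribution)
  also have "(1 / s) *\<^sub>R (complex_of_real (sqrt (2 * pi)) * \<dots>) = of_real (2 * pi * normal_density 0 s y)"
  proof -
    have "2 * pi / sqrt (2 * pi * s\<^sup>2) = sqrt (2 * pi) / s"
      using s by (simp add: real_sqrt_mult field_simps)
    moreover have "2 * pi * normal_density 0 s y = 2 * pi / sqrt (2 * pi * s\<^sup>2) * exp (- (y / s)\<^sup>2 / 2)"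
      by (simp add: normal_density_def power_divide mult.commute[of 2 "s\<^sup>2"])
    ultimately have "1 / s * (sqrt (2 * pi) * exp (- (y / s)\<^sup>2 / 2)) = 2 * pi * normal_density 0 s y"
      by simp
    then show ?thesis
      by (simp add: scaleR_conv_of_real flip: of_real_mult of_real_divide)
  qed
  finally show ?thesis .
qed

lemma integrable_gaussian:
  assumes s: "s > 0"
  shows "integrable lebesgue (\<lambda>\<xi>. complex_of_real (exp (- (s * \<xi>)\<^sup>2 / 2)))"
proof -
  have "integrable lborel (\<lambda>\<xi>. sqrt (2 * pi / s\<^sup>2) * normal_density 0 (1 / s) \<xi>)"
    by (intro integrable_mult_right integrable_normal_density) (use s in auto)
  also have "(\<lambda>\<xi>. sqrt (2 * pi / s\<^sup>2) * normal_density 0 (1 / s) \<xi>) = (\<lambda>\<xi>. exp (- (s * \<xi>)\<^sup>2 / 2))"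
    using s by (auto simp: normal_density_def power_mult_distrib power_divide field_simps real_sqrt_mult real_sqrt_divide)
  finally show ?thesis
    by (intro integrable_of_real integrable_completion[THEN iffD2]) auto
qed

declare measurable_lebesgue_ident [measurable]

lemma measurable_lebesgue_affine:
  fixes f :: "real \<Rightarrow> 'b::topological_space"
  assumes "f \<in> lebesgue \<rightarrow>\<^sub>M M" "c \<noteq> 0"
  shows "(\<lambda>x. f (t + c * x)) \<in> lebesgue \<rightarrow>\<^sub>M M"
  using measurable_compose[OF lebesgue_affine_measurable[where c="\<lambda>x::real. c"] assms(1)] assms(2)
  by simp

lemma integrable_mult_bounded:
  fixes f g :: "'a \<Rightarrow> complex"
  assumes "integrable M f" "g \<in> borel_measurable M" "\<And>x. cmod (g x) \<le> C"
  shows "integrable M (\<lambda>x. f x * g x)"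
proof (rule Bochner_Integration.integrable_bound)
  show "integrable M (\<lambda>x. C * cmod (f x))" using assms by simp
  show "(\<lambda>x. f x * g x) \<in> borel_measurable M" using assms by simp
  have "0 \<le> C" using assms(3) norm_ge_zero order_trans by blast
  then show "AE x in M. norm (f x * g x) \<le> norm (C * cmod (f x))"
    using assms(3) by (auto simp: norm_mult mult.commute[of C] abs_mult intro!: AE_I2 mult_left_mono)
qed

lemma fourier_measurable [measurable]:
  assumes [measurable]: "u \<in> borel_measurable lebesgue"
  shows "fourier u \<in> borel_measurable lebesgue"
  unfolding fourier_def by measurable

lemma norm_fourier_le:
  shows "cmod (fourier u \<xi>) \<le> (\<integral>x. cmod (u x) \<partial>lebesgue)"
  unfolding fourier_def
  by (rule order_trans[OF integral_norm_bound]) (simp add: norm_mult)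

text \<open>Fubini for the absolutely integrable kernel
  \<open>f x * g \<xi> * cis (- (x * \<xi>))\<close>. This symmetry of the transform is the tool
  behind inversion, the Bessel bound and all pairings on \<open>L^2\<close>.\<close>

lemma fourier_multiplication_formula:
  assumes f: "integrable lebesgue f" and g: "integrable lebesgue g"
  shows "(\<integral>\<xi>. fourier f \<xi> * g \<xi> \<partial>lebesgue) = (\<integral>x. f x * fourier g x \<partial>lebesgue)"
proof -
  have [measurable]: "f \<in> borel_measurable lebesgue" "g \<in> borel_measurable lebesgue"
    using f g by auto
  let ?h = "\<lambda>x \<xi>. f x * g \<xi> * cis (- (x * \<xi>))"
  have "integrable (lebesgue \<Otimes>\<^sub>M lebesgue) (case_prod ?h)"
  proof (rule lebesgue_pair.Fubini_integrable)
    have "(\<lambda>x. \<integral>\<xi>. norm (case (x, \<xi>) of (x, \<xi>) \<Rightarrow> ?h x \<xi>) \<partial>lebesgue)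
        = (\<lambda>x. cmod (f x) * (\<integral>\<xi>. cmod (g \<xi>) \<partial>lebesgue))"
      by (simp add: norm_mult)
    then show "integrable lebesgue (\<lambda>x. \<integral>\<xi>. norm (case (x, \<xi>) of (x, \<xi>) \<Rightarrow> ?h x \<xi>) \<partial>lebesgue)"
      using f by simp
    show "AE x in lebesgue. integrable lebesgue (\<lambda>\<xi>. case (x, \<xi>) of (x, \<xi>) \<Rightarrow> ?h x \<xi>)"
      using g by (auto intro!: AE_I2 integrable_mult_bounded[where C=1 and f="\<lambda>\<xi>. f _ * g \<xi>"])
  qed measurable
  from lebesgue_pair.Fubini_integral[OF this]
  have "(\<integral>\<xi>. (\<integral>x. ?h x \<xi> \<partial>lebesgue) \<partial>lebesgue) = (\<integral>x. (\<integral>\<xi>. ?h x \<xi> \<partial>lebesgue) \<partial>lebesgue)" .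
  moreover have "(\<integral>x. ?h x \<xi> \<partial>lebesgue) = fourier f \<xi> * g \<xi>" for \<xi>
    unfolding fourier_def by (subst integral_mult_left_zero[symmetric]) (simp add: mult_ac)
  moreover have "(\<integral>\<xi>. ?h x \<xi> \<partial>lebesgue) = f x * fourier g x" for x
    unfolding fourier_def by (subst integral_mult_right_zero[symmetric]) (simp add: mult_ac)
  ultimately show ?thesis by simp
qed

lemma fourier_modulation: "fourier (\<lambda>\<xi>. f \<xi> * cis (x * \<xi>)) y = fourier f (y - x)"
  unfolding fourier_def by (simp add: mult.assoc cis_mult algebra_simps)

lemma fourier_reflect: "fourier (\<lambda>x. f (- x)) \<xi> = fourier f (- \<xi>)"
  unfolding fourier_def
  using lebesgue_integral_real_affine[of "-1" "\<lambda>x. f x * cis (x * \<xi>)" 0] by simp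

text \<open>The multiplication formula with a modulated Gaussian as second factor, whose transform
  is \<open>2 * pi\<close> times the normal density centred at \<open>x\<close>. The damping makes
  the left side meaningful even when \<open>fourier f\<close> is not integrable.\<close>

lemma fourier_regularized_inversion:
  fixes f :: "real \<Rightarrow> complex"
  assumes f: "integrable lebesgue f" and s: "s > 0"
  shows "(\<integral>\<xi>. fourier f \<xi> * (of_real (exp (- (s * \<xi>)\<^sup>2 / 2)) * cis (x * \<xi>)) \<partial>lebesgue)
       = 2 * pi * (\<integral>y. f y * of_real (normal_density 0 s (y - x)) \<partial>lebesgue)"
proof -
  have "integrable lebesgue (\<lambda>\<xi>. of_real (exp (- (s * \<xi>)\<^sup>2 / 2)) * cis (x * \<xi>))"
    using integrable_gaussian[OF s] by (rule integrable_mult_bounded[where C=1]) auto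
  from fourier_multiplication_formula[OF f this] show ?thesis
    unfolding fourier_modulation fourier_gaussian[OF s]
    by (simp add: mult.left_commute[of "f _"])
qed

text \<open>The regularized identity is evaluated along widths \<open>1 / (n + 1)\<close> and both
  sides converge: the left by domination with \<open>cmod (fourier f \<xi>)\<close>, the right by
  continuity of \<open>f\<close> at \<open>x\<close>. Continuity everywhere yields equality at every
  point. Writing the inverse transform as \<open>fourier\<close> at \<open>- x\<close> keeps a
  single operator in play.\<close>

theorem fourier_inversion:
  fixes f :: "real \<Rightarrow> complex"
  assumes f: "integrable lebesgue f" and F: "integrable lebesgue (fourier f)"
    and cont: "\<And>x. isCont f x" and bdd: "\<And>x. cmod (f x) \<le> B"
  shows "fourier (fourier f) (- x) = 2 * pi * f x"
proof (rule LIMSEQ_unique)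
  let ?s = "\<lambda>n::nat. 1 / real (Suc n)"
  let ?L = "\<lambda>n. \<integral>\<xi>. fourier f \<xi> * (of_real (exp (- (?s n * \<xi>)\<^sup>2 / 2)) * cis (x * \<xi>)) \<partial>lebesgue"
  have [measurable]: "f \<in> borel_measurable lebesgue" using f by auto
  have s0: "?s \<longlonglongrightarrow> 0" by (rule LIMSEQ_Suc[OF lim_1_over_n])
  have "?L \<longlonglongrightarrow> (\<integral>\<xi>. fourier f \<xi> * cis (x * \<xi>) \<partial>lebesgue)"
  proof (rule integral_dominated_convergence[where w="\<lambda>\<xi>. cmod (fourier f \<xi>)"])
    show "AE \<xi> in lebesgue. (\<lambda>n. fourier f \<xi> * (of_real (exp (- (?s n * \<xi>)\<^sup>2 / 2)) * cis (x * \<xi>)))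
        \<longlonglongrightarrow> fourier f \<xi> * cis (x * \<xi>)"
    proof (rule AE_I2)
      fix \<xi> :: real
      have "(\<lambda>n. fourier f \<xi> * (of_real (exp (- (?s n * \<xi>)\<^sup>2 / 2)) * cis (x * \<xi>)))
        \<longlonglongrightarrow> fourier f \<xi> * (of_real (exp (- (0 * \<xi>)\<^sup>2 / 2)) * cis (x * \<xi>))"
        by (intro tendsto_intros s0) auto
      then show "(\<lambda>n. fourier f \<xi> * (of_real (exp (- (?s n * \<xi>)\<^sup>2 / 2)) * cis (x * \<xi>)))
        \<longlonglongrightarrow> fourier f \<xi> * cis (x * \<xi>)" by simp
    qed
    show "integrable lebesgue (\<lambda>\<xi>. cmod (fourier f \<xi>))" using F by simp
    show "AE \<xi> in lebesgue. cmod (fourier f \<xi> * (of_real (exp (- (?s n * \<xi>)\<^sup>2 / 2)) * cis (x * \<xi>)))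
        \<le> cmod (fourier f \<xi>)" for n
      by (auto simp: norm_mult intro!: AE_I2 mult_left_le)
    show "(\<lambda>\<xi>. fourier f \<xi> * cis (x * \<xi>)) \<in> borel_measurable lebesgue" by measurable
    show "(\<lambda>\<xi>. fourier f \<xi> * (of_real (exp (- (?s n * \<xi>)\<^sup>2 / 2)) * cis (x * \<xi>))) \<in> borel_measurable lebesgue" for n
      by measurable
  qed
  then show "?L \<longlonglongrightarrow> fourier (fourier f) (- x)"
    unfolding fourier_def[of _ "-x"] by (simp add: mult.commute)
  \<comment> \<open>The substitution \<open>y = x + s * t\<close> replaces the shrinking density by
    the fixed standard one, so that the width survives only in the argument of \<open>f\<close> and
    dominated convergence applies.\<close>
  have "?L n = 2 * pi * (\<integral>t. f (x + ?s n * t) * of_real (std_normal_density t) \<partial>lebesgue)" for n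
  proof -
    have "?L n = 2 * pi * (\<integral>y. f y * of_real (normal_density 0 (?s n) (y - x)) \<partial>lebesgue)"
      by (rule fourier_regularized_inversion[OF f]) auto
    also have "(\<integral>y. f y * of_real (normal_density 0 (?s n) (y - x)) \<partial>lebesgue)
       = ?s n *\<^sub>R (\<integral>t. f (x + ?s n * t) * of_real (normal_density 0 (?s n) (?s n * t)) \<partial>lebesgue)"
      by (subst lebesgue_integral_real_affine[of "?s n" _ x]) auto
    also have "\<dots> = (\<integral>t. f (x + ?s n * t) * of_real (std_normal_density t) \<partial>lebesgue)"
    proof -
      have "?s n * normal_density 0 (?s n) (?s n * t) = std_normal_density t" for t
        by (auto simp: normal_density_def real_sqrt_mult real_sqrt_divide power_divide field_simps simp del: of_nat_Suc)
      moreover have "?s n *\<^sub>R (f (x + ?s n * t) * of_real d) = f (x + ?s n * t) * of_real (?s n * d)" for t d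
        by (simp only: scaleR_conv_of_real of_real_mult mult_ac)
      ultimately show ?thesis
        by (simp only: integral_scaleR_right[symmetric])
    qed
    finally show ?thesis .
  qed
  moreover have "(\<lambda>n. \<integral>t. f (x + ?s n * t) * of_real (std_normal_density t) \<partial>lebesgue)
       \<longlonglongrightarrow> (\<integral>t. f x * of_real (std_normal_density t) \<partial>lebesgue)"
  proof (rule integral_dominated_convergence[where w="\<lambda>t. B * std_normal_density t"])
    have i: "integrable lebesgue std_normal_density"
      by (intro integrable_completion[THEN iffD2]) auto
    then show "integrable lebesgue (\<lambda>t. B * std_normal_density t)" by simp
    show "(\<lambda>t. f x * of_real (std_normal_density t)) \<in> borel_measurable lebesgue" by measurable
    have "(\<lambda>t. f (x + ?s n * t)) \<in> borel_measurable lebesgue" for n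
      by (rule measurable_lebesgue_affine) auto
    then show "(\<lambda>t. f (x + ?s n * t) * of_real (std_normal_density t)) \<in> borel_measurable lebesgue" for n
      by measurable
    show "AE t in lebesgue. (\<lambda>n. f (x + ?s n * t) * of_real (std_normal_density t))
       \<longlonglongrightarrow> f x * of_real (std_normal_density t)"
    proof (rule AE_I2, intro tendsto_mult tendsto_const)
      fix t :: real
      have "(\<lambda>n. x + ?s n * t) \<longlonglongrightarrow> x + 0 * t" by (intro tendsto_intros s0)
      then show "(\<lambda>n. f (x + ?s n * t)) \<longlonglongrightarrow> f x"
        using isCont_tendsto_compose[OF cont[of x]] by simp
    qed
    show "AE t in lebesgue. cmod (f (x + ?s n * t) * of_real (std_normal_density t)) \<le> B * std_normal_density t" for n
      using bdd by (auto simp: norm_mult intro!: mult_right_mono)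
  qed
  moreover have "(\<integral>t. f x * of_real (std_normal_density t) \<partial>lebesgue) = f x"
  proof -
    have "(\<integral>t. complex_of_real (std_normal_density t) \<partial>lebesgue) = of_real (\<integral>t. std_normal_density t \<partial>lborel)"
      by (subst integral_completion) auto
    also have "\<dots> = 1" by (subst integral_normal_density) auto
    finally show ?thesis by simp
  qed
  ultimately have "(\<lambda>n. 2 * pi * (\<integral>t. f (x + ?s n * t) * of_real (std_normal_density t) \<partial>lebesgue))
      \<longlonglongrightarrow> 2 * pi * f x" and "?L = (\<lambda>n. 2 * pi * (\<integral>t. f (x + ?s n * t) * of_real (std_normal_density t) \<partial>lebesgue))"
    by (simp_all only: tendsto_mult tendsto_const)
  then show "?L \<longlonglongrightarrow> 2 * pi * f x"
    by (simp only:)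
qed

section \<open>The square norm bound for transforms of integrable functions\<close>

lemma nn_integral_normal_density:
  assumes "s > 0"
  shows "(\<integral>\<^sup>+y. ennreal (normal_density x s y) \<partial>lebesgue) = 1"
  using assms by (simp add: nn_integral_completion nn_integral_eq_integral)

text \<open>With the Gaussian weight no density argument is needed: the weighted integral is the quadratic form of
  the heat kernel at \<open>f\<close>, which Young's inequality bounds by the square norm of \<open>f\<close>.\<close>

lemma fourier_bessel_gaussian:
  assumes f: "integrable lebesgue f" and s: "s > 0"
  shows "(\<integral>\<^sup>+\<xi>. ennreal ((cmod (fourier f \<xi>))\<^sup>2 * exp (- (s * \<xi>)\<^sup>2 / 2)) \<partial>lebesgue)
       \<le> ennreal (2 * pi) * (\<integral>\<^sup>+x. ennreal ((cmod (f x))\<^sup>2) \<partial>lebesgue)"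
proof -
  have [measurable]: "f \<in> borel_measurable lebesgue" using f by auto
  let ?G = "\<lambda>\<xi>. complex_of_real (exp (- (s * \<xi>)\<^sup>2 / 2))"
  let ?n = "\<lambda>x y. normal_density 0 s (y - x)"
  let ?B = "\<integral>x. cmod (f x) \<partial>lebesgue"
  \<comment> \<open>The reflection is chosen so that
    \<open>fourier (\<lambda>x. cnj (f x)) \<xi>\<close> equals the conjugate of
    \<open>fourier f (- \<xi>)\<close>; its product with \<open>g\<close> is then a squared modulus
    times the Gaussian, while \<open>fourier g\<close> is the heat kernel applied to
    \<open>f\<close>.\<close>
  define g where "g = (\<lambda>\<xi>. fourier f (- \<xi>) * ?G \<xi>)"
  have refl: "fourier (\<lambda>x. cnj (f x)) \<xi> = cnj (fourier f (- \<xi>))" for \<xi>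
    unfolding fourier_def by (subst Bochner_Integration.integral_cnj[symmetric]) (simp add: cis_cnj)
  have [measurable]: "(\<lambda>\<xi>. fourier f (- \<xi>)) \<in> borel_measurable lebesgue"
    using measurable_lebesgue_affine[of "fourier f" borel "-1" 0] by simp
  have g: "integrable lebesgue g"
    unfolding g_def using integrable_mult_bounded[OF integrable_gaussian[OF s], of "\<lambda>\<xi>. fourier f (- \<xi>)" ?B]
    by (simp add: norm_fourier_le mult.commute)
  have fg: "fourier g x = 2 * pi * (\<integral>y. f y * of_real (?n x y) \<partial>lebesgue)" for x
  proof -
    have "fourier g x = fourier (\<lambda>\<xi>. fourier f \<xi> * ?G \<xi>) (- x)"
      unfolding g_def fourier_reflect[symmetric] by simp
    then show ?thesis
      using fourier_regularized_inversion[OF f s, of x] unfolding fourier_def[of _ "-x"]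
      by (simp add: mult_ac)
  qed
  have i1: "integrable lebesgue (\<lambda>\<xi>. (cmod (fourier f \<xi>))\<^sup>2 * exp (- (s * \<xi>)\<^sup>2 / 2))"
  proof (rule Bochner_Integration.integrable_bound)
    show "integrable lebesgue (\<lambda>\<xi>. ?B\<^sup>2 * exp (- (s * \<xi>)\<^sup>2 / 2))"
      using integrable_gaussian[OF s] complex_of_real_integrable_eq by (intro integrable_mult_right) blast
    show "AE \<xi> in lebesgue. norm ((cmod (fourier f \<xi>))\<^sup>2 * exp (- (s * \<xi>)\<^sup>2 / 2)) \<le> norm (?B\<^sup>2 * exp (- (s * \<xi>)\<^sup>2 / 2))"
      by (auto simp: abs_mult intro!: power_mono norm_fourier_le)
  qed measurable
  have "(\<integral>x. cnj (f x) * fourier g x \<partial>lebesgue) = (\<integral>\<xi>. fourier (\<lambda>x. cnj (f x)) \<xi> * g \<xi> \<partial>lebesgue)"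
    using f g by (intro fourier_multiplication_formula[symmetric]) auto
  also have "\<dots> = (\<integral>\<xi>. complex_of_real ((cmod (fourier f (-\<xi>)))\<^sup>2 * exp (- (s * \<xi>)\<^sup>2 / 2)) \<partial>lebesgue)"
    by (intro Bochner_Integration.integral_cong)
       (auto simp: refl g_def complex_norm_square simp del: of_real_power)
  also have "\<dots> = complex_of_real (\<integral>\<xi>. (cmod (fourier f \<xi>))\<^sup>2 * exp (- (s * \<xi>)\<^sup>2 / 2) \<partial>lebesgue)"
    using lebesgue_integral_real_affine[of "-1" "\<lambda>\<xi>. (cmod (fourier f \<xi>))\<^sup>2 * exp (- (s * \<xi>)\<^sup>2 / 2)" 0]
    by (simp del: of_real_mult of_real_power)
  finally have eq: "cmod (\<integral>x. cnj (f x) * fourier g x \<partial>lebesgue) = (\<integral>\<xi>. (cmod (fourier f \<xi>))\<^sup>2 * exp (- (s * \<xi>)\<^sup>2 / 2) \<partial>lebesgue)"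
    by simp
  have "(\<integral>\<^sup>+\<xi>. ennreal ((cmod (fourier f \<xi>))\<^sup>2 * exp (- (s * \<xi>)\<^sup>2 / 2)) \<partial>lebesgue)
      = ennreal (cmod (\<integral>x. cnj (f x) * fourier g x \<partial>lebesgue))"
    unfolding eq by (rule nn_integral_eq_integral[OF i1]) auto
  also have "\<dots> \<le> (\<integral>\<^sup>+x. ennreal (cmod (cnj (f x) * fourier g x)) \<partial>lebesgue)"
    by (rule integral_norm_bound_ennreal) (use f g in \<open>auto intro!: integrable_mult_bounded norm_fourier_le\<close>)
  also have "\<dots> \<le> (\<integral>\<^sup>+x. ennreal pi * (\<integral>\<^sup>+y. (ennreal ((cmod (f x))\<^sup>2) + ennreal ((cmod (f y))\<^sup>2)) * ennreal (?n x y) \<partial>lebesgue) \<partial>lebesgue)"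
  proof (rule nn_integral_mono)
    fix x :: real
    have "ennreal (cmod (cnj (f x) * fourier g x)) = ennreal (2 * pi * cmod (f x)) * ennreal (cmod (\<integral>y. f y * of_real (?n x y) \<partial>lebesgue))"
      unfolding fg by (simp add: norm_mult mult_ac flip: ennreal_mult)
    also have "\<dots> \<le> ennreal (2 * pi * cmod (f x)) * (\<integral>\<^sup>+y. ennreal (cmod (f y * of_real (?n x y))) \<partial>lebesgue)"
    proof (intro mult_left_mono integral_norm_bound_ennreal integrable_mult_bounded[OF f])
      show "cmod (of_real (?n x y)) \<le> 1 / sqrt (2 * pi * s\<^sup>2)" for y
        by (simp add: normal_density_def norm_divide norm_mult divide_right_mono)
    qed auto
    also have "\<dots> = (\<integral>\<^sup>+y. ennreal (2 * pi * cmod (f x) * cmod (f y) * ?n x y) \<partial>lebesgue)"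
      by (subst nn_integral_cmult[symmetric]) (auto simp: norm_mult mult_ac simp flip: ennreal_mult)
    also have "\<dots> \<le> (\<integral>\<^sup>+y. ennreal pi * ((ennreal ((cmod (f x))\<^sup>2) + ennreal ((cmod (f y))\<^sup>2)) * ennreal (?n x y)) \<partial>lebesgue)"
    proof (rule nn_integral_mono)
      fix y
      \<comment> \<open>This splits the quadratic form into two parts, each depending on
        \<open>f\<close> in one variable only; the kernel then integrates to 1 in the other
        variable.\<close>
      have "2 * cmod (f x) * cmod (f y) \<le> (cmod (f x))\<^sup>2 + (cmod (f y))\<^sup>2"
        by (rule sum_squares_bound)
      then have "2 * cmod (f x) * cmod (f y) * (pi * ?n x y) \<le> ((cmod (f x))\<^sup>2 + (cmod (f y))\<^sup>2) * (pi * ?n x y)"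
        by (intro mult_right_mono) auto
      then show "ennreal (2 * pi * cmod (f x) * cmod (f y) * ?n x y)
          \<le> ennreal pi * ((ennreal ((cmod (f x))\<^sup>2) + ennreal ((cmod (f y))\<^sup>2)) * ennreal (?n x y))"
        by (simp add: ennreal_leI mult_ac flip: ennreal_plus ennreal_mult)
    qed
    finally show "ennreal (cmod (cnj (f x) * fourier g x)) \<le> ennreal pi * (\<integral>\<^sup>+y. (ennreal ((cmod (f x))\<^sup>2) + ennreal ((cmod (f y))\<^sup>2)) * ennreal (?n x y) \<partial>lebesgue)"
      by (subst nn_integral_cmult[symmetric]) auto
  qed
  also have "\<dots> = ennreal pi * ((\<integral>\<^sup>+x. \<integral>\<^sup>+y. ennreal ((cmod (f x))\<^sup>2) * ennreal (?n x y) \<partial>lebesgue \<partial>lebesgue)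
        + (\<integral>\<^sup>+x. \<integral>\<^sup>+y. ennreal ((cmod (f y))\<^sup>2) * ennreal (?n x y) \<partial>lebesgue \<partial>lebesgue))"
    by (simp add: nn_integral_cmult nn_integral_add distrib_right)
  also have "(\<integral>\<^sup>+x. \<integral>\<^sup>+y. ennreal ((cmod (f x))\<^sup>2) * ennreal (?n x y) \<partial>lebesgue \<partial>lebesgue)
       = (\<integral>\<^sup>+x. ennreal ((cmod (f x))\<^sup>2) \<partial>lebesgue)"
  proof -
    have "(\<integral>\<^sup>+y. ennreal (?n x y) \<partial>lebesgue) = 1" for x
      using nn_integral_normal_density[OF s, of x] by (simp add: normal_density_def)
    then show ?thesis by (simp add: nn_integral_cmult)
  qed
  also have "(\<integral>\<^sup>+x. \<integral>\<^sup>+y. ennreal ((cmod (f y))\<^sup>2) * ennreal (?n x y) \<partial>lebesgue \<partial>lebesgue)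
       = (\<integral>\<^sup>+y. \<integral>\<^sup>+x. ennreal ((cmod (f y))\<^sup>2) * ennreal (?n x y) \<partial>lebesgue \<partial>lebesgue)"
    by (rule lebesgue_pair.Fubini'[symmetric]) measurable
  also have "\<dots> = (\<integral>\<^sup>+x. ennreal ((cmod (f x))\<^sup>2) \<partial>lebesgue)"
  proof -
    have "(\<integral>\<^sup>+x. ennreal (?n x y) \<partial>lebesgue) = 1" for y
      using nn_integral_normal_density[OF s, of y] by (simp add: normal_density_def power2_commute)
    then show ?thesis by (simp add: nn_integral_cmult)
  qed
  also have "ennreal pi * ((\<integral>\<^sup>+x. ennreal ((cmod (f x))\<^sup>2) \<partial>lebesgue) + (\<integral>\<^sup>+x. ennreal ((cmod (f x))\<^sup>2) \<partial>lebesgue))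
     = ennreal (2 * pi) * (\<integral>\<^sup>+x. ennreal ((cmod (f x))\<^sup>2) \<partial>lebesgue)"
    by (simp add: ennreal_mult mult_2[symmetric] mult_ac)
  finally show ?thesis .
qed

text \<open>The Gaussian weights tend to 1 as the width parameter tends to 0, and Fatou carries the
  uniform bound to the limit.\<close>

theorem fourier_bessel:
  assumes f: "integrable lebesgue f"
  shows "(\<integral>\<^sup>+\<xi>. ennreal ((cmod (fourier f \<xi>))\<^sup>2) \<partial>lebesgue)
       \<le> ennreal (2 * pi) * (\<integral>\<^sup>+x. ennreal ((cmod (f x))\<^sup>2) \<partial>lebesgue)"
proof -
  have [measurable]: "f \<in> borel_measurable lebesgue" using f by auto
  let ?s = "\<lambda>n::nat. 1 / real (Suc n)"
  let ?h = "\<lambda>n \<xi>. ennreal ((cmod (fourier f \<xi>))\<^sup>2 * exp (- (?s n * \<xi>)\<^sup>2 / 2))"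
  have s0: "?s \<longlonglongrightarrow> 0" by (rule LIMSEQ_Suc[OF lim_1_over_n])
  have "(\<lambda>n. ?h n \<xi>) \<longlonglongrightarrow> ennreal ((cmod (fourier f \<xi>))\<^sup>2 * exp (- (0 * \<xi>)\<^sup>2 / 2))" for \<xi>
    by (intro tendsto_intros s0) auto
  then have "liminf (\<lambda>n. ?h n \<xi>) = ennreal ((cmod (fourier f \<xi>))\<^sup>2)" for \<xi>
    by (intro lim_imp_Liminf) auto
  then have "(\<integral>\<^sup>+\<xi>. ennreal ((cmod (fourier f \<xi>))\<^sup>2) \<partial>lebesgue) = (\<integral>\<^sup>+\<xi>. liminf (\<lambda>n. ?h n \<xi>) \<partial>lebesgue)"
    by simp
  also have "\<dots> \<le> liminf (\<lambda>n. \<integral>\<^sup>+\<xi>. ?h n \<xi> \<partial>lebesgue)"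
    by (rule nn_integral_liminf) measurable
  also have "\<dots> \<le> ennreal (2 * pi) * (\<integral>\<^sup>+x. ennreal ((cmod (f x))\<^sup>2) \<partial>lebesgue)"
    using fourier_bessel_gaussian[OF f, of "?s _"] by (intro Liminf_le) (auto intro!: always_eventually)
  finally show ?thesis .
qed

section \<open>The Fourier transform of square integrable functions\<close>

text \<open>The square is kept, without a root, and valued in \<open>ennreal\<close>: finiteness and
  convergence to 0 follow from the crude triangle inequality with factor 2, with measurability as
  the only side condition.\<close>

definition sqnorm :: "(real \<Rightarrow> complex) \<Rightarrow> ennreal" where
  "sqnorm f = (\<integral>\<^sup>+x. ennreal ((cmod (f x))\<^sup>2) \<partial>lebesgue)"

text \<open>The cut-off hidden in \<open>fourier_L2\<close> and \<open>inv_fourier_L2\<close>. A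
  truncated square integrable function is integrable, so that \<open>fourier\<close> applies to
  it.\<close>

definition truncate :: "nat \<Rightarrow> (real \<Rightarrow> complex) \<Rightarrow> real \<Rightarrow> complex" where
  "truncate n u x = indicator {- real n..real n} x * u x"

lemma square_integrable_iff:
  "square_integrable f \<longleftrightarrow> f \<in> borel_measurable lebesgue \<and> sqnorm f < \<infinity>"
  by (simp add: square_integrable_def sqnorm_def)

lemma L2_limit_iff:
  "L2_limit G h \<longleftrightarrow> h \<in> borel_measurable lebesgue \<and> (\<lambda>n. sqnorm (\<lambda>x. h x - G n x)) \<longlonglongrightarrow> 0"
  by (simp add: L2_limit_def sqnorm_def)

lemma sqnorm_mono: "(\<And>x. cmod (f x) \<le> cmod (g x)) \<Longrightarrow> sqnorm f \<le> sqnorm g"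
  unfolding sqnorm_def by (intro nn_integral_mono ennreal_leI power_mono) auto

lemma sqnorm_cmult:
  assumes [measurable]: "f \<in> borel_measurable lebesgue"
  shows "sqnorm (\<lambda>x. c * f x) = ennreal ((cmod c)\<^sup>2) * sqnorm f"
  unfolding sqnorm_def by (subst nn_integral_cmult[symmetric]) (auto simp: norm_mult power_mult_distrib ennreal_mult)

lemma sqnorm_affine:
  assumes "f \<in> borel_measurable lebesgue"  "\<bar>c\<bar> = 1"
  shows "sqnorm (\<lambda>x. f (t + c * x)) = sqnorm f"
proof -
  have "(\<lambda>x. ennreal ((cmod (f x))\<^sup>2)) \<in> borel_measurable lebesgue" using assms(1) by measurable
  from nn_integral_real_affine_lebesgue[OF this, of c t] show ?thesis
    using assms(2) by (simp add: sqnorm_def)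
qed

lemma sqnorm_add_le:
  assumes [measurable]: "f \<in> borel_measurable lebesgue" "g \<in> borel_measurable lebesgue"
  shows "sqnorm (\<lambda>x. f x + g x) \<le> 2 * sqnorm f + 2 * sqnorm g"
proof -
  have "ennreal ((cmod (f x + g x))\<^sup>2) \<le> 2 * ennreal ((cmod (f x))\<^sup>2) + 2 * ennreal ((cmod (g x))\<^sup>2)" for x
  proof -
    have "(cmod (f x + g x))\<^sup>2 \<le> (cmod (f x) + cmod (g x))\<^sup>2"
      by (intro power_mono norm_triangle_ineq) auto
    also have "\<dots> \<le> 2 * (cmod (f x))\<^sup>2 + 2 * (cmod (g x))\<^sup>2"
      using sum_squares_bound[of "cmod (f x)" "cmod (g x)"] by (simp add: power2_sum)
    finally have "ennreal ((cmod (f x + g x))\<^sup>2) \<le> ennreal (2 * (cmod (f x))\<^sup>2 + 2 * (cmod (g x))\<^sup>2)"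
      by (rule ennreal_leI)
    also have "\<dots> = 2 * ennreal ((cmod (f x))\<^sup>2) + 2 * ennreal ((cmod (g x))\<^sup>2)"
      by (simp add: ennreal_mult)
    finally show ?thesis .
  qed
  then have "sqnorm (\<lambda>x. f x + g x) \<le> (\<integral>\<^sup>+x. 2 * ennreal ((cmod (f x))\<^sup>2) + 2 * ennreal ((cmod (g x))\<^sup>2) \<partial>lebesgue)"
    unfolding sqnorm_def by (intro nn_integral_mono)
  also have "\<dots> = 2 * sqnorm f + 2 * sqnorm g"
    unfolding sqnorm_def by (simp add: nn_integral_add nn_integral_cmult)
  finally show ?thesis .
qed

lemma sqnorm_diff_le:
  assumes [measurable]: "f \<in> borel_measurable lebesgue" "g \<in> borel_measurable lebesgue"
  shows "sqnorm (\<lambda>x. f x - g x) \<le> 2 * sqnorm f + 2 * sqnorm g"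
  using sqnorm_add_le[of f "\<lambda>x. - g x"] by (simp add: sqnorm_def)

lemma square_integrable_add:
  assumes "square_integrable f" "square_integrable g"
  shows "square_integrable (\<lambda>x. f x + g x)"
  using assms sqnorm_add_le[of f g] unfolding square_integrable_iff
  by (auto intro: le_less_trans simp: ennreal_mult_less_top)

lemma square_integrable_cmult:
  "square_integrable f \<Longrightarrow> square_integrable (\<lambda>x. c * f x)"
  by (auto simp: square_integrable_iff sqnorm_cmult ennreal_mult_less_top)

lemma square_integrable_AE_bound:
  assumes "square_integrable f" "g \<in> borel_measurable lebesgue" "AE x in lebesgue. cmod (g x) \<le> C * cmod (f x)"
  shows "square_integrable g"
proof -
  have "cmod (g x) \<le> C * cmod (f x) \<Longrightarrow> ennreal ((cmod (g x))\<^sup>2) \<le> ennreal ((cmod (of_real C * f x))\<^sup>2)" for x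
    by (intro ennreal_leI power_mono) (auto simp: norm_mult intro: order_trans[OF _ mult_right_mono[OF abs_ge_self]])
  then have "sqnorm g \<le> sqnorm (\<lambda>x. of_real C * f x)"
    unfolding sqnorm_def by (intro nn_integral_mono_AE eventually_mono[OF assms(3)])
  with assms show ?thesis
    using square_integrable_cmult[OF assms(1), of "of_real C"]
    unfolding square_integrable_iff by (auto intro: le_less_trans)
qed

lemma square_integrable_bound:
  assumes "square_integrable f" "g \<in> borel_measurable lebesgue" "\<And>x. cmod (g x) \<le> C * cmod (f x)"
  shows "square_integrable g"
  using assms by (intro square_integrable_AE_bound[of f g C]) auto

lemma square_integrable_affine:
  assumes "square_integrable f" "\<bar>c\<bar> = 1"
  shows "square_integrable (\<lambda>x. f (t + c * x))"
  using assms sqnorm_affine[of f c t] measurable_lebesgue_affine[of f borel c t]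
  by (auto simp: square_integrable_iff)

section \<open>Completeness of \<open>L^2\<close> and convergence of pairings\<close>

lemma ennreal_tendsto_0I:
  fixes f :: "'a \<Rightarrow> ennreal"
  assumes "\<And>e::real. e > 0 \<Longrightarrow> eventually (\<lambda>x. f x \<le> ennreal e) F"
  shows "(f \<longlongrightarrow> 0) F"
proof (rule order_tendstoI)
  fix a :: ennreal assume "0 < a"
  then obtain e :: ennreal where e: "0 < e" "e < a" using dense by blast
  then obtain r where "e = ennreal r" "0 < r"
    by (cases e) auto
  then show "eventually (\<lambda>x. f x < a) F"
    using assms[of r] e by (auto elim!: eventually_mono)
qed auto

lemma ennreal_tendsto_0_sandwich:
  fixes f g :: "'a \<Rightarrow> ennreal"
  assumes "(g \<longlongrightarrow> 0) F" "\<And>x. f x \<le> g x"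
  shows "(f \<longlongrightarrow> 0) F"
  by (rule tendsto_sandwich[OF _ _ tendsto_const assms(1)]) (use assms(2) in auto)

text \<open>The Riesz-Fischer argument: a rapidly Cauchy subsequence converges almost everywhere,
  and Fatou along that subsequence bounds the distance of the limit to every late member of the full
  sequence.\<close>

lemma L2_complete:
  assumes [measurable]: "\<And>n. G n \<in> borel_measurable lebesgue"
    and cauchy: "\<And>\<epsilon>::real. \<epsilon> > 0 \<Longrightarrow> \<exists>N. \<forall>m\<ge>N. \<forall>n\<ge>N. sqnorm (\<lambda>x. G m x - G n x) \<le> ennreal \<epsilon>"
  shows "\<exists>h. L2_limit G h"
proof -
  obtain N where N: "\<And>k m n. m \<ge> N k \<Longrightarrow> n \<ge> N k \<Longrightarrow> sqnorm (\<lambda>x. G m x - G n x) \<le> ennreal ((1/4)^k)" for k :: nat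
    using cauchy[of "(1/4)^_"] by (simp, metis)
  \<comment> \<open>The thresholds \<open>N k\<close> need not be monotone. Their partial sums plus
    \<open>k\<close> are increasing and dominate both \<open>N k\<close> and
    \<open>k\<close>.\<close>
  define r where "r k = k + (\<Sum>i\<le>k. N i)" for k
  have r: "N k \<le> r k" "k \<le> r k" "r k \<le> r (Suc k)" for k
    using member_le_sum[of k "{..k}" N] by (auto simp: r_def)
  \<comment> \<open>Square-summability with weights \<open>2^k\<close> gives absolute summability of the increments.\<close>
  define D where "D k x = cmod (G (r (Suc k)) x - G (r k) x)" for k x
  have [measurable]: "D k \<in> borel_measurable lebesgue" for k
    unfolding D_def by measurable
  have "(\<integral>\<^sup>+x. (\<Sum>k. ennreal (2^k * (D k x)\<^sup>2)) \<partial>lebesgue) = (\<Sum>k. \<integral>\<^sup>+x. ennreal (2^k * (D k x)\<^sup>2) \<partial>lebesgue)"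
    by (rule nn_integral_suminf) measurable
  also have "\<dots> \<le> (\<Sum>k. ennreal ((1/2)^k))"
  proof (rule suminf_le)
    fix k
    have "(\<integral>\<^sup>+x. ennreal (2^k * (D k x)\<^sup>2) \<partial>lebesgue) = ennreal (2^k) * sqnorm (\<lambda>x. G (r (Suc k)) x - G (r k) x)"
      unfolding sqnorm_def D_def by (subst nn_integral_cmult[symmetric]) (auto simp: ennreal_mult)
    also have "\<dots> \<le> ennreal (2^k) * ennreal ((1/4)^k)"
      using r[of k] by (intro mult_left_mono N) auto
    also have "\<dots> = ennreal ((1/2)^k)"
      by (simp flip: ennreal_mult power_mult_distrib)
    finally show "(\<integral>\<^sup>+x. ennreal (2^k * (D k x)\<^sup>2) \<partial>lebesgue) \<le> ennreal ((1/2)^k)" .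
  qed auto
  also have "\<dots> = ennreal 2"
    by (intro suminf_ennreal_eq) (use power_half_series geometric_sums[of "1/2::real"] in auto)
  finally have "(\<integral>\<^sup>+x. (\<Sum>k. ennreal (2^k * (D k x)\<^sup>2)) \<partial>lebesgue) \<noteq> \<infinity>"
    by (auto simp: top_unique)
  then have "AE x in lebesgue. (\<Sum>k. ennreal (2^k * (D k x)\<^sup>2)) \<noteq> \<infinity>"
    by (intro nn_integral_PInf_AE) measurable
  then have conv: "AE x in lebesgue. convergent (\<lambda>k. G (r k) x)"
  proof eventually_elim
    case (elim x)
    then have "summable (\<lambda>k. 2^k * (D k x)\<^sup>2)"
      by (intro summable_suminf_not_top) auto
    then have S: "summable (\<lambda>k. 2^k * (D k x)\<^sup>2 + (1/2)^k)"
      by (intro summable_add summable_geometric) auto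
    \<comment> \<open>From \<open>(2^k * D k x - 1)^2 \<ge> 0\<close>: a summable weighted square
      controls the first power up to a geometric term.\<close>
    have "D k x \<le> 2^k * (D k x)\<^sup>2 + (1/2)^k" for k
    proof -
      have "0 \<le> (2^k * D k x - 1)\<^sup>2" by simp
      then have "2 * (2^k * D k x) \<le> (2^k * D k x)\<^sup>2 + 1"
        by (simp add: power2_diff)
      moreover have "0 \<le> 2^k * D k x" by (simp add: D_def)
      ultimately have "2^k * D k x \<le> 2^k * (2^k * (D k x)\<^sup>2 + (1/2)^k)"
        by (simp add: power_mult_distrib power2_eq_square algebra_simps flip: power_mult_distrib)
      then show ?thesis by (simp only: mult_le_cancel_left_pos zero_less_power zero_less_numeral)
    qed
    then have "summable (\<lambda>k. G (r (Suc k)) x - G (r k) x)"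
      by (intro summable_comparison_test'[OF S, of 0]) (auto simp: D_def)
    then have "convergent (\<lambda>n. \<Sum>k<n. G (r (Suc k)) x - G (r k) x)"
      by (simp add: summable_iff_convergent)
    then have "convergent (\<lambda>n. G (r n) x - G (r 0) x)"
      using sum_lessThan_telescope[of "\<lambda>k. G (r k) x"] by simp
    from convergent_add[OF this convergent_const[of "G (r 0) x"]] show ?case by simp
  qed
  define h where "h x = lim (\<lambda>k. G (r k) x)" for x
  have [measurable]: "h \<in> borel_measurable lebesgue"
    unfolding h_def by (rule borel_measurable_lim_metric) simp
  have "(\<lambda>n. sqnorm (\<lambda>x. h x - G n x)) \<longlonglongrightarrow> 0"
  proof (rule ennreal_tendsto_0I)
    fix e :: real assume "e > 0"
    then obtain M where M: "\<And>m n. m \<ge> M \<Longrightarrow> n \<ge> M \<Longrightarrow> sqnorm (\<lambda>x. G m x - G n x) \<le> ennreal e"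
      using cauchy by blast
    have "sqnorm (\<lambda>x. h x - G n x) \<le> ennreal e" if "n \<ge> M" for n
    proof -
      have "AE x in lebesgue. ennreal ((cmod (h x - G n x))\<^sup>2) = liminf (\<lambda>k. ennreal ((cmod (G (r k) x - G n x))\<^sup>2))"
        using conv
      proof eventually_elim
        case (elim x)
        then have "(\<lambda>k. G (r k) x) \<longlonglongrightarrow> h x" by (simp add: h_def convergent_LIMSEQ_iff)
        then have "(\<lambda>k. ennreal ((cmod (G (r k) x - G n x))\<^sup>2)) \<longlonglongrightarrow> ennreal ((cmod (h x - G n x))\<^sup>2)"
          by (intro tendsto_intros)
        then show ?case by (intro lim_imp_Liminf[symmetric]) auto
      qed
      then have "sqnorm (\<lambda>x. h x - G n x) = (\<integral>\<^sup>+x. liminf (\<lambda>k. ennreal ((cmod (G (r k) x - G n x))\<^sup>2)) \<partial>lebesgue)"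
        unfolding sqnorm_def by (rule nn_integral_cong_AE)
      also have "\<dots> \<le> liminf (\<lambda>k. sqnorm (\<lambda>x. G (r k) x - G n x))"
        unfolding sqnorm_def by (rule nn_integral_liminf) measurable
      also have "\<dots> \<le> ennreal e"
        using M[OF order_trans[OF _ r(2)] that]
        by (intro Liminf_le) (auto simp: eventually_sequentially)
      finally show ?thesis .
    qed
    then show "eventually (\<lambda>n. sqnorm (\<lambda>x. h x - G n x) \<le> ennreal e) sequentially"
      by (auto simp: eventually_sequentially)
  qed
  then show ?thesis
    unfolding L2_limit_iff by (intro exI[of _ h]) simp
qed

lemma truncate_measurable [measurable]:
  assumes [measurable]: "u \<in> borel_measurable lebesgue"
  shows "truncate n u \<in> borel_measurable lebesgue"
  unfolding truncate_def[abs_def] by measurable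

lemma norm_truncate_le: "cmod (truncate n u x) \<le> cmod (u x)"
  by (auto simp: truncate_def indicator_def)

lemma L2_limit_truncate:
  assumes u: "square_integrable u"
  shows "L2_limit (\<lambda>n. truncate n u) u"
proof -
  have [measurable]: "u \<in> borel_measurable lebesgue" and fin: "sqnorm u < \<infinity>"
    using u by (auto simp: square_integrable_iff)
  have "(\<lambda>n. \<integral>\<^sup>+x. ennreal ((cmod (u x - truncate n u x))\<^sup>2) \<partial>lebesgue) \<longlonglongrightarrow> (\<integral>\<^sup>+x. 0 \<partial>(lebesgue :: real measure))"
  proof (rule nn_integral_dominated_convergence[where w="\<lambda>x. ennreal ((cmod (u x))\<^sup>2)"])
    show "AE x in lebesgue. ennreal ((cmod (u x - truncate n u x))\<^sup>2) \<le> ennreal ((cmod (u x))\<^sup>2)" for n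
      by (auto simp: truncate_def indicator_def)
    show "AE x in lebesgue. (\<lambda>n. ennreal ((cmod (u x - truncate n u x))\<^sup>2)) \<longlonglongrightarrow> 0"
    proof (rule AE_I2, rule tendsto_eventually)
      fix x :: real
      obtain N :: nat where "\<bar>x\<bar> \<le> real N" using real_arch_simple by blast
      then show "eventually (\<lambda>n. ennreal ((cmod (u x - truncate n u x))\<^sup>2) = 0) sequentially"
        unfolding eventually_sequentially by (intro exI[of _ N]) (auto simp: truncate_def indicator_def)
    qed
  qed (use fin in \<open>auto simp: sqnorm_def\<close>)
  then show ?thesis by (auto simp: L2_limit_iff sqnorm_def)
qed

lemma integrable_mult_L2:
  assumes "square_integrable f" "square_integrable g"
  shows "integrable lebesgue (\<lambda>x. f x * g x)"
proof (rule Bochner_Integration.integrable_bound)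
  have [measurable]: "f \<in> borel_measurable lebesgue" "g \<in> borel_measurable lebesgue"
    using assms by (auto simp: square_integrable_iff)
  have "integrable lebesgue (\<lambda>x. (cmod (f x))\<^sup>2)" "integrable lebesgue (\<lambda>x. (cmod (g x))\<^sup>2)"
    using assms by (auto intro!: integrableI_nonneg simp: square_integrable_def)
  then show "integrable lebesgue (\<lambda>x. (cmod (f x))\<^sup>2 + (cmod (g x))\<^sup>2)" by simp
  show "(\<lambda>x. f x * g x) \<in> borel_measurable lebesgue" by measurable
  show "AE x in lebesgue. norm (f x * g x) \<le> norm ((cmod (f x))\<^sup>2 + (cmod (g x))\<^sup>2)"
  proof (rule AE_I2)
    fix x
    have "2 * (cmod (f x) * cmod (g x)) \<le> (cmod (f x))\<^sup>2 + (cmod (g x))\<^sup>2"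
      using sum_squares_bound[of "cmod (f x)" "cmod (g x)"] by (simp add: mult.assoc)
    moreover have "0 \<le> cmod (f x) * cmod (g x)" by simp
    ultimately show "norm (f x * g x) \<le> norm ((cmod (f x))\<^sup>2 + (cmod (g x))\<^sup>2)"
      by (simp only: norm_mult real_norm_def)
  qed
qed

lemma square_integrable_indicator: "square_integrable (indicator {a..b::real})"
proof -
  have "sqnorm (indicator {a..b}) = (\<integral>\<^sup>+x. indicator {a..b} x \<partial>lebesgue)"
    unfolding sqnorm_def by (intro nn_integral_cong) (auto split: split_indicator)
  also have "\<dots> = emeasure lebesgue {a..b}" by simp
  also have "\<dots> < \<infinity>" by (simp add: emeasure_lborel_Icc_eq)
  finally show ?thesis by (auto simp: square_integrable_iff)
qed

lemma truncate_integrable: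
  assumes "square_integrable u"
  shows "integrable lebesgue (truncate n u)"
  using integrable_mult_L2[OF square_integrable_indicator assms]
  unfolding truncate_def[abs_def] .

lemma square_integrable_truncate:
  "square_integrable u \<Longrightarrow> square_integrable (truncate n u)"
  by (rule square_integrable_bound[where C=1])
     (auto simp: norm_truncate_le square_integrable_iff)

lemma L2_limit_square_integrable:
  assumes "L2_limit G h" "\<And>n. square_integrable (G n)"
  shows "square_integrable h"
proof -
  have [measurable]: "h \<in> borel_measurable lebesgue" "G n \<in> borel_measurable lebesgue" for n
    using assms by (auto simp: L2_limit_iff square_integrable_iff)
  obtain n where n: "sqnorm (\<lambda>x. h x - G n x) < 1"
    using order_tendstoD(2)[of _ 0 _ 1] assms(1) unfolding L2_limit_iff eventually_sequentially by fastforce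
  have "square_integrable (\<lambda>x. (h x - G n x) + G n x)"
    using n assms by (intro square_integrable_add) (auto simp: square_integrable_iff intro: less_trans)
  then show ?thesis by simp
qed

lemma L2_limit_diff:
  assumes "L2_limit G h" "L2_limit G' h'"
    and [measurable]: "\<And>n. G n \<in> borel_measurable lebesgue" "\<And>n. G' n \<in> borel_measurable lebesgue"
  shows "L2_limit (\<lambda>n x. G n x - G' n x) (\<lambda>x. h x - h' x)"
proof -
  have [measurable]: "h \<in> borel_measurable lebesgue" "h' \<in> borel_measurable lebesgue"
    using assms by (auto simp: L2_limit_iff)
  have "(\<lambda>n. 2 * sqnorm (\<lambda>x. h x - G n x) + 2 * sqnorm (\<lambda>x. h' x - G' n x)) \<longlonglongrightarrow> 2 * 0 + 2 * 0"
    using assms by (intro tendsto_intros ennreal_tendsto_cmult) (auto simp: L2_limit_iff)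
  moreover have "sqnorm (\<lambda>x. (h x - h' x) - (G n x - G' n x)) \<le> 2 * sqnorm (\<lambda>x. h x - G n x) + 2 * sqnorm (\<lambda>x. h' x - G' n x)" for n
    using sqnorm_diff_le[of "\<lambda>x. h x - G n x" "\<lambda>x. h' x - G' n x"] by (simp add: algebra_simps)
  ultimately have "(\<lambda>n. sqnorm (\<lambda>x. (h x - h' x) - (G n x - G' n x))) \<longlonglongrightarrow> 0"
    by (auto elim: ennreal_tendsto_0_sandwich)
  then show ?thesis by (simp add: L2_limit_iff)
qed

text \<open>Since the transforms on \<open>L^2\<close> are picked by \<open>SOME\<close>, a limit is
  determined only up to a null set; this is the means of identifying two candidates.\<close>

lemma L2_limit_unique:
  assumes "L2_limit G h" "L2_limit G h'" and [measurable]: "\<And>n. G n \<in> borel_measurable lebesgue"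
  shows "AE x in lebesgue. h x = h' x"
proof -
  have [measurable]: "h \<in> borel_measurable lebesgue" "h' \<in> borel_measurable lebesgue"
    using assms by (auto simp: L2_limit_iff)
  have "(\<lambda>n. sqnorm (\<lambda>x. h x - h' x)) \<longlonglongrightarrow> 0"
    using L2_limit_diff[OF assms(1,2)] by (simp add: L2_limit_iff)
  then have "sqnorm (\<lambda>x. h x - h' x) = 0" by (simp add: LIMSEQ_const_iff)
  then show ?thesis by (simp add: sqnorm_def nn_integral_0_iff_AE)
qed

text \<open>Cauchy-Schwarz applied to \<open>h x - G n x\<close>. The pairing is bilinear, without a
  conjugate, to match the multiplication formula.\<close>

lemma L2_limit_pairing:
  assumes lim: "L2_limit G h" and G: "\<And>n. square_integrable (G n)" and \<phi>: "square_integrable \<phi>"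
  shows "(\<lambda>n. \<integral>x. G n x * \<phi> x \<partial>lebesgue) \<longlonglongrightarrow> (\<integral>x. h x * \<phi> x \<partial>lebesgue)"
proof -
  have h: "square_integrable h" using L2_limit_square_integrable[OF lim G] .
  have [measurable]: "h \<in> borel_measurable lebesgue" "\<phi> \<in> borel_measurable lebesgue" "G n \<in> borel_measurable lebesgue" for n
    using h \<phi> G by (auto simp: square_integrable_iff)
  let ?d = "\<lambda>n. (\<integral>x. h x * \<phi> x \<partial>lebesgue) - (\<integral>x. G n x * \<phi> x \<partial>lebesgue)"
  have "ennreal ((cmod (?d n))\<^sup>2) \<le> sqnorm (\<lambda>x. h x - G n x) * sqnorm \<phi>" for n
  proof -
    have i: "integrable lebesgue (\<lambda>x. (h x - G n x) * \<phi> x)"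
      using integrable_mult_L2[OF h \<phi>] integrable_mult_L2[OF G \<phi>] by (simp add: left_diff_distrib)
    have "?d n = (\<integral>x. (h x - G n x) * \<phi> x \<partial>lebesgue)"
      using integrable_mult_L2[OF h \<phi>] integrable_mult_L2[OF G \<phi>] by (simp add: left_diff_distrib)
    then have "ennreal (cmod (?d n)) \<le> (\<integral>\<^sup>+x. ennreal (cmod ((h x - G n x) * \<phi> x)) \<partial>lebesgue)"
      using integral_norm_bound_ennreal[OF i] by simp
    also have "\<dots> = (\<integral>\<^sup>+x. ennreal (cmod (h x - G n x)) * ennreal (cmod (\<phi> x)) \<partial>lebesgue)"
      by (simp add: norm_mult ennreal_mult)
    finally have "(ennreal (cmod (?d n)))\<^sup>2 \<le> (\<integral>\<^sup>+x. ennreal (cmod (h x - G n x)) * ennreal (cmod (\<phi> x)) \<partial>lebesgue)\<^sup>2"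
      by (rule power_mono) simp
    also have "\<dots> \<le> sqnorm (\<lambda>x. h x - G n x) * sqnorm \<phi>"
      using Cauchy_Schwarz_nn_integral[of "\<lambda>x. ennreal (cmod (h x - G n x))" lebesgue "\<lambda>x. ennreal (cmod (\<phi> x))"]
      by (simp add: sqnorm_def ennreal_power)
    finally show ?thesis by (simp add: ennreal_power)
  qed
  moreover have "(\<lambda>n. sqnorm \<phi> * sqnorm (\<lambda>x. h x - G n x)) \<longlonglongrightarrow> sqnorm \<phi> * 0"
    using lim \<phi> by (intro ennreal_tendsto_cmult) (auto simp: L2_limit_iff square_integrable_iff)
  ultimately have "(\<lambda>n. ennreal ((cmod (?d n))\<^sup>2)) \<longlonglongrightarrow> 0"
    by (auto simp only: mult.commute[of _ "sqnorm \<phi>"] mult_zero_right elim: ennreal_tendsto_0_sandwich)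
  then have "(\<lambda>n. (cmod (?d n))\<^sup>2) \<longlonglongrightarrow> 0"
    using tendsto_ennreal_iff[of "\<lambda>n. (cmod (?d n))\<^sup>2" sequentially 0] by simp
  then have "?d \<longlonglongrightarrow> 0"
    by (simp only: power_tendsto_0_iff[OF pos2] tendsto_norm_zero_iff)
  from tendsto_diff[OF tendsto_const[of "\<integral>x. h x * \<phi> x \<partial>lebesgue"] this] show ?thesis by simp
qed

section \<open>The transforms on \<open>L^2\<close> as limits of truncated integrals\<close>

lemma fourier_diff:
  assumes "integrable lebesgue f" "integrable lebesgue g"
  shows "fourier (\<lambda>x. f x - g x) = (\<lambda>\<xi>. fourier f \<xi> - fourier g \<xi>)"
proof
  fix \<xi>
  have "integrable lebesgue (\<lambda>x. f x * cis (- (x * \<xi>)))" "integrable lebesgue (\<lambda>x. g x * cis (- (x * \<xi>)))"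
    using assms by (auto intro!: integrable_mult_bounded[where C=1])
  then show "fourier (\<lambda>x. f x - g x) \<xi> = fourier f \<xi> - fourier g \<xi>"
    unfolding fourier_def by (simp add: left_diff_distrib)
qed

lemma square_integrable_fourier:
  assumes "integrable lebesgue f" "square_integrable f"
  shows "square_integrable (fourier f)"
  using fourier_bessel[OF assms(1)] assms(2)
  by (auto simp: square_integrable_def ennreal_mult_less_top intro: le_less_trans)

text \<open>The Bessel bound makes the truncated transforms Cauchy, so a limit exists and the choice
  in \<open>fourier_L2\<close> really selects one.\<close>

lemma fourier_L2_limit:
  assumes u: "square_integrable u"
  shows "L2_limit (\<lambda>n. fourier (truncate n u)) (fourier_L2 u)"
proof -
  have [measurable]: "u \<in> borel_measurable lebesgue" using u by (auto simp: square_integrable_iff)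
  have "\<exists>h. L2_limit (\<lambda>n. fourier (truncate n u)) h"
  proof (rule L2_complete)
    fix e :: real assume "e > 0"
    have "(\<lambda>n. sqnorm (\<lambda>x. u x - truncate n u x)) \<longlonglongrightarrow> 0"
      using L2_limit_truncate[OF u] by (simp add: L2_limit_iff)
    then have "eventually (\<lambda>n. sqnorm (\<lambda>x. u x - truncate n u x) < ennreal (e / (2 * pi))) sequentially"
      using \<open>e > 0\<close> by (intro order_tendstoD) auto
    then obtain N where N: "sqnorm (\<lambda>x. u x - truncate N u x) < ennreal (e / (2 * pi))"
      by (auto simp: eventually_sequentially)
    have "sqnorm (\<lambda>x. fourier (truncate m u) x - fourier (truncate n u) x) \<le> ennreal e" if "m \<ge> N" "n \<ge> N" for m n
    proof -
      have "sqnorm (\<lambda>x. fourier (truncate m u) x - fourier (truncate n u) x)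
          = sqnorm (fourier (\<lambda>x. truncate m u x - truncate n u x))"
        using u by (simp add: fourier_diff truncate_integrable)
      also have "\<dots> \<le> ennreal (2 * pi) * sqnorm (\<lambda>x. truncate m u x - truncate n u x)"
        unfolding sqnorm_def using u by (intro fourier_bessel Bochner_Integration.integrable_diff truncate_integrable)
      also have "\<dots> \<le> ennreal (2 * pi) * sqnorm (\<lambda>x. u x - truncate N u x)"
      proof (intro mult_left_mono sqnorm_mono)
        fix x
        \<comment> \<open>On \<open>[-N, N]\<close> both truncations equal \<open>u\<close> and the
          left side is 0; outside, \<open>u x - truncate N u x\<close> is all of \<open>u x\<close>,
          which dominates any difference of truncations.\<close>
        show "cmod (truncate m u x - truncate n u x) \<le> cmod (u x - truncate N u x)"
          using that by (cases "\<bar>x\<bar> \<le> real N") (auto simp: truncate_def abs_le_iff split: split_indicator)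
      qed auto
      also have "\<dots> \<le> ennreal (2 * pi) * ennreal (e / (2 * pi))"
        using N by (intro mult_left_mono) auto
      also have "\<dots> = ennreal e" using \<open>e > 0\<close> by (simp flip: ennreal_mult)
      finally show ?thesis .
    qed
    then show "\<exists>N. \<forall>m\<ge>N. \<forall>n\<ge>N. sqnorm (\<lambda>x. fourier (truncate m u) x - fourier (truncate n u) x) \<le> ennreal e"
      by blast
  qed measurable
  then have "L2_limit (\<lambda>n. fourier (truncate n u)) (SOME h. L2_limit (\<lambda>n. fourier (truncate n u)) h)"
    by (rule someI_ex)
  moreover have "fourier_L2 u = (SOME h. L2_limit (\<lambda>n. fourier (truncate n u)) h)"
    unfolding fourier_L2_def fourier_def truncate_def[abs_def] by (simp add: mult.assoc)
  ultimately show ?thesis by simp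
qed

lemma square_integrable_fourier_truncate:
  "square_integrable u \<Longrightarrow> square_integrable (fourier (truncate n u))"
  by (intro square_integrable_fourier truncate_integrable square_integrable_truncate)

lemma square_integrable_fourier_L2:
  "square_integrable u \<Longrightarrow> square_integrable (fourier_L2 u)"
  by (rule L2_limit_square_integrable[OF fourier_L2_limit square_integrable_fourier_truncate])

text \<open>The multiplication formula for truncations passes to the limit on both sides. It
  describes \<open>fourier_L2 u\<close> by its action on test functions, where no pointwise formula
  is available.\<close>

lemma fourier_L2_pairing:
  assumes u: "square_integrable u" and \<phi>: "integrable lebesgue \<phi>" "square_integrable \<phi>"
  shows "(\<integral>\<xi>. fourier_L2 u \<xi> * \<phi> \<xi> \<partial>lebesgue) = (\<integral>x. u x * fourier \<phi> x \<partial>lebesgue)"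
proof (rule LIMSEQ_unique)
  show "(\<lambda>n. \<integral>\<xi>. fourier (truncate n u) \<xi> * \<phi> \<xi> \<partial>lebesgue) \<longlonglongrightarrow> (\<integral>\<xi>. fourier_L2 u \<xi> * \<phi> \<xi> \<partial>lebesgue)"
    using L2_limit_pairing[OF fourier_L2_limit[OF u]] u \<phi> by (simp add: square_integrable_fourier_truncate)
  show "(\<lambda>n. \<integral>\<xi>. fourier (truncate n u) \<xi> * \<phi> \<xi> \<partial>lebesgue) \<longlonglongrightarrow> (\<integral>x. u x * fourier \<phi> x \<partial>lebesgue)"
    using L2_limit_pairing[OF L2_limit_truncate[OF u] _ square_integrable_fourier[OF \<phi>]]
      square_integrable_truncate[OF u] fourier_multiplication_formula[OF truncate_integrable[OF u] \<phi>(1)] by simp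
qed

text \<open>The truncated inverse integrals are the forward ones reflected and scaled by
  \<open>1 / (2 * pi)\<close>. Convergence is therefore inherited from
  \<open>fourier_L2_limit\<close>, because reflection preserves the square norm.\<close>

lemma inv_fourier_L2_limit:
  assumes g: "square_integrable g"
  shows "L2_limit (\<lambda>n x. of_real (1 / (2 * pi)) * fourier (truncate n g) (- x)) (inv_fourier_L2 g)"
proof -
  have [measurable]: "g \<in> borel_measurable lebesgue" using g by (auto simp: square_integrable_iff)
  have L: "L2_limit (\<lambda>n. fourier (truncate n g)) (fourier_L2 g)" by (rule fourier_L2_limit[OF g])
  then have [measurable]: "fourier_L2 g \<in> borel_measurable lebesgue" by (simp add: L2_limit_iff)
  define k where "k = complex_of_real (1 / (2 * pi))"
  have [measurable]: "(\<lambda>x. fourier_L2 g (-x)) \<in> borel_measurable lebesgue"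
     "(\<lambda>x. fourier (truncate n g) (-x)) \<in> borel_measurable lebesgue" for n
    using measurable_lebesgue_affine[of "fourier_L2 g" borel "-1" 0]
      measurable_lebesgue_affine[of "fourier (truncate n g)" borel "-1" 0] by auto
  have "sqnorm (\<lambda>x. k * fourier_L2 g (- x) - k * fourier (truncate n g) (- x))
     = ennreal ((cmod k)\<^sup>2) * sqnorm (\<lambda>x. fourier_L2 g x - fourier (truncate n g) x)" for n
    using sqnorm_affine[of "\<lambda>x. fourier_L2 g x - fourier (truncate n g) x" "-1" 0]
    by (simp add: right_diff_distrib[symmetric] sqnorm_cmult)
  moreover have "(\<lambda>n. ennreal ((cmod k)\<^sup>2) * sqnorm (\<lambda>x. fourier_L2 g x - fourier (truncate n g) x)) \<longlonglongrightarrow> ennreal ((cmod k)\<^sup>2) * 0"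
    using L by (intro ennreal_tendsto_cmult) (auto simp: L2_limit_iff)
  ultimately have "L2_limit (\<lambda>n x. k * fourier (truncate n g) (- x)) (\<lambda>x. k * fourier_L2 g (- x))"
    by (simp add: L2_limit_iff)
  then have "L2_limit (\<lambda>n x. k * fourier (truncate n g) (- x)) (SOME h. L2_limit (\<lambda>n x. k * fourier (truncate n g) (- x)) h)"
    by (rule someI[of "L2_limit (\<lambda>n x. k * fourier (truncate n g) (- x))"])
  moreover have "fourier v (- x) = (\<integral>\<xi>. v \<xi> * cis (x * \<xi>) \<partial>lebesgue)" for v x
    by (simp add: fourier_def mult.commute)
  then have "inv_fourier_L2 g = (SOME h. L2_limit (\<lambda>n x. k * fourier (truncate n g) (- x)) h)"
    unfolding inv_fourier_L2_def k_def truncate_def[abs_def] by (simp add: mult.assoc)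
  ultimately show ?thesis by (simp only: k_def)
qed

lemma square_integrable_inv_fourier_approx:
  assumes g: "square_integrable g"
  shows "square_integrable (\<lambda>x. of_real (1 / (2 * pi)) * fourier (truncate n g) (- x))"
proof (rule square_integrable_cmult)
  show "square_integrable (\<lambda>x. fourier (truncate n g) (- x))"
    using square_integrable_affine[OF square_integrable_fourier_truncate[OF g], of "-1" n 0] by simp
qed

lemma square_integrable_inv_fourier_L2:
  "square_integrable g \<Longrightarrow> square_integrable (inv_fourier_L2 g)"
  by (rule L2_limit_square_integrable[OF inv_fourier_L2_limit square_integrable_inv_fourier_approx])

text \<open>The reflection and the factor move to the test function and form its inverse transform
  there.\<close>

lemma inv_fourier_L2_pairing:
  assumes g: "square_integrable g" and \<phi>: "integrable lebesgue \<phi>" "square_integrable \<phi>"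
  shows "(\<integral>x. inv_fourier_L2 g x * \<phi> x \<partial>lebesgue) = (\<integral>\<xi>. g \<xi> * (of_real (1 / (2 * pi)) * fourier \<phi> (- \<xi>)) \<partial>lebesgue)"
proof (rule LIMSEQ_unique)
  let ?k = "complex_of_real (1 / (2 * pi))"
  let ?\<psi> = "\<lambda>\<xi>. ?k * fourier (\<lambda>x. \<phi> (- x)) \<xi>"
  have \<phi>': "integrable lebesgue (\<lambda>x. \<phi> (- x))"
    using lebesgue_integrable_real_affine[OF \<phi>(1), of "-1" 0] by simp
  have "square_integrable (\<lambda>x. \<phi> (- x))"
    using square_integrable_affine[OF \<phi>(2), of "-1" 0] by simp
  then have s: "square_integrable ?\<psi>"
    by (intro square_integrable_cmult square_integrable_fourier \<phi>')
  let ?a = "\<lambda>n. \<integral>x. ?k * fourier (truncate n g) (- x) * \<phi> x \<partial>lebesgue"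
  show "?a \<longlonglongrightarrow> (\<integral>x. inv_fourier_L2 g x * \<phi> x \<partial>lebesgue)"
    using L2_limit_pairing[OF inv_fourier_L2_limit[OF g] square_integrable_inv_fourier_approx[OF g] \<phi>(2)] by simp
  have "?a n = (\<integral>\<xi>. truncate n g \<xi> * ?\<psi> \<xi> \<partial>lebesgue)" for n
  proof -
    have "?a n = ?k * (\<integral>x. fourier (truncate n g) x * \<phi> (- x) \<partial>lebesgue)"
      using lebesgue_integral_real_affine[of "-1" "\<lambda>x. fourier (truncate n g) x * \<phi> (- x)" 0]
      by (simp add: mult.assoc)
    also have "\<dots> = ?k * (\<integral>x. truncate n g x * fourier (\<lambda>x. \<phi> (- x)) x \<partial>lebesgue)"
      using fourier_multiplication_formula[OF truncate_integrable[OF g] \<phi>'] by simp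
    finally show ?thesis by (simp add: mult.left_commute[of "truncate n g _"] )
  qed
  then show "?a \<longlonglongrightarrow> (\<integral>\<xi>. g \<xi> * (?k * fourier \<phi> (- \<xi>)) \<partial>lebesgue)"
    using L2_limit_pairing[OF L2_limit_truncate[OF g] _ s] square_integrable_truncate[OF g]
    by (simp only: fourier_reflect)
qed

text \<open>The approximating integrals are linear for each \<open>n\<close>, but the selected
  limits are not linear on the nose; uniqueness of limits gives the identity almost
  everywhere.\<close>

lemma inv_fourier_L2_diff:
  assumes g: "square_integrable f" "square_integrable g" "square_integrable (\<lambda>x. f x - g x)"
  shows "AE x in lebesgue. inv_fourier_L2 (\<lambda>x. f x - g x) x = inv_fourier_L2 f x - inv_fourier_L2 g x"
proof -
  let ?k = "complex_of_real (1 / (2 * pi))"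
  let ?A = "\<lambda>f n x. ?k * fourier (truncate n f) (- x)"
  have m: "?A h n \<in> borel_measurable lebesgue" if "square_integrable h" for h n
    using square_integrable_inv_fourier_approx[OF that] by (simp add: square_integrable_iff)
  have "?A f n x - ?A g n x = ?A (\<lambda>x. f x - g x) n x" for n x
  proof -
    have "truncate n (\<lambda>x. f x - g x) = (\<lambda>x. truncate n f x - truncate n g x)"
      by (auto simp: truncate_def right_diff_distrib)
    then show ?thesis
      using fourier_diff[OF truncate_integrable[OF g(1)] truncate_integrable[OF g(2)]]
      by (simp add: right_diff_distrib diff_divide_distrib)
  qed
  then have "L2_limit (?A (\<lambda>x. f x - g x)) (\<lambda>x. inv_fourier_L2 f x - inv_fourier_L2 g x)"
    using L2_limit_diff[OF inv_fourier_L2_limit[OF g(1)] inv_fourier_L2_limit[OF g(2)] m[OF g(1)] m[OF g(2)]] by simp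
  from L2_limit_unique[OF inv_fourier_L2_limit[OF g(3)] this m[OF g(3)]] show ?thesis .
qed

text \<open>Open intervals are closed under intersection and generate the Borel sets, so a Dynkin
  class argument extends vanishing from intervals to Borel sets. It is run on \<open>(-n, n)\<close>
  for each \<open>n\<close>, where the square integrable \<open>g\<close> is integrable.\<close>

lemma AE_zero_if_interval_integrals_zero:
  fixes g :: "real \<Rightarrow> complex"
  assumes g: "square_integrable g"
    and zero: "\<And>a b. (\<integral>x. g x * indicator {a<..<b} x \<partial>lebesgue) = 0"
  shows "AE x in lebesgue. g x = 0"
proof -
  have "sets borel = sets (sigma UNIV (range (\<lambda>(a,b). {a<..<b::real})))"
    by (simp only: borel_eq_box box_real)
  also have "\<dots> = sigma_sets UNIV (range (\<lambda>(a,b). {a<..<b::real}))"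
    by (rule sets_measure_of) simp
  finally have borel: "sigma_sets UNIV (range (\<lambda>(a,b). {a<..<b::real})) = sets borel" ..
  have "AE x in lebesgue. g x * indicator {- real n<..<real n} x = 0" for n :: nat
  proof -
    let ?I = "{- real n<..<real n}"
    let ?f = "\<lambda>x. g x * indicator ?I x"
    have "square_integrable (indicator ?I :: real \<Rightarrow> complex)"
      by (rule square_integrable_bound[OF square_integrable_indicator[of "- real n" "real n"], of _ 1])
         (auto simp: indicator_def)
    then have f: "integrable lebesgue ?f" by (rule integrable_mult_L2[OF g])
    have Int: "Int_stable (range (\<lambda>(a,b). {a<..<b::real}))"
    proof (rule Int_stableI)
      fix A B :: "real set"
      assume "A \<in> range (\<lambda>(a,b). {a<..<b})" "B \<in> range (\<lambda>(a,b). {a<..<b})"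
      then obtain a b c d where "A = {a<..<b}" "B = {c<..<d}" by auto
      then have "A \<inter> B = (\<lambda>(a,b). {a<..<b}) (max a c, min b d)" by simp
      then show "A \<inter> B \<in> range (\<lambda>(a,b). {a<..<b})" by (rule range_eqI)
    qed
    have Pow: "range (\<lambda>(a,b). {a<..<b::real}) \<subseteq> Pow UNIV" by simp
    have B: "set_lebesgue_integral lebesgue A ?f = 0"
      if A: "A \<in> sigma_sets UNIV (range (\<lambda>(a,b). {a<..<b::real}))" for A
      using Int Pow A
    proof (induction rule: sigma_sets_induct_disjoint)
      case (basic A)
      then obtain a b where "A = {a<..<b}" by auto
      then have "A \<inter> ?I = {max a (- real n)<..<min b (real n)}" by auto
      moreover have "set_lebesgue_integral lebesgue A ?f = (\<integral>x. g x * indicator (A \<inter> ?I) x \<partial>lebesgue)"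
        unfolding set_lebesgue_integral_def
        by (intro Bochner_Integration.integral_cong) (auto simp: indicator_def)
      ultimately show ?case using zero by simp
    next
      case empty
      then show ?case by (simp add: set_lebesgue_integral_def)
    next
      case (compl A)
      then have A: "A \<in> sets lebesgue"
        by (simp add: borel)
      have "set_lebesgue_integral lebesgue (UNIV - A) ?f = (\<integral>x. ?f x - indicat_real A x *\<^sub>R ?f x \<partial>lebesgue)"
        unfolding set_lebesgue_integral_def
        by (rule Bochner_Integration.integral_cong) (auto split: split_indicator)
      also have "\<dots> = (\<integral>x. ?f x \<partial>lebesgue) - set_lebesgue_integral lebesgue A ?f"
        unfolding set_lebesgue_integral_def
        by (rule Bochner_Integration.integral_diff[OF f integrable_mult_indicator[OF A f]])
      finally show ?case using compl zero by simp
    next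
      case (union A)
      then have A: "A i \<in> sets lebesgue" for i
        by (auto simp: borel)
      have "set_lebesgue_integral lebesgue (\<Union>i. A i) ?f = (\<Sum>i. set_lebesgue_integral lebesgue (A i) ?f)"
      proof (rule lebesgue_integral_countable_add)
        show "set_integrable lebesgue (\<Union>i. A i) ?f"
          unfolding set_integrable_def using A by (intro integrable_mult_indicator f) auto
      qed (use union A in \<open>auto simp: disjoint_family_on_def\<close>)
      then show ?case using union by simp
    qed
    \<comment> \<open>A Lebesgue set differs from a Borel set by a part of a Borel null set, which
      does not affect the integral.\<close>
    have "set_lebesgue_integral lebesgue A ?f = 0" if A: "A \<in> sets lebesgue" for A
    proof -
      obtain S N N' where S: "A = S \<union> N" "S \<in> sets lborel" "N' \<in> null_sets lborel" "N \<subseteq> N'"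
        using A by (rule sets_completionE)
      have N: "AE x in lebesgue. x \<notin> N"
        using S by (intro AE_completion AE_not_in[THEN eventually_mono, of N']) auto
      have [measurable]: "A \<in> sets lebesgue" "S \<in> sets lebesgue" "?f \<in> borel_measurable lebesgue"
        using A S f by auto
      have "set_lebesgue_integral lebesgue A ?f = set_lebesgue_integral lebesgue S ?f"
        unfolding set_lebesgue_integral_def
      proof (rule integral_cong_AE)
        show "AE x in lebesgue. indicat_real A x *\<^sub>R ?f x = indicat_real S x *\<^sub>R ?f x"
          using N by eventually_elim (auto simp: S(1) split: split_indicator)
      qed measurable
      also have "\<dots> = 0"
        using S(2) by (intro B) (simp add: borel)
      finally show ?thesis .
    qed
    then show ?thesis using sigma_finite_measure.density_zero[OF sigma_finite_lebesgue f] by blast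
  qed
  then have "AE x in lebesgue. \<forall>n::nat. g x * indicator {- real n<..<real n} x = 0"
    unfolding AE_all_countable by blast
  then show ?thesis
  proof eventually_elim
    case (elim x)
    obtain n :: nat where "\<bar>x\<bar> < real n" using reals_Archimedean2 by blast
    then show ?case using elim[rule_format, of n] by (auto simp: abs_less_iff)
  qed
qed

section \<open>Schwartz functions\<close>

abbreviation vderiv :: "(real \<Rightarrow> complex) \<Rightarrow> real \<Rightarrow> complex" where
  "vderiv f \<equiv> \<lambda>x. vector_derivative f (at x)"

lemma vderiv_iter_0 [simp]: "vderiv_iter 0 f = f"
  by (simp add: vderiv_iter_def)

lemma vderiv_iter_Suc: "vderiv_iter (Suc m) f = vderiv_iter m (vderiv f)"
  unfolding vderiv_iter_def by (subst funpow_Suc_right) simp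

text \<open>The definition speaks of all iterated derivatives. Exhibiting a family closed under one
  derivative, whose members decay rapidly, replaces every Leibniz formula for higher
  derivatives.\<close>

lemma schwartz_coinduct:
  assumes "f \<in> A"
    and diff: "\<And>g x. g \<in> A \<Longrightarrow> g differentiable at x"
    and deriv: "\<And>g. g \<in> A \<Longrightarrow> vderiv g \<in> A"
    and bound: "\<And>g k. g \<in> A \<Longrightarrow> \<exists>C. \<forall>x. \<bar>x\<bar> ^ k * cmod (g x) \<le> C"
  shows "f \<in> schwartz"
proof -
  have "vderiv_iter m g \<in> A" if "g \<in> A" for m g
    using that by (induction m arbitrary: g) (auto simp: vderiv_iter_Suc deriv)
  with assms show ?thesis by (auto simp: schwartz_def)
qed

lemma schwartz_vderiv: "f \<in> schwartz \<Longrightarrow> vderiv f \<in> schwartz"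
  by (auto simp: schwartz_def vderiv_iter_Suc[symmetric])

lemma schwartz_has_vector_derivative:
  assumes "f \<in> schwartz"
  shows "(f has_vector_derivative vderiv f x) (at x)"
proof -
  have "vderiv_iter 0 f differentiable at x" using assms unfolding schwartz_def by blast
  then show ?thesis by (simp add: vector_derivative_works)
qed

lemma schwartz_isCont: "f \<in> schwartz \<Longrightarrow> isCont f x"
  using schwartz_has_vector_derivative has_vector_derivative_continuous by blast

lemma schwartz_measurable:
  assumes "f \<in> schwartz"
  shows "f \<in> borel_measurable borel" "f \<in> borel_measurable lebesgue"
proof -
  show "f \<in> borel_measurable borel"
    using assms by (intro borel_measurable_continuous_onI continuous_at_imp_continuous_on ballI schwartz_isCont)
  then show "f \<in> borel_measurable lebesgue"
    by (simp add: measurable_completion)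
qed

lemma schwartz_bound:
  assumes "f \<in> schwartz"
  shows "\<exists>C. \<forall>x. \<bar>x\<bar> ^ k * cmod (f x) \<le> C"
proof -
  have "\<exists>C. \<forall>x. \<bar>x\<bar> ^ k * cmod (vderiv_iter 0 f x) \<le> C"
    using assms unfolding schwartz_def by blast
  then show ?thesis by simp
qed

lemma integrable_inverse_1_plus_square_lebesgue: "integrable lebesgue (\<lambda>x::real. inverse (1 + x\<^sup>2))"
proof -
  have "integrable lborel (\<lambda>x::real. inverse (1 + x\<^sup>2))"
    using integrable_inverse_1_plus_square by (simp add: set_integrable_def)
  then show ?thesis by (subst integrable_completion) auto
qed

lemma schwartz_weighted_bound:
  assumes "f \<in> schwartz"
  obtains C where "\<And>x. cmod (f x) \<le> C * inverse (1 + x\<^sup>2)" "C \<ge> 0"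
proof -
  obtain C0 where 0: "\<And>x. \<bar>x\<bar> ^ 0 * cmod (f x) \<le> C0" using schwartz_bound[OF assms] by blast
  obtain C2 where 2: "\<And>x. \<bar>x\<bar> ^ 2 * cmod (f x) \<le> C2" using schwartz_bound[OF assms] by blast
  have "cmod (f x) \<le> (C0 + C2) * inverse (1 + x\<^sup>2)" for x
  proof -
    have "cmod (f x) * (1 + x\<^sup>2) \<le> C0 + C2" using 0[of x] 2[of x] by (simp add: algebra_simps)
    moreover have "1 + x\<^sup>2 > 0" by (simp add: add_pos_nonneg)
    ultimately show ?thesis by (simp add: field_simps)
  qed
  moreover have "0 \<le> C0 + C2"
    using 0[of 0] 2[of 0] by (smt (verit) mult_nonneg_nonneg norm_ge_zero zero_le_power abs_ge_zero)
  ultimately show ?thesis using that by blast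
qed

lemma schwartz_integrable:
  assumes "f \<in> schwartz"
  shows "integrable lebesgue f"
proof -
  obtain C where C: "\<And>x. cmod (f x) \<le> C * inverse (1 + x\<^sup>2)" "C \<ge> 0"
    using schwartz_weighted_bound[OF assms] by blast
  show ?thesis
    by (rule Bochner_Integration.integrable_bound[OF integrable_mult_right[OF integrable_inverse_1_plus_square_lebesgue, of C]])
       (use C in \<open>auto simp: schwartz_measurable assms abs_mult intro!: AE_I2\<close>)
qed

lemma schwartz_square_integrable:
  assumes "f \<in> schwartz"
  shows "square_integrable f"
proof -
  obtain B where B: "\<And>x. \<bar>x\<bar> ^ 0 * cmod (f x) \<le> B" using schwartz_bound[OF assms] by blast
  have m: "f \<in> borel_measurable lebesgue" using assms by (rule schwartz_measurable)
  have "integrable lebesgue (\<lambda>x. f x * cnj (f x))"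
  proof (rule integrable_mult_bounded)
    show "(\<lambda>x. cnj (f x)) \<in> borel_measurable lebesgue"
      using schwartz_integrable[OF assms] by (intro borel_measurable_integrable) simp
    show "cmod (cnj (f x)) \<le> B" for x using B[of x] by simp
  qed (rule schwartz_integrable[OF assms])
  then have "(\<integral>\<^sup>+x. ennreal (norm (f x * cnj (f x))) \<partial>lebesgue) < \<infinity>"
    by (simp add: integrable_iff_bounded)
  then show ?thesis using m by (simp add: square_integrable_def norm_mult power2_eq_square)
qed

lemma schwartz_add:
  assumes "f \<in> schwartz" "g \<in> schwartz"
  shows "(\<lambda>x. f x + g x) \<in> schwartz"
proof (rule schwartz_coinduct[where A="{\<lambda>x. f x + g x | f g. f \<in> schwartz \<and> g \<in> schwartz}"])
  have d: "((\<lambda>x. f x + g x) has_vector_derivative (vderiv f x + vderiv g x)) (at x)"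
    if "f \<in> schwartz" "g \<in> schwartz" for f g x
    using that by (intro derivative_intros schwartz_has_vector_derivative)
  fix h assume "h \<in> {\<lambda>x. f x + g x | f g. f \<in> schwartz \<and> g \<in> schwartz}"
  then obtain f g where h: "h = (\<lambda>x. f x + g x)" and fg: "f \<in> schwartz" "g \<in> schwartz" by blast
  show "h differentiable at x" for x
    unfolding h by (rule differentiableI_vector[OF d[OF fg]])
  have "vderiv h = (\<lambda>x. vderiv f x + vderiv g x)"
    unfolding h using vector_derivative_at[OF d[OF fg]] by blast
  then show "vderiv h \<in> {\<lambda>x. f x + g x | f g. f \<in> schwartz \<and> g \<in> schwartz}"
    by (intro CollectI exI[of _ "vderiv f"] exI[of _ "vderiv g"] conjI schwartz_vderiv fg)
  fix k
  obtain A where A: "\<And>x. \<bar>x\<bar> ^ k * cmod (f x) \<le> A" using schwartz_bound[OF fg(1)] by blast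
  obtain B where B: "\<And>x. \<bar>x\<bar> ^ k * cmod (g x) \<le> B" using schwartz_bound[OF fg(2)] by blast
  have "\<bar>x\<bar> ^ k * cmod (h x) \<le> A + B" for x
  proof -
    have "\<bar>x\<bar> ^ k * cmod (h x) \<le> \<bar>x\<bar> ^ k * (cmod (f x) + cmod (g x))"
      unfolding h by (intro mult_left_mono norm_triangle_ineq) auto
    then show ?thesis using A[of x] B[of x] by (simp add: distrib_left)
  qed
  then show "\<exists>C. \<forall>x. \<bar>x\<bar> ^ k * cmod (h x) \<le> C" by blast
qed (use assms in blast)

lemma schwartz_cmult:
  assumes "f \<in> schwartz"
  shows "(\<lambda>x. c * f x) \<in> schwartz"
proof (rule schwartz_coinduct[where A="{\<lambda>x. c * f x | f. f \<in> schwartz}"])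
  have d: "((\<lambda>x. c * f x) has_vector_derivative (c * vderiv f x)) (at x)" if "f \<in> schwartz" for f x
    using has_vector_derivative_mult_right[OF schwartz_has_vector_derivative[OF that]] .
  fix h assume "h \<in> {\<lambda>x. c * f x | f. f \<in> schwartz}"
  then obtain f where h: "h = (\<lambda>x. c * f x)" and f: "f \<in> schwartz" by blast
  show "h differentiable at x" for x
    unfolding h by (rule differentiableI_vector[OF d[OF f]])
  have "vderiv h = (\<lambda>x. c * vderiv f x)"
    unfolding h using vector_derivative_at[OF d[OF f]] by blast
  then show "vderiv h \<in> {\<lambda>x. c * f x | f. f \<in> schwartz}"
    by (intro CollectI exI[of _ "vderiv f"] conjI schwartz_vderiv f)
  fix k
  obtain A where A: "\<And>x. \<bar>x\<bar> ^ k * cmod (f x) \<le> A" using schwartz_bound[OF f] by blast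
  have "\<bar>x\<bar> ^ k * cmod (h x) \<le> cmod c * A" for x
    using mult_left_mono[OF A[of x] norm_ge_zero[of c]] by (simp add: h norm_mult mult_ac)
  then show "\<exists>C. \<forall>x. \<bar>x\<bar> ^ k * cmod (h x) \<le> C" by blast
qed (use assms in blast)

lemma schwartz_mult_id:
  assumes "f \<in> schwartz"
  shows "(\<lambda>x. of_real x * f x) \<in> schwartz"
proof -
  \<comment> \<open>Products with \<open>x\<close> alone are not closed under differentiation: the
    derivative of \<open>x * f + g\<close> is \<open>x * f' + (f + g')\<close>, so the extra summand
    \<open>g\<close> has to be carried along.\<close>
  let ?A = "{\<lambda>x. of_real x * f x + g x | f g. f \<in> schwartz \<and> g \<in> schwartz}"
  have zero: "(\<lambda>x. 0) \<in> schwartz" using schwartz_cmult[OF assms, of 0] by simp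
  show ?thesis
  proof (rule schwartz_coinduct[where A="?A"])
    have "(\<lambda>x. of_real x * f x) = (\<lambda>x. of_real x * f x + 0)" by simp
    then show "(\<lambda>x. of_real x * f x) \<in> ?A"
      using assms zero by (intro CollectI exI[of _ f] exI[of _ "\<lambda>x. 0"] conjI)
  next
    have d: "((\<lambda>x. of_real x * f x + g x) has_vector_derivative (of_real x * vderiv f x + (f x + vderiv g x))) (at x)"
      if "f \<in> schwartz" "g \<in> schwartz" for f g and x :: real
    proof -
      have "((\<lambda>x. of_real x * f x + g x) has_vector_derivative (of_real x * vderiv f x + of_real 1 * f x + vderiv g x)) (at x)"
        using that by (intro derivative_intros schwartz_has_vector_derivative)
      then show ?thesis by (simp add: add.assoc)
    qed
    fix h assume "h \<in> ?A"
    then obtain f g where h: "h = (\<lambda>x. of_real x * f x + g x)" and fg: "f \<in> schwartz" "g \<in> schwartz" by blast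
    show "h differentiable at x" for x
      unfolding h by (rule differentiableI_vector[OF d[OF fg]])
    have "vderiv h = (\<lambda>x. of_real x * vderiv f x + (f x + vderiv g x))"
      unfolding h using vector_derivative_at[OF d[OF fg]] by blast
    then show "vderiv h \<in> ?A"
      by (intro CollectI exI[of _ "vderiv f"] exI[of _ "\<lambda>x. f x + vderiv g x"] conjI schwartz_vderiv schwartz_add fg)
    fix k
    obtain A where A: "\<And>x. \<bar>x\<bar> ^ Suc k * cmod (f x) \<le> A" using schwartz_bound[OF fg(1)] by blast
    obtain B where B: "\<And>x. \<bar>x\<bar> ^ k * cmod (g x) \<le> B" using schwartz_bound[OF fg(2)] by blast
    have "\<bar>x\<bar> ^ k * cmod (h x) \<le> A + B" for x
    proof -
      have "\<bar>x\<bar> ^ k * cmod (h x) \<le> \<bar>x\<bar> ^ k * (\<bar>x\<bar> * cmod (f x) + cmod (g x))"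
        unfolding h by (intro mult_left_mono order_trans[OF norm_triangle_ineq]) (auto simp: norm_mult)
      then show ?thesis using A[of x] B[of x] by (simp add: algebra_simps)
    qed
    then show "\<exists>C. \<forall>x. \<bar>x\<bar> ^ k * cmod (h x) \<le> C" by blast
  qed
qed

lemma schwartz_tendsto_0:
  assumes "f \<in> schwartz"
  shows "(f \<longlongrightarrow> 0) at_top" "(f \<longlongrightarrow> 0) at_bot"
proof -
  obtain C where C: "\<And>x. \<bar>x\<bar> ^ 1 * cmod (f x) \<le> C" using schwartz_bound[OF assms] by blast
  have b: "cmod (f x) \<le> norm (C / x)" if "x \<noteq> 0" for x
    using C[of x] that by (simp add: field_simps)
  have "((\<lambda>x::real. C / x) \<longlongrightarrow> 0) at_top" "((\<lambda>x::real. C / x) \<longlongrightarrow> 0) at_bot"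
    by (intro tendsto_divide_0[OF tendsto_const] filterlim_at_top_imp_at_infinity filterlim_at_bot_imp_at_infinity filterlim_ident)+
  from this[THEN tendsto_norm_zero] have "((\<lambda>x::real. norm (C / x)) \<longlongrightarrow> 0) at_top" "((\<lambda>x::real. norm (C / x)) \<longlongrightarrow> 0) at_bot"
    by simp_all
  note lim = this
  have "eventually (\<lambda>x. cmod (f x) \<le> norm (C / x)) at_top"
    by (rule eventually_mono[OF eventually_gt_at_top[of 0]], rule b) simp
  then show "(f \<longlongrightarrow> 0) at_top"
    by (rule Lim_null_comparison[OF _ lim(1)])
  have "eventually (\<lambda>x. cmod (f x) \<le> norm (C / x)) at_bot"
    by (rule eventually_mono[OF eventually_le_at_bot[of "-1"]], rule b) simp
  then show "(f \<longlongrightarrow> 0) at_bot"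
    by (rule Lim_null_comparison[OF _ lim(2)])
qed

section \<open>The Fourier transform on Schwartz functions\<close>

lemma has_vector_derivative_cis [derivative_intros]:
  assumes "(g has_real_derivative g') (at x)"
  shows "((\<lambda>x. cis (g x)) has_vector_derivative (\<i> * of_real g' * cis (g x))) (at x)"
proof -
  have "((\<lambda>x. \<i> * complex_of_real (g x)) has_vector_derivative \<i> * of_real g') (at x)"
    using assms by (intro has_vector_derivative_mult_right has_vector_derivative_of_real)
  from field_vector_diff_chain_at[OF this DERIV_exp] show ?thesis
    by (simp add: o_def cis_conv_exp)
qed

text \<open>Integration by parts: the derivative of \<open>f x * cis (- (x * \<xi>))\<close> has
  integral 0 over the line, since this product vanishes at both infinities.\<close>

lemma fourier_vderiv:
  assumes f: "f \<in> schwartz"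
  shows "fourier (vderiv f) \<xi> = \<i> * of_real \<xi> * fourier f \<xi>"
proof -
  define e where "e = (\<lambda>x. cis (- (x * \<xi>)))"
  define F where "F x = f x * e x" for x
  define F' where "F' x = vderiv f x * e x - \<i> * of_real \<xi> * (f x * e x)" for x
  have "integrable lebesgue (\<lambda>x. h x * e x)" if "h \<in> schwartz" for h
    using schwartz_integrable[OF that] unfolding e_def by (intro integrable_mult_bounded[where C=1]) auto
  then have i: "integrable lebesgue (\<lambda>x. f x * e x)" "integrable lebesgue (\<lambda>x. vderiv f x * e x)"
    using f schwartz_vderiv by auto
  then have F': "integrable lebesgue F'" unfolding F'_def by simp
  have e: "isCont e x" for x
    unfolding e_def
    by (rule has_vector_derivative_continuous[OF has_vector_derivative_cis]) (auto intro!: derivative_eq_intros)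
  have c: "isCont F' x" for x
    unfolding F'_def by (intro continuous_intros e schwartz_isCont[OF f] schwartz_isCont[OF schwartz_vderiv[OF f]])
  have F'b: "F' \<in> borel_measurable borel"
    using c by (intro borel_measurable_continuous_onI continuous_at_imp_continuous_on) auto
  have norm_e: "cmod (e x) = 1" for x by (simp add: e_def)
  have "(LBINT x=-\<infinity>..\<infinity>. F' x) = 0 - 0"
  proof (rule interval_integral_FTC_integrable[where F=F])
    show "(F has_vector_derivative F' x) (at x)" for x
    proof -
      have "(F has_vector_derivative (f x * (\<i> * of_real (- \<xi>) * e x) + vderiv f x * e x)) (at x)"
        unfolding F_def e_def using f
        by (intro has_vector_derivative_mult schwartz_has_vector_derivative has_vector_derivative_cis)
           (auto intro!: derivative_eq_intros)
      then show ?thesis unfolding F'_def by (simp add: algebra_simps)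
    qed
    show "set_integrable lborel (einterval (-\<infinity>) \<infinity>) F'"
      using F' F'b by (simp add: set_integrable_def integrable_completion)
    have "(F \<longlongrightarrow> 0) Fl" if "(f \<longlongrightarrow> 0) Fl" for Fl
      by (rule Lim_null_comparison[OF _ tendsto_norm_zero[OF that]]) (simp add: F_def norm_mult norm_e)
    then show "((F \<circ> real_of_ereal) \<longlongrightarrow> 0) (at_right (-\<infinity>))" "((F \<circ> real_of_ereal) \<longlongrightarrow> 0) (at_left \<infinity>)"
      unfolding ereal_tendsto_simps using schwartz_tendsto_0[OF f] by blast+
  qed (use c in auto)
  then have "(\<integral>x. F' x \<partial>lebesgue) = 0"
    using F'b by (simp add: interval_lebesgue_integral_def set_lebesgue_integral_def integral_completion)
  moreover have "(\<integral>x. F' x \<partial>lebesgue) = fourier (vderiv f) \<xi> - \<i> * of_real \<xi> * fourier f \<xi>"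
    unfolding F'_def fourier_def e_def[symmetric] using i
    by (subst Bochner_Integration.integral_diff) (auto simp: fourier_def e_def)
  ultimately show ?thesis by simp
qed

text \<open>Differentiation under the integral made quantitative: the bound \<open>t^2\<close> for
  \<open>cis t - 1 - \<i> * t\<close> gives an error of at most \<open>(\<eta> - \<xi>)^2\<close>
  times the second absolute moment of \<open>f\<close>.\<close>

lemma fourier_has_vector_derivative:
  assumes f: "f \<in> schwartz"
  shows "(fourier f has_vector_derivative fourier (\<lambda>x. - \<i> * (of_real x * f x)) \<xi>) (at \<xi>)"
proof -
  let ?g = "\<lambda>x. - \<i> * (of_real x * f x)"
  have g: "?g \<in> schwartz" and xf: "(\<lambda>x. of_real x * (of_real x * f x)) \<in> schwartz"
    by (intro schwartz_cmult schwartz_mult_id f)+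
  define K where "K = (\<integral>x. cmod (of_real x * (of_real x * f x)) \<partial>lebesgue)"
  have int: "integrable lebesgue (\<lambda>x. h x * cis (- (x * \<eta>)))" if "h \<in> schwartz" for h \<eta>
    using schwartz_integrable[OF that] by (intro integrable_mult_bounded[where C=1]) auto
  have cis_bound: "cmod (cis t - 1 - \<i> * of_real t) \<le> t\<^sup>2" for t
    using iexp_approx1[of t 1] by (simp add: cis_conv_exp numeral_2_eq_2 algebra_simps) (smt (verit) norm_ge_zero)
  have "cmod (fourier f \<eta> - fourier f \<xi> - (\<eta> - \<xi>) *\<^sub>R fourier ?g \<xi>) \<le> (\<eta> - \<xi>)\<^sup>2 * K" for \<eta>
  proof -
    let ?J = "\<lambda>x. f x * cis (- (x * \<eta>)) - f x * cis (- (x * \<xi>)) - (\<eta> - \<xi>) *\<^sub>R (?g x * cis (- (x * \<xi>)))"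
    have "fourier f \<eta> - fourier f \<xi> - (\<eta> - \<xi>) *\<^sub>R fourier ?g \<xi> = (\<integral>x. ?J x \<partial>lebesgue)"
      unfolding fourier_def using int[OF f] int[OF g] by simp
    also have "cmod \<dots> \<le> (\<integral>x. (\<eta> - \<xi>)\<^sup>2 * cmod (of_real x * (of_real x * f x)) \<partial>lebesgue)"
    proof (rule Bochner_Integration.integral_norm_bound_integral)
      show "integrable lebesgue ?J" using int[OF f] int[OF g] by simp
      show "integrable lebesgue (\<lambda>x. (\<eta> - \<xi>)\<^sup>2 * cmod (of_real x * (of_real x * f x)))"
        using schwartz_integrable[OF xf] by simp
      fix x
      have "cis (- (x * \<eta>)) = cis (- (x * \<xi>)) * cis (- (x * (\<eta> - \<xi>)))"
        by (simp add: cis_mult algebra_simps)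
      then have "?J x = f x * cis (- (x * \<xi>)) * (cis (- (x * (\<eta> - \<xi>))) - 1 - \<i> * of_real (- (x * (\<eta> - \<xi>))))"
        by (simp add: scaleR_conv_of_real algebra_simps)
      then have "cmod (?J x) = cmod (f x) * cmod (cis (- (x * (\<eta> - \<xi>))) - 1 - \<i> * of_real (- (x * (\<eta> - \<xi>))))"
        by (simp only: norm_mult norm_cis mult_1_right)
      also have "\<dots> \<le> cmod (f x) * (- (x * (\<eta> - \<xi>)))\<^sup>2"
        by (intro mult_left_mono cis_bound) auto
      also have "\<dots> = (\<eta> - \<xi>)\<^sup>2 * cmod (of_real x * (of_real x * f x))"
        using abs_mult_self_eq[of x] by (simp add: norm_mult power2_eq_square mult_ac)
      finally show "cmod (?J x) \<le> (\<eta> - \<xi>)\<^sup>2 * cmod (of_real x * (of_real x * f x))" .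
    qed
    finally show ?thesis by (simp add: K_def)
  qed
  then have b: "norm (fourier f \<eta> - fourier f \<xi> - (\<eta> - \<xi>) *\<^sub>R fourier ?g \<xi>) / norm (\<eta> - \<xi>) \<le> \<bar>\<eta> - \<xi>\<bar> * K"
    if "\<eta> \<noteq> \<xi>" for \<eta>
    using that by (simp add: pos_divide_le_eq power2_eq_square mult_ac)
  show ?thesis
    unfolding has_vector_derivative_def has_derivative_iff_norm
  proof (intro conjI bounded_linear_scaleR_left)
    have "((\<lambda>\<eta>. \<bar>\<eta> - \<xi>\<bar> * K) \<longlongrightarrow> \<bar>\<xi> - \<xi>\<bar> * K) (at \<xi>)"
      by (intro tendsto_intros)
    then have lim: "((\<lambda>\<eta>. \<bar>\<eta> - \<xi>\<bar> * K) \<longlongrightarrow> 0) (at \<xi>)" by simp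
    have "eventually (\<lambda>\<eta>. \<eta> \<noteq> \<xi>) (at \<xi>)" by (rule eventually_neq_at_within)
    then have "eventually (\<lambda>\<eta>. norm (norm (fourier f \<eta> - fourier f \<xi> - (\<eta> - \<xi>) *\<^sub>R fourier ?g \<xi>) / norm (\<eta> - \<xi>)) \<le> \<bar>\<eta> - \<xi>\<bar> * K) (at \<xi>)"
      by (rule eventually_mono) (use b in simp)
    then show "((\<lambda>\<eta>. norm (fourier f \<eta> - fourier f \<xi> - (\<eta> - \<xi>) *\<^sub>R fourier ?g \<xi>) / norm (\<eta> - \<xi>)) \<longlongrightarrow> 0) (at \<xi>)"
      using lim by (rule Lim_null_comparison)
  qed
qed

text \<open>Differentiating the transform multiplies \<open>f\<close> by \<open>- \<i> * x\<close>,
  and multiplying the transform by a power of \<open>\<xi>\<close> differentiates \<open>f\<close>,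
  up to modulus. Every weighted bound thus becomes the plain bound by the integral of the modulus
  for the transform of another Schwartz function.\<close>

theorem schwartz_fourier:
  assumes "u \<in> schwartz"
  shows "fourier u \<in> schwartz"
proof (rule schwartz_coinduct[where A="fourier ` schwartz"])
  fix h assume "h \<in> fourier ` schwartz"
  then obtain f where h: "h = fourier f" and f: "f \<in> schwartz" by blast
  show "h differentiable at x" for x
    unfolding h by (rule differentiableI_vector[OF fourier_has_vector_derivative[OF f]])
  have "vderiv h = fourier (\<lambda>x. - \<i> * (of_real x * f x))"
    unfolding h using vector_derivative_at[OF fourier_has_vector_derivative[OF f]] by blast
  then show "vderiv h \<in> fourier ` schwartz"
    using schwartz_cmult[OF schwartz_mult_id[OF f]] by blast
  fix k
  have "\<exists>v\<in>schwartz. \<forall>\<xi>. \<bar>\<xi>\<bar> ^ k * cmod (h \<xi>) = cmod (fourier v \<xi>)"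
  proof (induction k)
    case 0
    then show ?case using f h by auto
  next
    case (Suc k)
    then obtain v where v: "v \<in> schwartz" "\<And>\<xi>. \<bar>\<xi>\<bar> ^ k * cmod (h \<xi>) = cmod (fourier v \<xi>)" by blast
    then have "\<bar>\<xi>\<bar> ^ Suc k * cmod (h \<xi>) = cmod (fourier (vderiv v) \<xi>)" for \<xi>
      by (simp add: fourier_vderiv norm_mult mult.assoc)
    then show ?case using schwartz_vderiv[OF v(1)] by blast
  qed
  then obtain v where "\<And>\<xi>. \<bar>\<xi>\<bar> ^ k * cmod (h \<xi>) = cmod (fourier v \<xi>)" by blast
  then show "\<exists>C. \<forall>x. \<bar>x\<bar> ^ k * cmod (h x) \<le> C"
    using norm_fourier_le by metis
qed (use assms in blast)

lemma schwartz_fourier_inversion: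
  fixes u :: "real \<Rightarrow> complex"
  assumes "u \<in> schwartz"
  shows "fourier (fourier u) (- x) = 2 * pi * u x"
proof -
  obtain B where "\<And>x. \<bar>x\<bar> ^ 0 * cmod (u x) \<le> B" using schwartz_bound[OF assms] by blast
  then show ?thesis
    using assms by (intro fourier_inversion[where B=B] schwartz_integrable schwartz_fourier schwartz_isCont) auto
qed

lemma schwartz_mult_cis:
  assumes "f \<in> schwartz"
  shows "(\<lambda>\<xi>. f \<xi> * cis (x * \<xi>)) \<in> schwartz"
    and "vderiv (\<lambda>\<xi>. f \<xi> * cis (x * \<xi>)) = (\<lambda>\<xi>. vderiv f \<xi> * cis (x * \<xi>) + (\<i> * of_real x) * (f \<xi> * cis (x * \<xi>)))"
proof -
  let ?A = "{\<lambda>\<xi>. f \<xi> * cis (x * \<xi>) | f. f \<in> schwartz}"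
  have d: "((\<lambda>\<xi>. f \<xi> * cis (x * \<xi>)) has_vector_derivative
      (vderiv f \<xi> * cis (x * \<xi>) + (\<i> * of_real x) * (f \<xi> * cis (x * \<xi>)))) (at \<xi>)" if "f \<in> schwartz" for f \<xi>
  proof -
    have "((\<lambda>\<xi>. f \<xi> * cis (x * \<xi>)) has_vector_derivative
      (f \<xi> * (\<i> * of_real x * cis (x * \<xi>)) + vderiv f \<xi> * cis (x * \<xi>))) (at \<xi>)"
      using that by (intro has_vector_derivative_mult schwartz_has_vector_derivative has_vector_derivative_cis)
           (auto intro!: derivative_eq_intros)
    then show ?thesis by (simp add: algebra_simps)
  qed
  show "vderiv (\<lambda>\<xi>. f \<xi> * cis (x * \<xi>)) = (\<lambda>\<xi>. vderiv f \<xi> * cis (x * \<xi>) + (\<i> * of_real x) * (f \<xi> * cis (x * \<xi>)))"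
    using vector_derivative_at[OF d[OF assms]] by blast
  show "(\<lambda>\<xi>. f \<xi> * cis (x * \<xi>)) \<in> schwartz"
  proof (rule schwartz_coinduct[where A="?A"])
    fix h assume "h \<in> ?A"
    then obtain f where h: "h = (\<lambda>\<xi>. f \<xi> * cis (x * \<xi>))" and f: "f \<in> schwartz" by blast
    show "h differentiable at x" for x
      unfolding h by (rule differentiableI_vector[OF d[OF f]])
    have "vderiv h = (\<lambda>\<xi>. (vderiv f \<xi> + (\<i> * of_real x) * f \<xi>) * cis (x * \<xi>))"
      unfolding h using vector_derivative_at[OF d[OF f]] by (auto simp: algebra_simps)
    then show "vderiv h \<in> ?A"
      by (intro CollectI exI[of _ "\<lambda>\<xi>. vderiv f \<xi> + (\<i> * of_real x) * f \<xi>"] conjI schwartz_add schwartz_cmult schwartz_vderiv f)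
    fix k
    obtain A where "\<And>x. \<bar>x\<bar> ^ k * cmod (f x) \<le> A" using schwartz_bound[OF f] by blast
    then show "\<exists>C. \<forall>x. \<bar>x\<bar> ^ k * cmod (h x) \<le> C" by (auto simp: h norm_mult)
  qed (use assms in blast)
qed

section \<open>Polynomial growth of tempered multiplier operators\<close>

lemma vderiv_iter_add:
  assumes "f \<in> schwartz" "g \<in> schwartz"
  shows "vderiv_iter m (\<lambda>x. f x + g x) = (\<lambda>x. vderiv_iter m f x + vderiv_iter m g x)"
  using assms
proof (induction m arbitrary: f g)
  case (Suc m)
  have "((\<lambda>x. f x + g x) has_vector_derivative (vderiv f x + vderiv g x)) (at x)" for x
    using Suc.prems by (intro derivative_intros schwartz_has_vector_derivative)
  then have "vderiv (\<lambda>x. f x + g x) = (\<lambda>x. vderiv f x + vderiv g x)"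
    using vector_derivative_at by blast
  then show ?case
    using Suc by (simp add: vderiv_iter_Suc schwartz_vderiv)
qed simp

lemma vderiv_iter_cmult:
  assumes "f \<in> schwartz"
  shows "vderiv_iter m (\<lambda>x. c * f x) = (\<lambda>x. c * vderiv_iter m f x)"
  using assms
proof (induction m arbitrary: f)
  case (Suc m)
  have "((\<lambda>x. c * f x) has_vector_derivative (c * vderiv f x)) (at x)" for x
    using has_vector_derivative_mult_right[OF schwartz_has_vector_derivative[OF Suc.prems]] .
  then have "vderiv (\<lambda>x. c * f x) = (\<lambda>x. c * vderiv f x)"
    using vector_derivative_at by blast
  then show ?case
    using Suc by (simp add: vderiv_iter_Suc schwartz_vderiv)
qed simp

text \<open>Each derivative either falls on \<open>f\<close> or produces a factor
  \<open>\<i> * x\<close>, so \<open>m\<close> derivatives cost at most the power \<open>m\<close>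
  of \<open>1 + \<bar>x\<bar>\<close>. The induction varies \<open>f\<close>, since its derivative
  takes its place in one of the two terms.\<close>

lemma vderiv_iter_mult_cis_growth:
  assumes "f \<in> schwartz"
  shows "\<exists>C\<ge>0. \<forall>x \<xi>. \<bar>\<xi>\<bar> ^ k * cmod (vderiv_iter m (\<lambda>\<xi>. f \<xi> * cis (x * \<xi>)) \<xi>) \<le> C * (1 + \<bar>x\<bar>) ^ m"
  using assms
proof (induction m arbitrary: f)
  case 0
  obtain A where A: "\<And>x. \<bar>x\<bar> ^ k * cmod (f x) \<le> A" using schwartz_bound[OF 0] by blast
  have "0 \<le> \<bar>0\<bar> ^ k * cmod (f 0)" by simp
  also have "\<dots> \<le> A" by (rule A)
  finally show ?case using A by (auto simp: norm_mult)
next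
  case (Suc m)
  obtain C where C: "C \<ge> 0" "\<And>x \<xi>. \<bar>\<xi>\<bar> ^ k * cmod (vderiv_iter m (\<lambda>\<xi>. f \<xi> * cis (x * \<xi>)) \<xi>) \<le> C * (1 + \<bar>x\<bar>) ^ m"
    using Suc by blast
  obtain D where D: "D \<ge> 0" "\<And>x \<xi>. \<bar>\<xi>\<bar> ^ k * cmod (vderiv_iter m (\<lambda>\<xi>. vderiv f \<xi> * cis (x * \<xi>)) \<xi>) \<le> D * (1 + \<bar>x\<bar>) ^ m"
    using Suc.IH[OF schwartz_vderiv[OF Suc.prems]] by blast
  have "\<bar>\<xi>\<bar> ^ k * cmod (vderiv_iter (Suc m) (\<lambda>\<xi>. f \<xi> * cis (x * \<xi>)) \<xi>) \<le> (C + D) * (1 + \<bar>x\<bar>) ^ Suc m" for x \<xi>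
  proof -
    let ?a = "vderiv_iter m (\<lambda>\<xi>. vderiv f \<xi> * cis (x * \<xi>)) \<xi>" and ?b = "vderiv_iter m (\<lambda>\<xi>. f \<xi> * cis (x * \<xi>)) \<xi>"
    have "vderiv_iter (Suc m) (\<lambda>\<xi>. f \<xi> * cis (x * \<xi>)) \<xi> = ?a + \<i> * of_real x * ?b"
      unfolding vderiv_iter_Suc schwartz_mult_cis(2)[OF Suc.prems]
      using Suc.prems
      by (simp only: vderiv_iter_add vderiv_iter_cmult schwartz_mult_cis(1) schwartz_vderiv schwartz_cmult)
    then have "\<bar>\<xi>\<bar> ^ k * cmod (vderiv_iter (Suc m) (\<lambda>\<xi>. f \<xi> * cis (x * \<xi>)) \<xi>)
        \<le> \<bar>\<xi>\<bar> ^ k * (cmod ?a + \<bar>x\<bar> * cmod ?b)"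
      by (auto intro!: mult_left_mono order_trans[OF norm_triangle_ineq] simp: norm_mult)
    also have "\<dots> = \<bar>\<xi>\<bar> ^ k * cmod ?a + \<bar>x\<bar> * (\<bar>\<xi>\<bar> ^ k * cmod ?b)"
      by (simp add: algebra_simps)
    also have "\<dots> \<le> D * (1 + \<bar>x\<bar>) ^ m + \<bar>x\<bar> * (C * (1 + \<bar>x\<bar>) ^ m)"
      by (intro add_mono mult_left_mono C D) auto
    also have "\<dots> \<le> (1 + \<bar>x\<bar>) * (D * (1 + \<bar>x\<bar>) ^ m) + (1 + \<bar>x\<bar>) * (C * (1 + \<bar>x\<bar>) ^ m)"
      using C(1) D(1) by (intro add_mono mult_right_mono) (auto simp: distrib_right)
    also have "\<dots> = (C + D) * (1 + \<bar>x\<bar>) ^ Suc m" by (simp add: algebra_simps)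
    finally show ?thesis .
  qed
  then show ?case using C(1) D(1) by (intro exI[of _ "C + D"]) auto
qed

lemma schwartz_seminorm_bdd:
  assumes "f \<in> schwartz"
  shows "bdd_above (range (\<lambda>x. \<bar>x\<bar> ^ k * cmod (vderiv_iter m f x)))"
  using assms unfolding schwartz_def bdd_above_def by blast

lemma schwartz_seminorm_upper:
  assumes "f \<in> schwartz"
  shows "\<bar>x\<bar> ^ k * cmod (vderiv_iter m f x) \<le> schwartz_seminorm k m f"
  unfolding schwartz_seminorm_def using schwartz_seminorm_bdd[OF assms] by (intro cSUP_upper) auto

lemma schwartz_seminorm_nonneg:
  assumes "f \<in> schwartz"
  shows "0 \<le> schwartz_seminorm k m f"
  by (rule order_trans[OF _ schwartz_seminorm_upper[OF assms, of 0]]) simp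

text \<open>The value at \<open>x\<close> is \<open>b\<close> applied to the transform of
  \<open>u\<close> modulated by \<open>x\<close>. Finitely many seminorms control \<open>b\<close>,
  and each of them grows polynomially in the modulation.\<close>

lemma tempered_polynomial_growth:
  assumes b: "tempered b" and u: "u \<in> schwartz"
  shows "\<exists>C N. \<forall>x. cmod (fm_op_S b u x) \<le> C * (1 + \<bar>x\<bar>) ^ N"
proof -
  obtain C N where CN: "\<And>f. f \<in> schwartz \<Longrightarrow> cmod (b f) \<le> C * (\<Sum>k\<le>N. \<Sum>m\<le>N. schwartz_seminorm k m f)"
    using b unfolding tempered_def by blast
  let ?h = "\<lambda>x \<xi>. fourier u \<xi> * cis (x * \<xi>)"
  have h: "?h x \<in> schwartz" for x
    using u by (intro schwartz_mult_cis schwartz_fourier)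
  have "\<exists>D\<ge>0. \<forall>x. schwartz_seminorm k m (?h x) \<le> D * (1 + \<bar>x\<bar>) ^ m" for k m
  proof -
    obtain D where "D \<ge> 0" "\<And>x \<xi>. \<bar>\<xi>\<bar> ^ k * cmod (vderiv_iter m (?h x) \<xi>) \<le> D * (1 + \<bar>x\<bar>) ^ m"
      using vderiv_iter_mult_cis_growth[OF schwartz_fourier[OF u], of k m] by blast
    then show ?thesis
      unfolding schwartz_seminorm_def by (intro exI[of _ D] conjI allI cSUP_least) auto
  qed
  then obtain D where D: "\<And>k m. D k m \<ge> 0" "\<And>k m x. schwartz_seminorm k m (?h x) \<le> D k m * (1 + \<bar>x\<bar>) ^ m"
    by metis
  have "cmod (fm_op_S b u x) \<le> \<bar>C\<bar> * (\<Sum>k\<le>N. \<Sum>m\<le>N. D k m) * (1 + \<bar>x\<bar>) ^ N" for x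
  proof -
    have "cmod (fm_op_S b u x) \<le> cmod (b (?h x))"
      using pi_gt3 by (simp add: fm_op_S_def norm_mult norm_divide divide_le_eq mult_le_cancel_left1)
    also have "\<dots> \<le> C * (\<Sum>k\<le>N. \<Sum>m\<le>N. schwartz_seminorm k m (?h x))"
      by (rule CN[OF h])
    \<comment> \<open>Temperedness allows a constant of any sign; passing to
      \<open>\<bar>C\<bar>\<close> permits termwise estimates of the sum.\<close>
    also have "\<dots> \<le> \<bar>C\<bar> * (\<Sum>k\<le>N. \<Sum>m\<le>N. schwartz_seminorm k m (?h x))"
      using h by (intro mult_right_mono sum_nonneg schwartz_seminorm_nonneg) auto
    also have "\<dots> \<le> \<bar>C\<bar> * (\<Sum>k\<le>N. \<Sum>m\<le>N. D k m * (1 + \<bar>x\<bar>) ^ N)"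
    proof (intro mult_left_mono sum_mono)
      fix k m assume "m \<in> {..N}"
      then have "(1 + \<bar>x\<bar>) ^ m \<le> (1 + \<bar>x\<bar>) ^ N" by (intro power_increasing) auto
      then show "schwartz_seminorm k m (?h x) \<le> D k m * (1 + \<bar>x\<bar>) ^ N"
        using D(2)[of k m x] mult_left_mono[OF _ D(1)] order_trans by blast
    qed auto
    finally show ?thesis by (simp add: sum_distrib_right mult.assoc)
  qed
  then show ?thesis by blast
qed

text \<open>The seminorms of orders \<open>(0, 0)\<close> and \<open>(2, 0)\<close> bound
  \<open>cmod (f x) * (1 + x^2)\<close>. The larger double sum is used because continuity of a
  functional in \<open>tempered\<close> has this shape, here with \<open>N = 2\<close>.\<close>

lemma schwartz_integral_bound:
  assumes f: "f \<in> schwartz"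
  shows "(\<integral>x. cmod (f x) \<partial>lebesgue) \<le> (\<integral>x. inverse (1 + x\<^sup>2) \<partial>lebesgue) * (\<Sum>k\<le>2. \<Sum>m\<le>2. schwartz_seminorm k m f)"
proof -
  let ?S = "\<Sum>k\<le>2. \<Sum>m\<le>2. schwartz_seminorm k m f"
  have p: "schwartz_seminorm 0 0 f + schwartz_seminorm 2 0 f \<le> ?S"
    using schwartz_seminorm_nonneg[OF f] by (simp add: numeral_2_eq_2)
  have "cmod (f x) \<le> ?S * inverse (1 + x\<^sup>2)" for x
  proof -
    have "cmod (f x) * (1 + x\<^sup>2) \<le> ?S"
      using schwartz_seminorm_upper[OF f, of x 0 0] schwartz_seminorm_upper[OF f, of x 2 0] p
      by (simp add: algebra_simps)
    moreover have "1 + x\<^sup>2 > 0" by (simp add: add_pos_nonneg)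
    ultimately show ?thesis by (simp add: field_simps)
  qed
  then have "(\<integral>x. cmod (f x) \<partial>lebesgue) \<le> (\<integral>x. ?S * inverse (1 + x\<^sup>2) \<partial>lebesgue)"
    using schwartz_integrable[OF f] integrable_inverse_1_plus_square_lebesgue
    by (intro integral_mono) auto
  then show ?thesis by (simp add: mult.commute)
qed

section \<open>Smooth bump functions and translation operators\<close>

text \<open>The family is closed under differentiation, because the polynomial is evaluated at the reciprocal.\<close>

definition flat :: "real \<Rightarrow> real poly \<Rightarrow> real \<Rightarrow> real" where
  "flat k p x = (if 0 < x then poly p (inverse x) * exp (- (k * inverse x)) else 0)"

lemma poly_mult_exp_tendsto_0:
  fixes p :: "real poly"
  assumes "k > 0"
  shows "((\<lambda>y. poly p y * exp (- (k * y))) \<longlongrightarrow> 0) at_top"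
proof -
  have "((\<lambda>y. \<Sum>i\<le>degree p. coeff p i / k ^ i * ((k * y) ^ i / exp (k * y))) \<longlongrightarrow> (\<Sum>i\<le>degree p. coeff p i / k ^ i * 0)) at_top"
  proof (intro tendsto_sum tendsto_mult tendsto_const)
    have "filterlim (\<lambda>y. k * y) at_top at_top"
      using assms by (rule filterlim_tendsto_pos_mult_at_top[OF tendsto_const]) (rule filterlim_ident)
    then show "((\<lambda>y. (k * y) ^ i / exp (k * y)) \<longlongrightarrow> 0) at_top" for i
      by (rule filterlim_compose[OF tendsto_power_div_exp_0])
  qed
  moreover have "(\<Sum>i\<le>degree p. coeff p i / k ^ i * ((k * y) ^ i / exp (k * y))) = poly p y * exp (- (k * y))" for y
  proof -
    have "coeff p i / k ^ i * ((k * y) ^ i / exp (k * y)) = coeff p i * y ^ i * exp (- (k * y))" for i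
      using assms by (simp add: power_mult_distrib exp_minus divide_inverse)
    then show ?thesis by (simp add: poly_altdef sum_distrib_right)
  qed
  ultimately show ?thesis by simp
qed

text \<open>With \<open>y = inverse x\<close> the derivative of \<open>y\<close> is
  \<open>- y^2\<close>, so that \<open>poly p y * exp (- (k * y))\<close> has derivative
  \<open>y^2 * (k * p - p')\<close> at \<open>y\<close> times the same exponential. At 0 the
  exponential beats every polynomial in \<open>y\<close>.\<close>

lemma flat_has_real_derivative:
  assumes k: "k > 0"
  shows "(flat k p has_real_derivative flat k ([:0, 0, 1:] * (smult k p - pderiv p)) x) (at x)"
proof -
  consider "x > 0" | "x < 0" | "x = 0" by linarith
  then show ?thesis
  proof cases
    case 1
    have "((\<lambda>x. poly p (inverse x) * exp (- (k * inverse x))) has_real_derivative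
        flat k ([:0, 0, 1:] * (smult k p - pderiv p)) x) (at x)"
      using 1 by (auto intro!: derivative_eq_intros DERIV_chain2[OF poly_DERIV] simp: flat_def algebra_simps power2_eq_square)
    then show ?thesis
      by (rule has_field_derivative_transform_within_open[where S="{0<..}"]) (use 1 in \<open>auto simp: flat_def\<close>)
  next
    case 2
    have "((\<lambda>x::real. 0) has_real_derivative flat k ([:0, 0, 1:] * (smult k p - pderiv p)) x) (at x)"
      using 2 by (simp add: flat_def)
    then show ?thesis
      by (rule has_field_derivative_transform_within_open[where S="{..<0}"]) (use 2 in \<open>auto simp: flat_def\<close>)
  next
    case 3
    have "((\<lambda>y. flat k p y / y) \<longlongrightarrow> 0) (at_left 0)"
      by (rule tendsto_eventually) (auto simp: flat_def eventually_at_filter)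
    moreover have "((\<lambda>y. flat k p y / y) \<longlongrightarrow> 0) (at_right 0)"
    proof -
      \<comment> \<open>Dividing by \<open>y\<close> multiplies the polynomial in
        \<open>inverse y\<close> by its variable, so the difference quotient has the form already
        known to vanish.\<close>
      have "((\<lambda>y. poly (pCons 0 p) (inverse y) * exp (- (k * inverse y))) \<longlongrightarrow> 0) (at_right 0)"
        by (rule filterlim_compose[OF poly_mult_exp_tendsto_0[OF k] filterlim_inverse_at_top_right])
      then show ?thesis
        by (rule Lim_transform_eventually) (auto simp: flat_def eventually_at_filter divide_inverse)
    qed
    ultimately have "((\<lambda>y. flat k p y / y) \<longlongrightarrow> 0) (at 0)"
      by (rule filterlim_split_at)
    then show ?thesis
      using 3 by (simp add: has_field_derivative_iff flat_def[of _ _ 0])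
  qed
qed

text \<open>The family for \<open>schwartz_coinduct\<close>: polynomials and sums are just enough to
  absorb the product rule, while the decay parameter and the two endpoints stay fixed. Scalars and
  signs are absorbed by the polynomials.\<close>

inductive_set bumps :: "real \<Rightarrow> real \<Rightarrow> real \<Rightarrow> (real \<Rightarrow> complex) set" for k a b where
  base: "(\<lambda>x. of_real (flat k p (x - a) * flat k q (b - x))) \<in> bumps k a b"
| add: "f \<in> bumps k a b \<Longrightarrow> g \<in> bumps k a b \<Longrightarrow> (\<lambda>x. f x + g x) \<in> bumps k a b"

lemma bumps_derivative:
  assumes "k > 0" "f \<in> bumps k a b"
  shows "\<exists>g\<in>bumps k a b. \<forall>x. (f has_vector_derivative g x) (at x)"
  using assms(2)
proof induction
  case (base p q)
  let ?D = "\<lambda>p. [:0, 0, 1:] * (smult k p - pderiv p)"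
  \<comment> \<open>The factor in \<open>b - x\<close> contributes a minus sign, which is moved into
    its polynomial so that the second term is again a base element.\<close>
  let ?g = "\<lambda>x. complex_of_real (flat k (?D p) (x - a) * flat k q (b - x)) + of_real (flat k p (x - a) * flat k (- ?D q) (b - x))"
  have "((\<lambda>x. of_real (flat k p (x - a) * flat k q (b - x))) has_vector_derivative ?g x) (at x)" for x
  proof -
    have "((\<lambda>x. flat k p (x - a) * flat k q (b - x)) has_real_derivative
       (flat k (?D p) (x - a) * 1 * flat k q (b - x) + (flat k (?D q) (b - x) * (- 1)) * flat k p (x - a))) (at x)"
      by (intro DERIV_mult DERIV_chain2[OF flat_has_real_derivative[OF assms(1)]]) (auto intro!: derivative_eq_intros)
    moreover have "flat k (- ?D q) y = - flat k (?D q) y" for y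
      unfolding flat_def poly_minus by simp
    ultimately have "((\<lambda>x. flat k p (x - a) * flat k q (b - x)) has_real_derivative
       (flat k (?D p) (x - a) * flat k q (b - x) + flat k p (x - a) * flat k (- ?D q) (b - x))) (at x)"
      by (simp add: mult.commute)
    then show ?thesis
      unfolding of_real_add[symmetric] by (rule has_vector_derivative_of_real)
  qed
  moreover have "?g \<in> bumps k a b"
    by (intro bumps.add bumps.base)
  ultimately show ?case by (intro bexI[of _ ?g] allI)
next
  case (add f g)
  obtain f' where f': "f' \<in> bumps k a b" "\<forall>x. (f has_vector_derivative f' x) (at x)"
    using add.IH(1) by (rule bexE)
  obtain g' where g': "g' \<in> bumps k a b" "\<forall>x. (g has_vector_derivative g' x) (at x)"
    using add.IH(2) by (rule bexE)
  show ?case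
    using f'(1) g'(1) f'(2)[rule_format] g'(2)[rule_format]
    by (intro bexI[of _ "\<lambda>x. f' x + g' x"] allI has_vector_derivative_add bumps.add)
qed

lemma bumps_support: "f \<in> bumps k a b \<Longrightarrow> x \<notin> {a..b} \<Longrightarrow> f x = 0"
  by (induction rule: bumps.induct) (auto simp: flat_def)

lemma bumps_subset_schwartz:
  assumes "k > 0" "f \<in> bumps k a b"
  shows "f \<in> schwartz"
proof (rule schwartz_coinduct[where A="bumps k a b"])
  fix g assume g: "g \<in> bumps k a b"
  from bumps_derivative[OF assms(1) this] obtain g' where
    g': "g' \<in> bumps k a b" "\<And>x. (g has_vector_derivative g' x) (at x)" by blast
  show "g differentiable at x" for x
    using g'(2) by (rule differentiableI_vector)
  have "vderiv g = g'" using vector_derivative_at[OF g'(2)] by blast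
  then show "vderiv g \<in> bumps k a b" using g' by simp
  fix n
  have "continuous_on {a..b} (\<lambda>x. \<bar>x\<bar> ^ n * cmod (g x))"
    using g'(2) by (intro continuous_intros continuous_at_imp_continuous_on ballI has_vector_derivative_continuous)
  then have "bdd_above ((\<lambda>x. \<bar>x\<bar> ^ n * cmod (g x)) ` {a..b})"
    by (intro bounded_imp_bdd_above compact_imp_bounded compact_continuous_image) auto
  then obtain C where C: "\<forall>x\<in>{a..b}. \<bar>x\<bar> ^ n * cmod (g x) \<le> C"
    by (auto simp: bdd_above_def)
  \<comment> \<open>The maximum with 0 covers points outside \<open>[a, b]\<close>, also when the
    interval is empty and \<open>C\<close> is arbitrary.\<close>
  have "\<bar>x\<bar> ^ n * cmod (g x) \<le> max C 0" for x
    using C bumps_support[OF g, of x] by (cases "x \<in> {a..b}") (auto intro: max.coboundedI1)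
  then show "\<exists>C. \<forall>x. \<bar>x\<bar> ^ n * cmod (g x) \<le> C" by blast
qed (rule assms)

text \<open>The parameter \<open>k\<close> controls the steepness at the endpoints: as it decreases
  to 0 the function increases to the indicator of the open interval. A fixed \<open>k\<close>
  supplies a smooth witness.\<close>

definition bump :: "real \<Rightarrow> real \<Rightarrow> real \<Rightarrow> real \<Rightarrow> complex" where
  "bump k a b x = of_real (flat k 1 (x - a) * flat k 1 (b - x))"

lemma bump_schwartz: "k > 0 \<Longrightarrow> bump k a b \<in> schwartz"
  unfolding bump_def[abs_def] by (rule bumps_subset_schwartz[OF _ bumps.base])

lemma norm_bump:
  "cmod (bump k a b x) = (if a < x \<and> x < b then exp (- (k * inverse (x - a))) * exp (- (k * inverse (b - x))) else 0)"
  by (auto simp: bump_def flat_def norm_mult)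

lemma norm_bump_le_indicator:
  assumes "k \<ge> 0"
  shows "cmod (bump k a b x) \<le> indicator {a<..<b} x"
  using assms by (auto simp: norm_bump indicator_def intro!: mult_le_one)

lemma bump_tendsto_indicator:
  "(\<lambda>n. bump (1 / real (Suc n)) a b x) \<longlonglongrightarrow> indicator {a<..<b} x"
proof (cases "x \<in> {a<..<b}")
  case True
  have "(\<lambda>n. complex_of_real (exp (- (1 / real (Suc n) * inverse (x - a))) * exp (- (1 / real (Suc n) * inverse (b - x)))))
     \<longlonglongrightarrow> of_real (exp (- (0 * inverse (x - a))) * exp (- (0 * inverse (b - x))))"
    by (intro tendsto_intros LIMSEQ_Suc[OF lim_1_over_n])
  then show ?thesis using True by (simp add: bump_def flat_def)
qed (auto simp: bump_def flat_def)

text \<open>Steep bumps approximate the indicator of any open interval from below, and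
  \<open>g\<close> restricted to the closed interval dominates; this reduces the claim to vanishing
  interval integrals.\<close>

lemma AE_zero_if_schwartz_integrals_zero:
  fixes g :: "real \<Rightarrow> complex"
  assumes g: "square_integrable g"
    and zero: "\<And>\<phi>. \<phi> \<in> schwartz \<Longrightarrow> (\<integral>x. g x * \<phi> x \<partial>lebesgue) = 0"
  shows "AE x in lebesgue. g x = 0"
proof (rule AE_zero_if_interval_integrals_zero[OF g])
  fix a b :: real
  let ?\<phi> = "\<lambda>n. bump (1 / real (Suc n)) a b"
  have [measurable]: "g \<in> borel_measurable lebesgue" "?\<phi> n \<in> borel_measurable lebesgue" for n
    using g bump_schwartz[THEN schwartz_measurable(2)] by (auto simp: square_integrable_iff)
  have i: "integrable lebesgue (\<lambda>x. g x * indicator {a..b} x)"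
    by (rule integrable_mult_L2[OF g square_integrable_indicator])
  have "(\<lambda>n. \<integral>x. g x * ?\<phi> n x \<partial>lebesgue) \<longlonglongrightarrow> (\<integral>x. g x * indicator {a<..<b} x \<partial>lebesgue)"
  proof (rule integral_dominated_convergence[where w="\<lambda>x. cmod (g x * indicator {a..b} x)"])
    show "AE x in lebesgue. (\<lambda>n. g x * ?\<phi> n x) \<longlonglongrightarrow> g x * indicator {a<..<b} x"
      by (intro AE_I2 tendsto_intros bump_tendsto_indicator)
    show "AE x in lebesgue. cmod (g x * ?\<phi> n x) \<le> cmod (g x * indicator {a..b} x)" for n
    proof (rule AE_I2)
      fix x
      have "cmod (?\<phi> n x) \<le> indicator {a<..<b} x"
        by (rule norm_bump_le_indicator) auto
      also have "\<dots> \<le> cmod (indicator {a..b} x)" by (auto split: split_indicator)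
      finally show "cmod (g x * ?\<phi> n x) \<le> cmod (g x * indicator {a..b} x)"
        unfolding norm_mult by (intro mult_left_mono) auto
    qed
    show "(\<lambda>x. g x * indicator {a<..<b} x) \<in> borel_measurable lebesgue" by measurable
    show "(\<lambda>x. g x * ?\<phi> n x) \<in> borel_measurable lebesgue" for n by measurable
    show "integrable lebesgue (\<lambda>x. cmod (g x * indicator {a..b} x))" using i by (rule integrable_norm)
  qed
  moreover have "(\<integral>x. g x * ?\<phi> n x \<partial>lebesgue) = 0" for n
    by (rule zero[OF bump_schwartz]) auto
  ultimately show "(\<integral>x. g x * indicator {a<..<b} x \<partial>lebesgue) = 0"
    by (simp add: LIMSEQ_const_iff)
qed

section \<open>Trigonometric polynomials and the translations they induce\<close>

lemma fourier_sum:
  assumes "\<And>j. j \<in> J \<Longrightarrow> integrable lebesgue (f j)"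
  shows "fourier (\<lambda>x. \<Sum>j\<in>J. f j x) \<xi> = (\<Sum>j\<in>J. fourier (f j) \<xi>)"
proof -
  have "integrable lebesgue (\<lambda>x. f j x * cis (- (x * \<xi>)))" if "j \<in> J" for j
    using assms[OF that] by (intro integrable_mult_bounded[where C=1]) auto
  then show ?thesis
    unfolding fourier_def sum_distrib_right by (rule Bochner_Integration.integral_sum)
qed

lemma fourier_cmult: "fourier (\<lambda>x. c * f x) \<xi> = c * fourier f \<xi>"
  unfolding fourier_def by (simp add: mult.assoc)

text \<open>Arbitrary index sets and coefficients are allowed so that the difference of two members
  of the sequence has the same form as a member.\<close>

definition comb_symbol :: "nat set \<Rightarrow> (nat \<Rightarrow> complex) \<Rightarrow> real \<Rightarrow> complex" where
  "comb_symbol J \<alpha> \<xi> = (\<Sum>j\<in>J. \<alpha> j * cis (real j * \<xi>))"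

text \<open>The integral of \<open>f\<close> against \<open>comb_symbol J \<alpha>\<close>, since
  integrating \<open>f \<xi> * cis (real j * \<xi>)\<close> gives the transform of \<open>f\<close>
  at \<open>- real j\<close>.\<close>

definition comb_distribution :: "nat set \<Rightarrow> (nat \<Rightarrow> complex) \<Rightarrow> (real \<Rightarrow> complex) \<Rightarrow> complex" where
  "comb_distribution J \<alpha> f = (\<Sum>j\<in>J. \<alpha> j * fourier f (- real j))"

definition comb_shift :: "nat set \<Rightarrow> (nat \<Rightarrow> complex) \<Rightarrow> (real \<Rightarrow> complex) \<Rightarrow> real \<Rightarrow> complex" where
  "comb_shift J \<alpha> u x = (\<Sum>j\<in>J. \<alpha> j * u (x + real j))"

lemma comb_shift_measurable:
  assumes "u \<in> borel_measurable lebesgue"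
  shows "comb_shift J \<alpha> u \<in> borel_measurable lebesgue"
proof -
  have "(\<lambda>x. u (x + real j)) \<in> borel_measurable lebesgue" for j
    using measurable_lebesgue_affine[OF assms, of 1 "real j"] by (simp add: add.commute)
  then show ?thesis unfolding comb_shift_def[abs_def] by measurable
qed

lemma comb_symbol_measurable: "comb_symbol J \<alpha> \<in> borel_measurable lebesgue"
  unfolding comb_symbol_def[abs_def] by measurable

lemma norm_comb_symbol_le: "cmod (comb_symbol J \<alpha> \<xi>) \<le> (\<Sum>j\<in>J. cmod (\<alpha> j))"
  unfolding comb_symbol_def by (rule order_trans[OF norm_sum]) (simp add: norm_mult)

lemma essentially_bounded_comb_symbol: "essentially_bounded (comb_symbol J \<alpha>)"
  unfolding essentially_bounded_def using comb_symbol_measurable norm_comb_symbol_le by blast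

lemma tempered_comb_distribution: "tempered (comb_distribution J \<alpha>)"
  unfolding tempered_def
proof (intro conjI ballI allI exI)
  fix f g assume "f \<in> schwartz" "g \<in> schwartz"
  then have "fourier (\<lambda>x. f x + g x) \<xi> = fourier f \<xi> + fourier g \<xi>" for \<xi>
    using fourier_diff[OF schwartz_integrable schwartz_integrable, of f "\<lambda>x. - 1 * g x"]
      schwartz_cmult[of g "- 1"] fourier_cmult[of "- 1" g] by simp
  then show "comb_distribution J \<alpha> (\<lambda>x. f x + g x) = comb_distribution J \<alpha> f + comb_distribution J \<alpha> g"
    by (simp add: comb_distribution_def distrib_left sum.distrib)
next
  fix f c
  show "comb_distribution J \<alpha> (\<lambda>x. c * f x) = c * comb_distribution J \<alpha> f"
    by (simp add: comb_distribution_def fourier_cmult sum_distrib_left mult_ac)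
next
  fix f assume f: "f \<in> schwartz"
  let ?K = "\<integral>x. inverse (1 + x\<^sup>2) \<partial>(lebesgue :: real measure)" and ?S = "\<Sum>k\<le>2. \<Sum>m\<le>2. schwartz_seminorm k m f"
  have "cmod (comb_distribution J \<alpha> f) \<le> (\<Sum>j\<in>J. cmod (\<alpha> j) * (?K * ?S))"
    unfolding comb_distribution_def
  proof (rule order_trans[OF norm_sum sum_mono])
    fix j
    show "cmod (\<alpha> j * fourier f (- real j)) \<le> cmod (\<alpha> j) * (?K * ?S)"
      unfolding norm_mult
      using order_trans[OF norm_fourier_le schwartz_integral_bound[OF f]] by (intro mult_left_mono) auto
  qed
  then show "cmod (comb_distribution J \<alpha> f) \<le> (\<Sum>j\<in>J. cmod (\<alpha> j)) * ?K * ?S"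
    by (simp add: sum_distrib_right mult.assoc)
qed

text \<open>Modulation by \<open>x\<close> shifts the evaluation point of the double transform to
  \<open>- (x + real j)\<close>, where inversion gives \<open>2 * pi * u (x + real j)\<close>; the
  factor in \<open>fm_op_S\<close> cancels \<open>2 * pi\<close>.\<close>

lemma fm_op_S_comb_distribution:
  assumes u: "u \<in> schwartz"
  shows "fm_op_S (comb_distribution J \<alpha>) u = comb_shift J \<alpha> u"
proof
  fix x
  have "fourier (\<lambda>\<xi>. fourier u \<xi> * cis (x * \<xi>)) (- real j) = 2 * pi * u (x + real j)" for j
  proof -
    have "- real j - x = - (x + real j)" by simp
    then show ?thesis by (simp only: fourier_modulation schwartz_fourier_inversion[OF u])
  qed
  then show "fm_op_S (comb_distribution J \<alpha>) u x = comb_shift J \<alpha> u x"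
    by (simp add: fm_op_S_def comb_distribution_def comb_shift_def sum_divide_distrib)
qed

lemma square_integrable_mult_bounded:
  assumes "essentially_bounded a" "square_integrable u"
  shows "square_integrable (\<lambda>x. a x * u x)"
proof -
  obtain C where C: "AE x in lebesgue. cmod (a x) \<le> C" using assms(1) by (auto simp: essentially_bounded_def)
  have m: "a \<in> borel_measurable lebesgue" "u \<in> borel_measurable lebesgue"
    using assms by (auto simp: essentially_bounded_def square_integrable_iff)
  from C have "AE x in lebesgue. cmod (a x * u x) \<le> C * cmod (u x)"
    by (rule eventually_mono) (simp add: norm_mult mult_right_mono)
  then show ?thesis
    using square_integrable_AE_bound[OF assms(2) borel_measurable_times[OF m]] by blast
qed

lemma square_integrable_comb_shift:
  assumes "square_integrable u" "finite J"
  shows "square_integrable (comb_shift J \<alpha> u)"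
  using assms(2)
proof induction
  case empty
  then show ?case by (simp add: comb_shift_def[abs_def] square_integrable_def)
next
  case (insert j J)
  have "square_integrable (\<lambda>x. u (x + real j))"
    using square_integrable_affine[OF assms(1), of 1 "real j"] by (simp add: add.commute)
  with insert show ?case
    by (auto simp: comb_shift_def[abs_def] intro!: square_integrable_add square_integrable_cmult)
qed

text \<open>The difference of both sides is tested against Schwartz functions. The pairings shift
  both transforms onto the test function, where inversion holds pointwise, and the resulting right
  translations are moved back onto \<open>u\<close> by substitution.\<close>

lemma fm_op_L2_comb_symbol:
  assumes u: "square_integrable u" and J: "finite J"
  shows "AE x in lebesgue. fm_op_L2 (comb_symbol J \<alpha>) u x = comb_shift J \<alpha> u x"
proof -
  let ?g = "\<lambda>\<xi>. comb_symbol J \<alpha> \<xi> * fourier_L2 u \<xi>" and ?Cu = "comb_shift J \<alpha> u"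
  have g: "square_integrable ?g"
    by (intro square_integrable_mult_bounded essentially_bounded_comb_symbol square_integrable_fourier_L2 u)
  have v: "square_integrable (inv_fourier_L2 ?g)" by (rule square_integrable_inv_fourier_L2[OF g])
  have Cu: "square_integrable ?Cu" by (rule square_integrable_comb_shift[OF u J])
  have "square_integrable (\<lambda>x. inv_fourier_L2 ?g x + (-1) * ?Cu x)"
    by (intro square_integrable_add square_integrable_cmult v Cu)
  then have d: "square_integrable (\<lambda>x. inv_fourier_L2 ?g x - ?Cu x)" by simp
  have "(\<integral>x. (inv_fourier_L2 ?g x - ?Cu x) * \<phi> x \<partial>lebesgue) = 0" if \<phi>: "\<phi> \<in> schwartz" for \<phi>
  proof -
    have \<phi>': "integrable lebesgue \<phi>" "square_integrable \<phi>"
      using \<phi> by (auto intro: schwartz_integrable schwartz_square_integrable)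
    \<comment> \<open>The inverse transform of \<open>\<phi>\<close>; multiplied by the symbol it
      becomes \<open>?\<psi>\<close>, whose transform is the sum of translates of
      \<open>\<phi>\<close> by \<open>real j\<close> to the right.\<close>
    let ?r = "\<lambda>\<xi>. of_real (1 / (2 * pi)) * fourier \<phi> (- \<xi>)"
    let ?\<psi> = "\<lambda>\<xi>. \<Sum>j\<in>J. \<alpha> j * (?r \<xi> * cis (real j * \<xi>))"
    have r: "integrable lebesgue ?r" "square_integrable ?r"
    proof -
      have "fourier \<phi> \<in> schwartz" by (rule schwartz_fourier[OF \<phi>])
      then show "integrable lebesgue ?r" "square_integrable ?r"
        using lebesgue_integrable_real_affine[OF schwartz_integrable, of "fourier \<phi>" "-1" 0]
          square_integrable_affine[OF schwartz_square_integrable, of "fourier \<phi>" "-1" 0]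
        by (auto intro!: integrable_mult_right square_integrable_cmult simp del: of_real_divide)
    qed
    have ri: "integrable lebesgue (\<lambda>\<xi>. \<alpha> j * (?r \<xi> * cis (real j * \<xi>)))" for j
      by (intro integrable_mult_right integrable_mult_bounded[OF r(1), of _ 1]) auto
    have psi_eq: "?\<psi> \<xi> = comb_symbol J \<alpha> \<xi> * ?r \<xi>" for \<xi>
      unfolding comb_symbol_def sum_distrib_right by (intro sum.cong) (simp_all only: mult_ac)
    have "square_integrable ?\<psi>"
      unfolding psi_eq by (intro square_integrable_mult_bounded essentially_bounded_comb_symbol r)
    moreover have "integrable lebesgue ?\<psi>" by (intro Bochner_Integration.integrable_sum ri)
    moreover have F\<psi>: "fourier ?\<psi> x = (\<Sum>j\<in>J. \<alpha> j * \<phi> (x - real j))" for x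
    proof -
      have "fourier ?\<psi> x = (\<Sum>j\<in>J. fourier (\<lambda>\<xi>. \<alpha> j * (?r \<xi> * cis (real j * \<xi>))) x)"
        by (rule fourier_sum[OF ri])
      moreover have "fourier (\<lambda>\<xi>. \<alpha> j * (?r \<xi> * cis (real j * \<xi>))) x = \<alpha> j * \<phi> (x - real j)" for j
        using schwartz_fourier_inversion[OF \<phi>, of "x - real j"]
        by (simp only: fourier_cmult fourier_modulation fourier_reflect) simp
      ultimately show ?thesis by (simp only:)
    qed
    ultimately have "(\<integral>\<xi>. fourier_L2 u \<xi> * ?\<psi> \<xi> \<partial>lebesgue) = (\<integral>x. u x * (\<Sum>j\<in>J. \<alpha> j * \<phi> (x - real j)) \<partial>lebesgue)"
      using fourier_L2_pairing[OF u, of ?\<psi>] by simp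
    moreover have "(\<integral>x. inv_fourier_L2 ?g x * \<phi> x \<partial>lebesgue) = (\<integral>\<xi>. fourier_L2 u \<xi> * ?\<psi> \<xi> \<partial>lebesgue)"
      unfolding inv_fourier_L2_pairing[OF g \<phi>'] psi_eq by (simp add: mult_ac)
    moreover have "(\<integral>x. u x * (\<Sum>j\<in>J. \<alpha> j * \<phi> (x - real j)) \<partial>lebesgue) = (\<integral>x. ?Cu x * \<phi> x \<partial>lebesgue)"
    proof -
      have s: "square_integrable (\<lambda>x. \<phi> (x - real j))" "square_integrable (\<lambda>x. u (x + real j))" for j
        using square_integrable_affine[OF \<phi>'(2), of 1 "- real j"] square_integrable_affine[OF u, of 1 "real j"]
        by (simp_all add: add.commute)
      have "(\<integral>x. u x * (\<Sum>j\<in>J. \<alpha> j * \<phi> (x - real j)) \<partial>lebesgue) = (\<Sum>j\<in>J. \<alpha> j * (\<integral>x. u x * \<phi> (x - real j) \<partial>lebesgue))"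
        using integrable_mult_L2[OF u s(1)]
        by (simp add: sum_distrib_left mult.left_commute[of "u _"])
      moreover have "(\<integral>x. u x * \<phi> (x - real j) \<partial>lebesgue) = (\<integral>x. u (x + real j) * \<phi> x \<partial>lebesgue)" for j
        using lebesgue_integral_real_affine[of 1 "\<lambda>x. u x * \<phi> (x - real j)" "real j"]
        by (simp add: add.commute)
      moreover have "(\<Sum>j\<in>J. \<alpha> j * (\<integral>x. u (x + real j) * \<phi> x \<partial>lebesgue)) = (\<integral>x. ?Cu x * \<phi> x \<partial>lebesgue)"
        using integrable_mult_L2[OF s(2) \<phi>'(2)]
        by (simp add: comb_shift_def sum_distrib_right mult.assoc)
      ultimately show ?thesis by (simp only:)
    qed
    ultimately show ?thesis
      using integrable_mult_L2[OF v \<phi>'(2)] integrable_mult_L2[OF Cu \<phi>'(2)]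
      by (simp add: left_diff_distrib)
  qed
  from AE_zero_if_schwartz_integrals_zero[OF d this] show ?thesis
    by (simp add: fm_op_L2_def)
qed

section \<open>Multipliers of the weighted space\<close>

lemma ennreal_divide_le:
  fixes a b :: ennreal
  assumes "a \<le> C * b" "b < \<infinity>"
  shows "a / b \<le> C"
\<comment> \<open>For \<open>b = 0\<close> the assumption forces \<open>a = 0\<close>, and
  \<open>0 / 0\<close> is \<open>0\<close> in \<open>ennreal\<close>.\<close>
proof (cases "b = 0")
  case False
  have "a / b \<le> C * b / b" using assms(1) by (rule divide_right_mono_ennreal)
  also have "\<dots> = C" using False assms(2) by (simp add: ennreal_mult_divide_eq)
  finally show ?thesis .
qed (use assms in simp)

text \<open>The Cauchy condition ranges over pairs in either order. Putting the sign into the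
  coefficients gives one formula for both, and leaves their moduli unchanged.\<close>

lemma sum_lessThan_diff:
  fixes f :: "nat \<Rightarrow> complex"
  shows "sum f {..<m} - sum f {..<n} = (\<Sum>j\<in>{min m n..<max m n}. (if n \<le> m then 1 else - 1) * f j)"
proof -
  have *: "sum f {..<m} - sum f {..<n} = sum f {n..<m}" if "n \<le> m" for m n :: nat
    using sum_diff_nat_ivl[of 0 n m f] that by (simp add: atLeast0LessThan)
  show ?thesis
  proof (cases "n \<le> m")
    case False
    then have "sum f {..<m} - sum f {..<n} = - sum f {m..<n}" using *[of m n] by (simp add: algebra_simps)
    then show ?thesis using False by (simp add: sum_negf min_def max_def)
  qed (use * in \<open>simp add: min_def max_def\<close>)
qed

text \<open>It converts convergence in multiplier norm into convergence of the images of one fixed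
  \<open>u\<close>, with \<open>y\<close> the norm of \<open>u\<close>.\<close>

lemma ennreal_tendsto_0_if_ratio_le:
  fixes f d :: "nat \<Rightarrow> ennreal"
  assumes "\<And>n. f n / y \<le> d n" "d \<longlonglongrightarrow> 0" "y \<noteq> 0" "y < \<infinity>"
  shows "f \<longlonglongrightarrow> 0"
proof (rule ennreal_tendsto_0_sandwich)
  have "(\<lambda>n. y * d n) \<longlonglongrightarrow> y * 0" using assms by (intro ennreal_tendsto_cmult) auto
  then show "(\<lambda>n. y * d n) \<longlonglongrightarrow> 0" by simp
  fix n
  have "f n = y * (f n / y)"
    using assms(3,4) by (simp add: ennreal_times_divide mult.commute[of y] ennreal_mult_divide_eq)
  also have "\<dots> \<le> y * d n" by (intro mult_left_mono assms) simp
  finally show "f n \<le> y * d n" .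
qed

lemma AE_imp_ex_Ioo:
  assumes "AE x in lebesgue. P x" "a < (b::real)"
  shows "\<exists>x\<in>{a<..<b}. P x"
proof (rule ccontr)
  assume "\<not> ?thesis"
  then have "AE x in lebesgue. x \<notin> {a<..<b}" using assms(1) by (auto elim!: eventually_mono)
  then have "{a<..<b} \<in> null_sets lebesgue" by (subst AE_iff_null_sets) auto
  then show False using assms(2) by (auto simp: null_sets_def)
qed

text \<open>The condition on \<open>w\<close> says that shifting the weight left by \<open>t\<close>
  gains \<open>exp (- (c * t))\<close>; it is the one property common to both weights on which the
  norm estimates rest.\<close>

locale weighted_norm =
  fixes \<rho> :: "(real \<Rightarrow> ennreal) \<Rightarrow> ennreal" and w :: "real \<Rightarrow> real" and c :: real
  assumes banach_norm: "banach_function_norm \<rho>" and invariant: "translation_invariant \<rho>" and c: "c > 0"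
    and w_pos: "\<And>x. w x > 0" and w_shift: "\<And>x t. t \<ge> 0 \<Longrightarrow> w x \<le> exp (- (c * t)) * w (x + t)"
begin

lemma w_mono: "x \<le> y \<Longrightarrow> w x \<le> w y"
proof -
  assume "x \<le> y"
  then have "w x \<le> exp (- (c * (y - x))) * w y" using w_shift[of "y - x" x] by simp
  also have "\<dots> \<le> 1 * w y"
    using \<open>x \<le> y\<close> c w_pos[of y] by (intro mult_right_mono) auto
  finally show ?thesis by simp
qed

text \<open>The weight carries no measurability assumption; the shift condition makes it monotone,
  hence Borel.\<close>

lemma w_measurable [measurable]: "w \<in> borel_measurable lebesgue"
proof -
  have "w \<in> borel_measurable borel" by (rule borel_measurable_mono) (auto intro: monoI w_mono)
  then show ?thesis by (simp add: measurable_completion)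
qed

lemmas rho_zero_iff = banach_norm[unfolded banach_function_norm_def, THEN conjunct1, rule_format]
lemmas rho_cmult = banach_norm[unfolded banach_function_norm_def, THEN conjunct2, THEN conjunct1, rule_format]
lemmas rho_add = banach_norm[unfolded banach_function_norm_def, THEN conjunct2, THEN conjunct2, THEN conjunct1, rule_format]
lemmas rho_mono = banach_norm[unfolded banach_function_norm_def, THEN conjunct2, THEN conjunct2, THEN conjunct2,
  THEN conjunct1, rule_format]
lemmas rho_indicator = banach_norm[unfolded banach_function_norm_def, THEN conjunct2, THEN conjunct2, THEN conjunct2,
  THEN conjunct2, THEN conjunct2, THEN conjunct1, rule_format]

section \<open>The weighted norm and its behaviour under left translation\<close>

lemma weighted_measurable_iff:
  "(\<lambda>x. f x * complex_of_real (w x)) \<in> borel_measurable lebesgue \<longleftrightarrow> f \<in> borel_measurable lebesgue"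
proof
  assume m: "(\<lambda>x. f x * complex_of_real (w x)) \<in> borel_measurable lebesgue"
  have "(\<lambda>x. f x * complex_of_real (w x) / complex_of_real (w x)) \<in> borel_measurable lebesgue"
    using m by measurable
  moreover have "f x * complex_of_real (w x) / complex_of_real (w x) = f x" for x
    using w_pos[of x] by simp
  ultimately show "f \<in> borel_measurable lebesgue" by simp
next
  assume [measurable]: "f \<in> borel_measurable lebesgue"
  show "(\<lambda>x. f x * complex_of_real (w x)) \<in> borel_measurable lebesgue" by measurable
qed

lemma wnorm_measurable:
  "f \<in> borel_measurable lebesgue \<Longrightarrow> wnorm \<rho> w f = \<rho> (\<lambda>x. ennreal (cmod (f x) * w x))"
  by (simp add: wnorm_def weighted_measurable_iff)

text \<open>The default value infinity on non-measurable functions lets a finite norm certify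
  measurability.\<close>

lemma wnorm_finite_measurable: "wnorm \<rho> w f < \<infinity> \<Longrightarrow> f \<in> borel_measurable lebesgue"
  by (auto simp: wnorm_def weighted_measurable_iff split: if_splits)

lemma wnorm_mono_AE:
  assumes [measurable]: "f \<in> borel_measurable lebesgue" "g \<in> borel_measurable lebesgue"
    and "AE x in lebesgue. cmod (g x) \<le> cmod (f x)"
  shows "wnorm \<rho> w g \<le> wnorm \<rho> w f"
proof -
  have "AE x in lebesgue. ennreal (cmod (g x) * w x) \<le> ennreal (cmod (f x) * w x)"
    using assms(3) by (rule eventually_mono) (auto intro!: ennreal_leI mult_right_mono less_imp_le[OF w_pos])
  then show ?thesis by (simp add: wnorm_measurable) (rule rho_mono; measurable)
qed

lemma wnorm_cong_AE:
  assumes "f \<in> borel_measurable lebesgue" "g \<in> borel_measurable lebesgue" "AE x in lebesgue. f x = g x"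
  shows "wnorm \<rho> w f = wnorm \<rho> w g"
  using assms by (intro antisym wnorm_mono_AE) (auto elim!: eventually_mono)

lemma wnorm_zero_iff:
  assumes [measurable]: "f \<in> borel_measurable lebesgue"
  shows "wnorm \<rho> w f = 0 \<longleftrightarrow> (AE x in lebesgue. f x = 0)"
proof -
  have "ennreal (cmod (f x) * w x) = 0 \<longleftrightarrow> f x = 0" for x
    using w_pos[of x] by (auto simp: ennreal_eq_0_iff mult_le_0_iff)
  then show ?thesis by (simp add: wnorm_measurable rho_zero_iff)
qed

lemma wnorm_add:
  assumes [measurable]: "f \<in> borel_measurable lebesgue" "g \<in> borel_measurable lebesgue"
  shows "wnorm \<rho> w (\<lambda>x. f x + g x) \<le> wnorm \<rho> w f + wnorm \<rho> w g"
proof -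
  have le: "ennreal (cmod (f x + g x) * w x) \<le> ennreal (cmod (f x) * w x) + ennreal (cmod (g x) * w x)" for x
  proof -
    have "cmod (f x + g x) * w x \<le> cmod (f x) * w x + cmod (g x) * w x"
      unfolding distrib_right[symmetric] by (intro mult_right_mono norm_triangle_ineq less_imp_le[OF w_pos])
    then have "ennreal (cmod (f x + g x) * w x) \<le> ennreal (cmod (f x) * w x + cmod (g x) * w x)"
      by (rule ennreal_leI)
    also have "\<dots> = ennreal (cmod (f x) * w x) + ennreal (cmod (g x) * w x)"
      by (intro ennreal_plus mult_nonneg_nonneg norm_ge_zero less_imp_le[OF w_pos])
    finally show ?thesis .
  qed
  have "wnorm \<rho> w (\<lambda>x. f x + g x) = \<rho> (\<lambda>x. ennreal (cmod (f x + g x) * w x))"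
    by (rule wnorm_measurable) measurable
  also have "\<dots> \<le> \<rho> (\<lambda>x. ennreal (cmod (f x) * w x) + ennreal (cmod (g x) * w x))"
    by (rule rho_mono) (use le in auto)
  also have "\<dots> \<le> wnorm \<rho> w f + wnorm \<rho> w g"
    unfolding wnorm_measurable[OF assms(1)] wnorm_measurable[OF assms(2)] by (rule rho_add) measurable
  finally show ?thesis .
qed

lemma wnorm_cmult:
  assumes [measurable]: "f \<in> borel_measurable lebesgue"
  shows "wnorm \<rho> w (\<lambda>x. a * f x) = ennreal (cmod a) * wnorm \<rho> w f"
proof -
  have "ennreal (cmod (a * f x) * w x) = ennreal (cmod a) * ennreal (cmod (f x) * w x)" for x
    using w_pos[of x] by (simp add: norm_mult mult.assoc ennreal_mult less_imp_le)
  then show ?thesis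
    by (simp add: wnorm_measurable) (subst rho_cmult; simp)
qed

text \<open>Invariance belongs to the unweighted space, so it is applied to the product of
  \<open>f\<close> and \<open>w\<close>, which translates the weight as well. Comparing
  \<open>w x\<close> with \<open>w (x + t)\<close> then yields the exponential gain.\<close>

lemma wnorm_shift:
  assumes f: "wnorm \<rho> w f < \<infinity>" and t: "t \<ge> 0"
  shows "wnorm \<rho> w (\<lambda>x. f (x + t)) \<le> ennreal (exp (- (c * t))) * wnorm \<rho> w f"
proof -
  have m[measurable]: "f \<in> borel_measurable lebesgue" by (rule wnorm_finite_measurable[OF f])
  have [measurable]: "(\<lambda>x. f (x + t)) \<in> borel_measurable lebesgue" "(\<lambda>x. w (x + t)) \<in> borel_measurable lebesgue"
    using measurable_lebesgue_affine[of f borel 1 t] measurable_lebesgue_affine[of w borel 1 t] by (simp_all add: add.commute)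
  define u where "u = (\<lambda>x. f x * complex_of_real (w x))"
  have u: "ennreal (cmod (u x)) = ennreal (cmod (f x) * w x)" for x
    using w_pos[of x] by (simp add: u_def norm_mult)
  have "in_Y \<rho> u"
    using f unfolding in_Y_def u by (simp add: wnorm_measurable) (simp add: u_def)
  then have "\<rho> (\<lambda>x. ennreal (cmod (u (x - (- t))))) = \<rho> (\<lambda>x. ennreal (cmod (u x)))"
    using invariant unfolding translation_invariant_def by blast
  then have eq: "\<rho> (\<lambda>x. ennreal (cmod (f (x + t)) * w (x + t))) = wnorm \<rho> w f"
    by (simp add: u wnorm_measurable)
  have "wnorm \<rho> w (\<lambda>x. f (x + t)) = \<rho> (\<lambda>x. ennreal (cmod (f (x + t)) * w x))"
    by (rule wnorm_measurable) measurable
  also have "\<dots> \<le> \<rho> (\<lambda>x. ennreal (exp (- (c * t))) * ennreal (cmod (f (x + t)) * w (x + t)))"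
  proof (rule rho_mono)
    have "ennreal (cmod (f (x + t)) * w x) \<le> ennreal (exp (- (c * t))) * ennreal (cmod (f (x + t)) * w (x + t))" for x
    proof -
      have "cmod (f (x + t)) * w x \<le> exp (- (c * t)) * (cmod (f (x + t)) * w (x + t))"
        using mult_left_mono[OF w_shift[OF t, of x] norm_ge_zero[of "f (x + t)"]] by (simp add: mult_ac)
      then show ?thesis
        using w_pos[of "x + t"] by (subst ennreal_mult[symmetric]) (auto intro!: ennreal_leI)
    qed
    then show "AE x in lebesgue. ennreal (cmod (f (x + t)) * w x) \<le> ennreal (exp (- (c * t))) * ennreal (cmod (f (x + t)) * w (x + t))"
      by simp
  qed measurable
  also have "\<dots> = ennreal (exp (- (c * t))) * wnorm \<rho> w f"
    unfolding eq[symmetric] by (rule rho_cmult) auto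
  finally show ?thesis .
qed

lemma wnorm_comb_shift:
  assumes f: "wnorm \<rho> w f < \<infinity>" and J: "finite J"
  shows "wnorm \<rho> w (comb_shift J \<alpha> f) \<le> ennreal (\<Sum>j\<in>J. cmod (\<alpha> j) * exp (- (c * real j))) * wnorm \<rho> w f"
  using J
proof induction
  case empty
  have "wnorm \<rho> w (comb_shift {} \<alpha> f) = 0" by (subst wnorm_zero_iff) (auto simp: comb_shift_def[abs_def])
  then show ?case by simp
next
  case (insert j J)
  have m: "f \<in> borel_measurable lebesgue" by (rule wnorm_finite_measurable[OF f])
  then have mj: "(\<lambda>x. f (x + real j)) \<in> borel_measurable lebesgue"
    using measurable_lebesgue_affine[of f borel 1 "real j"] by (simp add: add.commute)
  have "wnorm \<rho> w (comb_shift (insert j J) \<alpha> f) = wnorm \<rho> w (\<lambda>x. \<alpha> j * f (x + real j) + comb_shift J \<alpha> f x)"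
    using insert by (simp add: comb_shift_def[abs_def])
  also have "\<dots> \<le> wnorm \<rho> w (\<lambda>x. \<alpha> j * f (x + real j)) + wnorm \<rho> w (comb_shift J \<alpha> f)"
    using mj comb_shift_measurable[OF m] by (intro wnorm_add) auto
  also have "\<dots> \<le> ennreal (cmod (\<alpha> j)) * (ennreal (exp (- (c * real j))) * wnorm \<rho> w f)
      + ennreal (\<Sum>j\<in>J. cmod (\<alpha> j) * exp (- (c * real j))) * wnorm \<rho> w f"
    unfolding wnorm_cmult[OF mj] by (intro add_mono insert.IH mult_left_mono wnorm_shift f) auto
  also have "\<dots> = ennreal (\<Sum>j\<in>insert j J. cmod (\<alpha> j) * exp (- (c * real j))) * wnorm \<rho> w f"
    using insert by (simp add: ennreal_plus sum_nonneg ennreal_mult distrib_right mult.assoc)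
  finally show ?case .
qed

lemma mult_norm_S_comb:
  assumes "finite J"
  shows "mult_norm_S \<rho> w (comb_distribution J \<alpha>) \<le> ennreal (\<Sum>j\<in>J. cmod (\<alpha> j) * exp (- (c * real j)))"
  unfolding mult_norm_S_def
proof (rule SUP_least)
  fix u assume "u \<in> {u \<in> schwartz. wnorm \<rho> w u < \<infinity> \<and> u \<noteq> (\<lambda>_. 0)}"
  then show "wnorm \<rho> w (fm_op_S (comb_distribution J \<alpha>) u) / wnorm \<rho> w u \<le> ennreal (\<Sum>j\<in>J. cmod (\<alpha> j) * exp (- (c * real j)))"
    using assms by (intro ennreal_divide_le) (auto simp: fm_op_S_comb_distribution intro!: wnorm_comb_shift)
qed

lemma mult_norm_L2_comb:
  assumes J: "finite J"
  shows "mult_norm_L2 \<rho> w (comb_symbol J \<alpha>) \<le> ennreal (\<Sum>j\<in>J. cmod (\<alpha> j) * exp (- (c * real j)))"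
  unfolding mult_norm_L2_def
proof (rule SUP_least)
  fix u assume "u \<in> {u. square_integrable u \<and> wnorm \<rho> w u < \<infinity> \<and> \<not> (AE x in lebesgue. u x = 0)}"
  then have u: "square_integrable u" "wnorm \<rho> w u < \<infinity>" by auto
  have "square_integrable (fm_op_L2 (comb_symbol J \<alpha>) u)"
    unfolding fm_op_L2_def
    by (intro square_integrable_inv_fourier_L2 square_integrable_mult_bounded essentially_bounded_comb_symbol square_integrable_fourier_L2 u)
  then have "wnorm \<rho> w (fm_op_L2 (comb_symbol J \<alpha>) u) = wnorm \<rho> w (comb_shift J \<alpha> u)"
    using square_integrable_comb_shift[OF u(1) J]
    by (intro wnorm_cong_AE fm_op_L2_comb_symbol u J) (auto simp: square_integrable_iff)
  then show "wnorm \<rho> w (fm_op_L2 (comb_symbol J \<alpha>) u) / wnorm \<rho> w u \<le> ennreal (\<Sum>j\<in>J. cmod (\<alpha> j) * exp (- (c * real j)))"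
    using u J by (intro ennreal_divide_le) (auto intro!: wnorm_comb_shift)
qed

text \<open>The rate \<open>c / 2\<close> lies strictly between 0 and \<open>c\<close>: against the
  translation bound \<open>exp (- (c * j))\<close> it leaves the geometric series of
  \<open>exp (- c / 2)\<close>, while the coefficients themselves grow exponentially.\<close>

definition coeff_seq :: "nat \<Rightarrow> complex" where
  "coeff_seq j = of_real (exp (c * real j / 2))"

lemma small_coeff_sums:
  assumes "\<epsilon> > 0"
  shows "\<exists>N. \<forall>m\<ge>N. \<forall>n. (\<Sum>j\<in>{m..<n}. cmod (coeff_seq j) * exp (- (c * real j))) < \<epsilon>"
proof -
  have "cmod (coeff_seq j) * exp (- (c * real j)) = exp (- c / 2) ^ j" for j
    by (simp add: coeff_seq_def exp_of_nat_mult[symmetric] mult_exp_exp algebra_simps)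
  moreover have "summable (\<lambda>j. exp (- c / 2) ^ j)"
    using c by (intro summable_geometric) simp
  ultimately have "summable (\<lambda>j. cmod (coeff_seq j) * exp (- (c * real j)))" by simp
  then obtain N where "\<And>m n. m \<ge> N \<Longrightarrow> norm (\<Sum>j\<in>{m..<n}. cmod (coeff_seq j) * exp (- (c * real j))) < \<epsilon>"
    using assms unfolding summable_Cauchy by blast
  then show ?thesis by (auto intro!: exI[of _ N] intro: le_less_trans[OF abs_ge_self])
qed

lemma comb_Cauchy:
  assumes d: "\<And>m n. d m n \<le> ennreal (\<Sum>j\<in>{min m n..<max m n}. cmod (coeff_seq j) * exp (- (c * real j)))"
  shows "\<forall>\<epsilon>>0. \<exists>N. \<forall>m\<ge>N. \<forall>n\<ge>N. d m n < ennreal \<epsilon>"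
proof (intro allI impI)
  fix \<epsilon> :: real assume "\<epsilon> > 0"
  then obtain N where "\<And>m n. m \<ge> N \<Longrightarrow> (\<Sum>j\<in>{m..<n}. cmod (coeff_seq j) * exp (- (c * real j))) < \<epsilon>"
    using small_coeff_sums by blast
  then have "d m n < ennreal \<epsilon>" if "m \<ge> N" "n \<ge> N" for m n
    using that \<open>\<epsilon> > 0\<close> by (intro le_less_trans[OF d] ennreal_lessI) auto
  then show "\<exists>N. \<forall>m\<ge>N. \<forall>n\<ge>N. d m n < ennreal \<epsilon>" by blast
qed

text \<open>On the open unit interval attached to \<open>j\<close> every partial sum with
  \<open>n > j\<close> reduces to the same translate. The error there does not depend on
  \<open>n\<close>, yet its norm is dominated by a null sequence.\<close>

lemma comb_limit:
  assumes u: "u \<in> borel_measurable lebesgue" "\<And>x. x \<notin> {0..1} \<Longrightarrow> u x = 0"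
    and lim: "(\<lambda>n. wnorm \<rho> w (\<lambda>x. comb_shift {..<n} coeff_seq u x - v x)) \<longlonglongrightarrow> 0"
  shows "AE x in lebesgue. x \<in> {- real j<..<1 - real j} \<longrightarrow> v x = coeff_seq j * u (x + real j)"
proof -
  let ?d = "\<lambda>n x. comb_shift {..<n} coeff_seq u x - v x" and ?I = "{- real j<..<1 - real j}"
  have cs: "comb_shift {..<n} coeff_seq u \<in> borel_measurable lebesgue" for n
    by (rule comb_shift_measurable[OF u(1)])
  \<comment> \<open>Nothing is known about the regularity of \<open>v\<close>. A single difference
    of finite norm is measurable, and subtracting it from the measurable partial sum recovers
    \<open>v\<close>.\<close>
  have "eventually (\<lambda>n. wnorm \<rho> w (?d n) < \<infinity>) sequentially"
    using lim by (rule order_tendstoD) simp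
  then obtain n where "wnorm \<rho> w (?d n) < \<infinity>" by (auto simp: eventually_sequentially)
  from borel_measurable_diff[OF cs[of n] wnorm_finite_measurable[OF this]]
  have v: "v \<in> borel_measurable lebesgue" by simp
  have uj: "(\<lambda>x. u (x + real j)) \<in> borel_measurable lebesgue"
    using measurable_lebesgue_affine[OF u(1), of 1 "real j"] by (simp add: add.commute)
  let ?h = "\<lambda>x. indicator ?I x * (coeff_seq j * u (x + real j) - v x)"
  have h: "?h \<in> borel_measurable lebesgue" using uj v by measurable
  have "wnorm \<rho> w ?h \<le> wnorm \<rho> w (?d n)" if "n \<ge> Suc j" for n
  proof (rule wnorm_mono_AE[OF _ h], use cs v in measurable, rule AE_I2)
    fix x
    have "comb_shift {..<n} coeff_seq u x = coeff_seq j * u (x + real j)" if "x \<in> ?I"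
    proof -
      \<comment> \<open>Openness of the interval matters: for \<open>i\<close> next to
        \<open>j\<close> the point \<open>x + real i\<close> lies strictly outside
        \<open>[0, 1]\<close>, whereas \<open>u\<close> may be nonzero at the endpoints.\<close>
      have "coeff_seq i * u (x + real i) = 0" if "i \<noteq> j" for i
      proof -
        have "x + real i \<notin> {0..1}"
        proof (cases "i < j")
          case True
          then have "real i + 1 \<le> real j" by linarith
          then show ?thesis using \<open>x \<in> ?I\<close> by auto
        next
          case False
          then have "real j + 1 \<le> real i" using that by linarith
          then show ?thesis using \<open>x \<in> ?I\<close> by auto
        qed
        then show ?thesis by (simp add: u(2))
      qed
      then have "(\<Sum>i<n. coeff_seq i * u (x + real i)) = (\<Sum>i\<in>{j}. coeff_seq i * u (x + real i))"
        using \<open>n \<ge> Suc j\<close> by (intro sum.mono_neutral_right) auto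
      then show ?thesis by (simp add: comb_shift_def)
    qed
    then show "cmod (?h x) \<le> cmod (?d n x)" by (auto simp: indicator_def)
  qed
  then have "eventually (\<lambda>n. wnorm \<rho> w ?h \<le> wnorm \<rho> w (?d n)) sequentially"
    unfolding eventually_sequentially by blast
  with lim have "wnorm \<rho> w ?h \<le> 0"
    by (intro tendsto_le[OF _ lim tendsto_const]) auto
  then have "AE x in lebesgue. ?h x = 0" using wnorm_zero_iff[OF h] by simp
  then show ?thesis by (rule eventually_mono) (auto split: split_indicator_asm)
qed

text \<open>On \<open>[0, 1]\<close> the increasing weight is at most \<open>w 1\<close>, so (A4)
  for that interval gives finiteness.\<close>

lemma wnorm_supported_finite:
  assumes "f \<in> borel_measurable lebesgue" "\<And>x. cmod (f x) \<le> indicator {0..1} x"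
  shows "wnorm \<rho> w f < \<infinity>"
proof -
  have m: "(indicator {0..1} :: real \<Rightarrow> ennreal) \<in> borel_measurable lebesgue" by auto
  have le: "ennreal (cmod (f x) * w x) \<le> ennreal (w 1) * indicator {0..1} x" for x
  proof (cases "x \<in> {0..1}")
    case True
    then have "cmod (f x) * w x \<le> 1 * w 1"
      using assms(2)[of x] w_pos[of x] by (intro mult_mono w_mono) auto
    then show ?thesis using True by (simp add: ennreal_leI)
  qed (use assms(2)[of x] in auto)
  have "wnorm \<rho> w f \<le> \<rho> (\<lambda>x. ennreal (w 1) * indicator {0..1} x)"
    unfolding wnorm_measurable[OF assms(1)] by (rule rho_mono) (use assms(1) m le in auto)
  also have "\<dots> = ennreal (w 1) * \<rho> (indicator {0..1})"
    using rho_cmult[OF m, of "w 1"] w_pos[of 1] by simp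
  also have "\<dots> < \<infinity>"
    using rho_indicator[of "{0..1}"] by (simp add: ennreal_mult_less_top)
  finally show ?thesis .
qed

text \<open>The test function must be Schwartz and nonzero on the whole open unit interval, with a
  computable lower bound in its middle; \<open>bump 1 0 1\<close> serves. Polynomial growth of
  \<open>fm_op_S b ?u\<close> then collides with the growth of \<open>coeff_seq\<close>.\<close>

lemma no_schwartz_limit:
  assumes b: "tempered b"
    and lim: "(\<lambda>n. mult_norm_S \<rho> w (\<lambda>f. comb_distribution {..<n} coeff_seq f - b f)) \<longlonglongrightarrow> 0"
  shows False
proof -
  let ?u = "bump 1 0 1"
  have u: "?u \<in> schwartz" by (rule bump_schwartz) simp
  have um: "?u \<in> borel_measurable lebesgue" by (rule schwartz_measurable(2)[OF u])
  have u0: "?u x \<noteq> 0" if "x \<in> {0<..<1}" for x using that by (simp add: bump_def flat_def)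
  have fin: "wnorm \<rho> w ?u < \<infinity>"
  proof (rule wnorm_supported_finite[OF um])
    show "cmod (?u x) \<le> indicator {0..1} x" for x
      using norm_bump_le_indicator[of 1 0 1 x] by (auto split: split_indicator_asm split_indicator)
  qed
  have ne: "wnorm \<rho> w ?u \<noteq> 0"
    using AE_imp_ex_Ioo[of "\<lambda>x. ?u x = 0" 0 1] u0 by (auto simp: wnorm_zero_iff[OF um])
  have op: "fm_op_S (\<lambda>f. comb_distribution {..<n} coeff_seq f - b f) ?u = (\<lambda>x. comb_shift {..<n} coeff_seq ?u x - fm_op_S b ?u x)" for n
    unfolding fm_op_S_comb_distribution[OF u, symmetric] by (auto simp: fm_op_S_def right_diff_distrib diff_divide_distrib)
  have conv: "(\<lambda>n. wnorm \<rho> w (\<lambda>x. comb_shift {..<n} coeff_seq ?u x - fm_op_S b ?u x)) \<longlonglongrightarrow> 0"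
  proof (rule ennreal_tendsto_0_if_ratio_le[OF _ lim ne fin])
    show "wnorm \<rho> w (\<lambda>x. comb_shift {..<n} coeff_seq ?u x - fm_op_S b ?u x) / wnorm \<rho> w ?u
       \<le> mult_norm_S \<rho> w (\<lambda>f. comb_distribution {..<n} coeff_seq f - b f)" for n
      unfolding mult_norm_S_def op[symmetric]
      using u fin u0[of "1/2"] by (intro SUP_upper) auto
  qed
  have AE: "AE x in lebesgue. x \<in> {- real j<..<1 - real j} \<longrightarrow> fm_op_S b ?u x = coeff_seq j * ?u (x + real j)" for j
    by (rule comb_limit[OF um _ conv]) (auto simp: bump_def flat_def)
  obtain C N where CN: "\<And>x. cmod (fm_op_S b ?u x) \<le> C * (1 + \<bar>x\<bar>) ^ N"
    using tempered_polynomial_growth[OF b u] by blast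
  have C0: "C \<ge> 0" using order_trans[OF norm_ge_zero CN[of 0]] by simp
  \<comment> \<open>In the middle half of the interval both reciprocals in the bump are at most 4,
    whence \<open>exp (- 8)\<close>. The identity holds only almost everywhere, which still provides
    a point there, and \<open>\<bar>x\<bar> \<le> 1 + real j\<close> gives the base
    \<open>2 + real j\<close>.\<close>
  have growth: "exp (c * real j / 2) * exp (- 8) \<le> C * (2 + real j) ^ N" for j
  proof -
    obtain x where x: "x \<in> {1/4 - real j<..<3/4 - real j}" and
      eq: "x \<in> {- real j<..<1 - real j} \<longrightarrow> fm_op_S b ?u x = coeff_seq j * ?u (x + real j)"
      using AE_imp_ex_Ioo[OF AE[of j], of "1/4 - real j" "3/4 - real j"] by auto
    have "exp (- 8) \<le> cmod (?u (x + real j))"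
    proof -
      have "inverse (x + real j) \<le> inverse (1/4)" "inverse (1 - (x + real j)) \<le> inverse (1/4)"
        using x le_imp_inverse_le[of "1/4" "x + real j"] le_imp_inverse_le[of "1/4" "1 - (x + real j)"]
        by simp_all
      then show ?thesis using x by (simp add: norm_bump mult_exp_exp)
    qed
    then have "exp (c * real j / 2) * exp (- 8) \<le> cmod (coeff_seq j * ?u (x + real j))"
      by (simp add: norm_mult coeff_seq_def)
    also have "\<dots> = cmod (fm_op_S b ?u x)" using eq x by auto
    also have "\<dots> \<le> C * (1 + \<bar>x\<bar>) ^ N" by (rule CN)
    also have "\<dots> \<le> C * (2 + real j) ^ N"
      using x C0 by (intro mult_left_mono power_mono) auto
    finally show ?thesis .
  qed
  \<comment> \<open>This choice gives \<open>exp (c * real j / 2) = exp (y j) * exp (- c)\<close>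
    and \<open>2 + real j = 2 / c * y j\<close>, so the growth estimate becomes a positive lower
    bound for a null sequence of the form \<open>y^N / exp y\<close>.\<close>
  define y where "y j = c / 2 * (2 + real j)" for j
  have "filterlim (\<lambda>j. 2 + real j) at_top sequentially"
    by (rule filterlim_tendsto_add_at_top[OF tendsto_const filterlim_real_sequentially])
  then have "filterlim y at_top sequentially"
    unfolding y_def using c by (intro filterlim_tendsto_pos_mult_at_top[OF tendsto_const]) auto
  then have "(\<lambda>j. y j ^ N / exp (y j)) \<longlonglongrightarrow> 0"
    by (rule filterlim_compose[OF tendsto_power_div_exp_0])
  then have "(\<lambda>j. C * (2 / c) ^ N * (y j ^ N / exp (y j))) \<longlonglongrightarrow> C * (2 / c) ^ N * 0"
    by (intro tendsto_intros)
  moreover have "exp (- 8) * exp (- c) \<le> C * (2 / c) ^ N * (y j ^ N / exp (y j))" for j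
  proof -
    have "2 / c * y j = 2 + real j" using c by (simp add: y_def)
    then have p: "(2 / c) ^ N * y j ^ N = (2 + real j) ^ N"
      by (simp only: power_mult_distrib[symmetric])
    have "exp (- 8) * exp (- c) * exp (y j) = exp (c * real j / 2) * exp (- 8)"
      by (simp add: y_def mult_exp_exp algebra_simps)
    also have "\<dots> \<le> C * ((2 / c) ^ N * y j ^ N)" unfolding p by (rule growth)
    finally have "exp (- 8) * exp (- c) \<le> C * ((2 / c) ^ N * y j ^ N) / exp (y j)"
      by (simp only: pos_le_divide_eq exp_gt_zero)
    then show ?thesis by (simp only: times_divide_eq_right mult.assoc)
  qed
  ultimately have "exp (- 8) * exp (- c) \<le> C * (2 / c) ^ N * 0"
    by (intro LIMSEQ_le_const) auto
  then show False by (simp add: mult_exp_exp)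
qed

text \<open>The indicator of \<open>[0, 1]\<close> is admissible here and makes the forced values
  constant on each interval. One interval far enough to the left already exceeds the finite square
  norm of the image.\<close>

lemma no_L2_limit:
  assumes b: "essentially_bounded b"
    and lim: "(\<lambda>n. mult_norm_L2 \<rho> w (\<lambda>x. comb_symbol {..<n} coeff_seq x - b x)) \<longlonglongrightarrow> 0"
  shows False
proof -
  let ?u = "indicator {0..1} :: real \<Rightarrow> complex"
  have u: "square_integrable ?u" by (rule square_integrable_indicator)
  have um: "?u \<in> borel_measurable lebesgue" by auto
  have fin: "wnorm \<rho> w ?u < \<infinity>"
    by (rule wnorm_supported_finite[OF um]) (auto split: split_indicator)
  have ne0: "\<not> (AE x in lebesgue. ?u x = 0)"
    using AE_imp_ex_Ioo[of "\<lambda>x. ?u x = 0" 0 1] by (auto split: split_indicator_asm)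
  then have ne: "wnorm \<rho> w ?u \<noteq> 0" by (simp add: wnorm_zero_iff[OF um])
  let ?v = "fm_op_L2 b ?u"
  have F: "square_integrable (fourier_L2 ?u)" by (rule square_integrable_fourier_L2[OF u])
  have sn: "square_integrable (\<lambda>\<xi>. comb_symbol {..<n} coeff_seq \<xi> * fourier_L2 ?u \<xi>)" for n
    by (intro square_integrable_mult_bounded essentially_bounded_comb_symbol F)
  have bF: "square_integrable (\<lambda>\<xi>. b \<xi> * fourier_L2 ?u \<xi>)"
    by (intro square_integrable_mult_bounded b F)
  have v: "square_integrable ?v"
    unfolding fm_op_L2_def by (rule square_integrable_inv_fourier_L2[OF bF])
  \<comment> \<open>Linearity in the symbol holds only almost everywhere, which is enough because
    the norm ignores null sets.\<close>
  have eq: "wnorm \<rho> w (fm_op_L2 (\<lambda>x. comb_symbol {..<n} coeff_seq x - b x) ?u)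
     = wnorm \<rho> w (\<lambda>x. comb_shift {..<n} coeff_seq ?u x - ?v x)" for n
  proof (rule wnorm_cong_AE)
    have "square_integrable (\<lambda>\<xi>. comb_symbol {..<n} coeff_seq \<xi> * fourier_L2 ?u \<xi> + (- 1) * (b \<xi> * fourier_L2 ?u \<xi>))"
      by (intro square_integrable_add square_integrable_cmult sn bF)
    then have d: "square_integrable (\<lambda>\<xi>. comb_symbol {..<n} coeff_seq \<xi> * fourier_L2 ?u \<xi> - b \<xi> * fourier_L2 ?u \<xi>)"
      by simp
    show "fm_op_L2 (\<lambda>x. comb_symbol {..<n} coeff_seq x - b x) ?u \<in> borel_measurable lebesgue"
      using square_integrable_inv_fourier_L2[OF d] by (simp add: fm_op_L2_def left_diff_distrib square_integrable_iff)
    show "(\<lambda>x. comb_shift {..<n} coeff_seq ?u x - ?v x) \<in> borel_measurable lebesgue"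
      using comb_shift_measurable[OF um] v by (intro borel_measurable_diff) (auto simp: square_integrable_iff)
    show "AE x in lebesgue. fm_op_L2 (\<lambda>x. comb_symbol {..<n} coeff_seq x - b x) ?u x = comb_shift {..<n} coeff_seq ?u x - ?v x"
      using inv_fourier_L2_diff[OF sn bF d] fm_op_L2_comb_symbol[OF u, of "{..<n}" coeff_seq, simplified]
    proof eventually_elim
      case (elim x)
      then show ?case by (simp only: fm_op_L2_def left_diff_distrib)
    qed
  qed
  have "(\<lambda>n. wnorm \<rho> w (\<lambda>x. comb_shift {..<n} coeff_seq ?u x - ?v x)) \<longlonglongrightarrow> 0"
  proof (rule ennreal_tendsto_0_if_ratio_le[OF _ lim ne fin])
    show "wnorm \<rho> w (\<lambda>x. comb_shift {..<n} coeff_seq ?u x - ?v x) / wnorm \<rho> w ?u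
       \<le> mult_norm_L2 \<rho> w (\<lambda>x. comb_symbol {..<n} coeff_seq x - b x)" for n
      unfolding mult_norm_L2_def eq[symmetric] by (rule SUP_upper) (use u fin ne0 in simp)
  qed
  then have AE: "AE x in lebesgue. x \<in> {- real j<..<1 - real j} \<longrightarrow> ?v x = coeff_seq j * ?u (x + real j)" for j
    by (rule comb_limit[OF um, rotated]) simp
  have ge: "ennreal (exp (c * real j)) \<le> sqnorm ?v" for j
  proof -
    have "ennreal (exp (c * real j)) = (\<integral>\<^sup>+x. ennreal (exp (c * real j)) * indicator {- real j<..<1 - real j} x \<partial>lebesgue)"
      by (subst nn_integral_cmult_indicator) auto
    also have "\<dots> \<le> sqnorm ?v"
      unfolding sqnorm_def
    proof (rule nn_integral_mono_AE)
      have sq: "(cmod (coeff_seq j))\<^sup>2 = exp (c * real j)"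
        by (simp add: coeff_seq_def power2_eq_square mult_exp_exp)
      show "AE x in lebesgue. ennreal (exp (c * real j)) * indicator {- real j<..<1 - real j} x \<le> ennreal ((cmod (?v x))\<^sup>2)"
        using AE[of j]
      proof eventually_elim
        case (elim x)
        show ?case
        proof (cases "x \<in> {- real j<..<1 - real j}")
          case True
          then have "?v x = coeff_seq j" using elim by auto
          then show ?thesis using True sq by simp
        qed simp
      qed
    qed
    finally show ?thesis .
  qed
  obtain B where B: "sqnorm ?v = ennreal B" "B \<ge> 0"
    using v unfolding square_integrable_iff by (cases "sqnorm ?v") auto
  have "exp (c * real j) \<le> B" for j using ge[of j] B by simp
  \<comment> \<open>Since \<open>exp t \<ge> 1 + t\<close>, an Archimedean choice of
    \<open>j\<close> already beats \<open>B\<close>.\<close>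
  moreover obtain j :: nat where "B / c < real j" using reals_Archimedean2 by blast
  then have "B < c * real j" using c by (simp add: field_simps)
  then have "B < exp (c * real j)" using exp_ge_add_one_self[of "c * real j"] by linarith
  ultimately show False by (meson not_less)
qed

section \<open>Incompleteness of the two multiplier spaces\<close>

lemma multipliers_S_not_complete:
  "not_complete_wrt (multipliers_S \<rho> w) (\<lambda>a b. mult_norm_S \<rho> w (\<lambda>f. a f - b f))"
  unfolding not_complete_wrt_def
proof (intro exI conjI allI)
  let ?s = "\<lambda>n. comb_distribution {..<n} coeff_seq"
  show "?s n \<in> multipliers_S \<rho> w" for n
    unfolding multipliers_S_def
    using tempered_comb_distribution le_less_trans[OF mult_norm_S_comb ennreal_less_top] by auto
  have eq: "(\<lambda>f. ?s m f - ?s n f) = comb_distribution {min m n..<max m n} (\<lambda>j. (if n \<le> m then 1 else - 1) * coeff_seq j)" for m n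
    unfolding comb_distribution_def sum_lessThan_diff by (simp only: mult.assoc)
  have "mult_norm_S \<rho> w (\<lambda>f. ?s m f - ?s n f) \<le> ennreal (\<Sum>j\<in>{min m n..<max m n}. cmod (coeff_seq j) * exp (- (c * real j)))" for m n
  proof -
    have "cmod ((if n \<le> m then 1 else - 1) * coeff_seq j) = cmod (coeff_seq j)" for j
      by (simp add: norm_mult)
    then show ?thesis
      using mult_norm_S_comb[of "{min m n..<max m n}" "\<lambda>j. (if n \<le> m then 1 else - 1) * coeff_seq j"]
      by (simp only: eq finite_atLeastLessThan)
  qed
  then have "\<forall>\<epsilon>>0. \<exists>N. \<forall>m\<ge>N. \<forall>n\<ge>N. mult_norm_S \<rho> w (\<lambda>f. ?s m f - ?s n f) < ennreal \<epsilon>"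
    by (rule comb_Cauchy)
  then show "\<epsilon> > 0 \<longrightarrow> (\<exists>N. \<forall>m\<ge>N. \<forall>n\<ge>N. mult_norm_S \<rho> w (\<lambda>f. ?s m f - ?s n f) < ennreal \<epsilon>)" for \<epsilon>
    by blast
  show "\<not> (\<exists>b\<in>multipliers_S \<rho> w. (\<lambda>n. mult_norm_S \<rho> w (\<lambda>f. ?s n f - b f)) \<longlonglongrightarrow> 0)"
    using no_schwartz_limit by (auto simp: multipliers_S_def)
qed

lemma multipliers_L2_not_complete:
  "not_complete_wrt (multipliers_L2 \<rho> w) (\<lambda>a b. mult_norm_L2 \<rho> w (\<lambda>x. a x - b x))"
  unfolding not_complete_wrt_def
proof (intro exI conjI allI)
  let ?s = "\<lambda>n. comb_symbol {..<n} coeff_seq"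
  show "?s n \<in> multipliers_L2 \<rho> w" for n
    unfolding multipliers_L2_def
    using essentially_bounded_comb_symbol le_less_trans[OF mult_norm_L2_comb ennreal_less_top] by auto
  have eq: "(\<lambda>x. ?s m x - ?s n x) = comb_symbol {min m n..<max m n} (\<lambda>j. (if n \<le> m then 1 else - 1) * coeff_seq j)" for m n
    unfolding comb_symbol_def sum_lessThan_diff by (simp only: mult.assoc)
  have "mult_norm_L2 \<rho> w (\<lambda>x. ?s m x - ?s n x) \<le> ennreal (\<Sum>j\<in>{min m n..<max m n}. cmod (coeff_seq j) * exp (- (c * real j)))" for m n
  proof -
    have "cmod ((if n \<le> m then 1 else - 1) * coeff_seq j) = cmod (coeff_seq j)" for j
      by (simp add: norm_mult)
    then show ?thesis
      using mult_norm_L2_comb[of "{min m n..<max m n}" "\<lambda>j. (if n \<le> m then 1 else - 1) * coeff_seq j"]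
      by (simp only: eq finite_atLeastLessThan)
  qed
  then have "\<forall>\<epsilon>>0. \<exists>N. \<forall>m\<ge>N. \<forall>n\<ge>N. mult_norm_L2 \<rho> w (\<lambda>x. ?s m x - ?s n x) < ennreal \<epsilon>"
    by (rule comb_Cauchy)
  then show "\<epsilon> > 0 \<longrightarrow> (\<exists>N. \<forall>m\<ge>N. \<forall>n\<ge>N. mult_norm_L2 \<rho> w (\<lambda>x. ?s m x - ?s n x) < ennreal \<epsilon>)" for \<epsilon>
    by blast
  show "\<not> (\<exists>b\<in>multipliers_L2 \<rho> w. (\<lambda>n. mult_norm_L2 \<rho> w (\<lambda>x. ?s n x - b x)) \<longlonglongrightarrow> 0)"
    using no_L2_limit by (auto simp: multipliers_L2_def)
qed

end

text \<open>The slope condition is given only on the right half line and the identity only on the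
  left. A shift that crosses the origin is compared through the value
  \<open>\<phi> 0 = 0\<close>.\<close>

lemma admissible_phi_shift:
  assumes \<phi>: "admissible_phi \<phi>" and t: "t \<ge> 0"
  shows "\<phi> x + t \<le> \<phi> (x + t)"
proof -
  have neg: "\<And>x. x \<le> 0 \<Longrightarrow> \<phi> x = x" and
    pos: "\<And>x z. 0 \<le> x \<Longrightarrow> x < z \<Longrightarrow> \<phi> z - \<phi> x \<ge> z - x"
    using \<phi> unfolding admissible_phi_def by (auto simp: le_divide_eq)
  consider "t = 0" | "x \<ge> 0" "t > 0" | "x + t \<le> 0" | "x < 0" "0 < x + t" using t by linarith
  then show ?thesis
  proof cases
    case 2
    then show ?thesis using pos[of x "x + t"] by simp
  next
    case 3
    then show ?thesis using neg[of x] neg[of "x + t"] t by simp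
  next
    case 4
    then show ?thesis using neg[of x] neg[of 0] pos[of 0 "x + t"] by simp
  qed simp
qed

theorem theorem6p5:
  fixes \<rho> :: "(real \<Rightarrow> ennreal) \<Rightarrow> ennreal" and w :: "real \<Rightarrow> real" and c :: real
  assumes "banach_function_norm \<rho>" and "translation_invariant \<rho>"
    and "c > 0"
    and "w = (\<lambda>x. exp (c * x)) \<or> (\<exists>\<phi>. admissible_phi \<phi> \<and> w = (\<lambda>x. exp (c * \<phi> x)))"
  shows "not_complete_wrt (multipliers_S \<rho> w)
           (\<lambda>a b. mult_norm_S \<rho> w (\<lambda>f. a f - b f))
       \<and> not_complete_wrt (multipliers_L2 \<rho> w)
           (\<lambda>a b. mult_norm_L2 \<rho> w (\<lambda>x. a x - b x))"
proof -
  \<comment> \<open>With the identity as \<open>\<phi>\<close> the first weight becomes an instance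
    of the second, so one interpretation handles both.\<close>
  have "admissible_phi (\<lambda>x. x)" by (simp add: admissible_phi_def)
  then obtain \<phi> where \<phi>: "admissible_phi \<phi>" and w: "w = (\<lambda>x. exp (c * \<phi> x))"
    using assms(4) by blast
  interpret weighted_norm \<rho> w c
  proof
    fix x t :: real assume "t \<ge> 0"
    then have "c * \<phi> x \<le> c * (\<phi> (x + t) - t)"
      using admissible_phi_shift[OF \<phi>, of t x] assms(3) by (intro mult_left_mono) auto
    then show "w x \<le> exp (- (c * t)) * w (x + t)"
      by (simp add: w mult_exp_exp algebra_simps)
  qed (use assms(1-3) in \<open>auto simp: w\<close>)
  show ?thesis
    using multipliers_S_not_complete multipliers_L2_not_complete by blast
qed

end
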